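(* Let $u$ be the weak solution of the heat equation with forcing $f$, and assume $u_{ttt},\ \Delta u_{tt},\ f_{tt}\in L^2(0,T;L^2(\Omega))$. Consider the Crank–Nicolson POD Galerkin reduced order model (CN POD-G-ROM), with POD basis built from the snapshots and their difference quotients, and let $e^k=u^k-u_r^k$ and $\phi_r^0=u_r^0-R_r(u^0)$. Then there is a constant $C>0$, independent of the discretization parameters ($N$, $\Delta t=T/N$, $r$) and of the ROM initial value $u_r^0\in X^r$, such that the following hold for all $N\ge1$ and $1\le r\le s$. When the $L^2$ POD basis is used ($\mathcal H=L^2(\Omega)$): $$\max_{1\le k\le N}\|e^k\|_{L^2}^2\le C\Big(\sum_{i=r+1}^s\lambda_i^{DQ}\|\varphi_i-R_r(\varphi_i)\|_{L^2}^2+\|\phi_r^0\|_{L^2}^2+\Delta t^4I(u,f)\Big),$$ $$\|e^N\|_{L^2}^2+\Delta t\sum_{n=0}^{N-1}\|\nabla e^{n+1/2}\|_{L^2}^2\le C\Big(\sum_{i=r+1}^s\lambda_i^{DQ}\big(\|\varphi_i-R_r(\varphi_i)\|_{L^2}^2+\|\nabla(\varphi_i-R_r(\varphi_i))\|_{L^2}^2\big)+\|\phi_r^0\|_{L^2}^2+\Delta t^4I(u,f)\Big).$$ When the $H^1_0$ POD basis is used ($\mathcal H=H^1_0(\Omega)$): $$\max_{1\le k\le N}\|e^k\|_{L^2}^2\le C\Big(\sum_{i=r+1}^s\lambda_i^{DQ}\|\varphi_i\|_{L^2}^2+\|\phi_r^0\|_{L^2}^2+\Delta t^4I(u,f)\Big),$$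 $$\|e^N\|_{L^2}^2+\Delta t\sum_{n=0}^{N-1}\|\nabla e^{n+1/2}\|_{L^2}^2\le C\Big(\sum_{i=r+1}^s(1+\|\varphi_i\|_{L^2}^2)\lambda_i^{DQ}+\|\phi_r^0\|_{L^2}^2+\Delta t^4I(u,f)\Big).$$
   Context: $\Omega\subset\mathbb R^d$ ($d\in\{1,2,3\}$) is a bounded open domain with Lipschitz boundary, $X=H^1_0(\Omega)$ with inner product $(u,v)_{H^1_0}=(\nabla u,\nabla v)_{L^2}$, $\nu>0$, $T>0$. $u(\cdot,t)\in X$, $t\in[0,T]$, satisfies $(\partial_tu,v)_{L^2}+\nu(\nabla u,\nabla v)_{L^2}=(f,v)_{L^2}$ for all $v\in X$, at every $t\in[0,T]$. The regularity hypothesis is understood to mean that $u$ and $f$ are regular enough in time that all quantities are well defined: $u\in H^3(0,T;L^2(\Omega))$, $\Delta u\in H^2(0,T;L^2(\Omega))$, $f\in H^2(0,T;L^2(\Omega))$ (continuous representatives in time). Set $$I(u,f)=\|u_{ttt}\|_{L^2(0,T;L^2)}^2+\|\Delta u_{tt}\|_{L^2(0,T;L^2)}^2+\|f_{tt}\|_{L^2(0,T;L^2)}^2.$$ Time grid: $\Delta t=T/N$, $t_n=n\Delta t$, $u^n=u(t_n)$. For any discrete or continuous time function $z$, $z^{n+1/2}:=\frac12(z^{n+1}+z^n)$ (an average, not a midpoint value), and $\partial z^{n+1}=(z^{n+1}-z^n)/\Delta t$. POD with difference quotients in the Hilbert space $\mathcal H$ ($\mathcal H=L^2(\Omega)$ or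 $\mathcal H=H^1_0(\Omega)$): let $v^n=u^n$ ($0\le n\le N$), $v^{N+n}=\partial u^n$ ($1\le n\le N$), and $K_{mn}=\frac1{2N+1}(v^m,v^n)_{\mathcal H}$, $0\le m,n\le 2N$, with eigenvalues $\lambda_1^{DQ}\ge\lambda_2^{DQ}\ge\dots\ge0$ and orthonormal eigenvectors $\mathbf z_i$; $s$ is the number of positive eigenvalues; the POD modes are $\varphi_i=(\lambda_i^{DQ})^{-1/2}(2N+1)^{-1/2}\sum_{m=0}^{2N}(\mathbf z_i)^mv^m$, $1\le i\le s$, which lie in $X$. $X^r=\mathrm{span}\{\varphi_1,\dots,\varphi_r\}$. Ritz projection $R_r:X\to X^r$: $(\nabla(w-R_r(w)),\nabla v_r)_{L^2}=0$ for all $v_r\in X^r$. CN POD-G-ROM: given $u_r^0\in X^r$, find $u_r^{n+1}\in X^r$, $n=0,\dots,N-1$, with $$(\partial u_r^{n+1},v_r)_{L^2}+\nu(\nabla u_r^{n+1/2},\nabla v_r)_{L^2}=(f^{n+1/2},v_r)_{L^2}\quad\forall v_r\in X^r.$$ *)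

theory Defs
  imports "HOL-Analysis.Analysis" "Jordan_Normal_Form.Char_Poly"
begin

text \<open>Elements of the Lebesgue and Sobolev spaces are represented by functions on the whole space
  of which only the values on \<open>\<Omega>\<close> (up to null sets) matter. Since both \<open>HOL-Analysis\<close> and
  \<open>Jordan_Normal_Form\<close> use the infix dot, \<^const>\<open>inner\<close> and \<^const>\<open>scalar_prod\<close> are
  written in prefix form.\<close>

definition L2 :: "'a::euclidean_space set \<Rightarrow> ('a \<Rightarrow> 'b::euclidean_space) set" where
  "L2 \<Omega> = {v. v \<in> borel_measurable (lebesgue_on \<Omega>) \<and>
                integrable (lebesgue_on \<Omega>) (\<lambda>x. (norm (v x))\<^sup>2)}"

definition l2_inner ::
  "'a::euclidean_space set \<Rightarrow> ('a \<Rightarrow> 'b::euclidean_space) \<Rightarrow> ('a \<Rightarrow> 'b) \<Rightarrow> real" where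
  "l2_inner \<Omega> v w = (LINT x|lebesgue_on \<Omega>. inner (v x) (w x))"

definition l2_norm :: "'a::euclidean_space set \<Rightarrow> ('a \<Rightarrow> 'b::euclidean_space) \<Rightarrow> real" where
  "l2_norm \<Omega> v = sqrt (l2_inner \<Omega> v v)"

definition pderiv_dir :: "'a::euclidean_space \<Rightarrow> ('a \<Rightarrow> real) \<Rightarrow> 'a \<Rightarrow> real" where
  "pderiv_dir b \<psi> x = frechet_derivative \<psi> (at x) b"

primrec Ck :: "nat \<Rightarrow> ('a::euclidean_space \<Rightarrow> real) \<Rightarrow> bool" where
  "Ck 0 \<psi> = continuous_on UNIV \<psi>"
| "Ck (Suc k) \<psi> = ((\<forall>x. \<psi> differentiable (at x)) \<and> (\<forall>b\<in>Basis. Ck k (pderiv_dir b \<psi>)))"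

definition test_functions :: "'a::euclidean_space set \<Rightarrow> ('a \<Rightarrow> real) set" where
  "test_functions \<Omega> =
     {\<psi>. (\<forall>k. Ck k \<psi>) \<and> compact (closure {x. \<psi> x \<noteq> 0}) \<and> closure {x. \<psi> x \<noteq> 0} \<subseteq> \<Omega>}"

definition grad :: "('a::euclidean_space \<Rightarrow> real) \<Rightarrow> 'a \<Rightarrow> 'a" where
  "grad \<psi> x = (\<Sum>b\<in>Basis. pderiv_dir b \<psi> x *\<^sub>R b)"

definition laplacian :: "('a::euclidean_space \<Rightarrow> real) \<Rightarrow> 'a \<Rightarrow> real" where
  "laplacian \<psi> x = (\<Sum>b\<in>Basis. pderiv_dir b (pderiv_dir b \<psi>) x)"

definition weak_gradient :: "'a::euclidean_space set \<Rightarrow> ('a \<Rightarrow> real) \<Rightarrow> ('a \<Rightarrow> 'a) \<Rightarrow> bool" where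
  "weak_gradient \<Omega> v g \<longleftrightarrow> (\<forall>\<psi>\<in>test_functions \<Omega>. \<forall>b\<in>Basis.
     (LINT x|lebesgue_on \<Omega>. v x * pderiv_dir b \<psi> x) =
     - (LINT x|lebesgue_on \<Omega>. inner (g x) b * \<psi> x))"

definition weak_laplacian :: "'a::euclidean_space set \<Rightarrow> ('a \<Rightarrow> real) \<Rightarrow> ('a \<Rightarrow> real) \<Rightarrow> bool" where
  "weak_laplacian \<Omega> v l \<longleftrightarrow> (\<forall>\<psi>\<in>test_functions \<Omega>.
     (LINT x|lebesgue_on \<Omega>. v x * laplacian \<psi> x) = (LINT x|lebesgue_on \<Omega>. l x * \<psi> x))"

definition H1 :: "'a::euclidean_space set \<Rightarrow> ('a \<Rightarrow> real) set" where
  "H1 \<Omega> = {v \<in> L2 \<Omega>. \<exists>g\<in>L2 \<Omega>. weak_gradient \<Omega> v g}"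

text \<open>The weak gradient is determined only up to a null set; a representative is chosen.\<close>

definition wgrad :: "'a::euclidean_space set \<Rightarrow> ('a \<Rightarrow> real) \<Rightarrow> 'a \<Rightarrow> 'a" where
  "wgrad \<Omega> v = (SOME g. g \<in> L2 \<Omega> \<and> weak_gradient \<Omega> v g)"

definition H10 :: "'a::euclidean_space set \<Rightarrow> ('a \<Rightarrow> real) set" where
  "H10 \<Omega> = {v \<in> H1 \<Omega>. \<exists>\<psi>. (\<forall>k::nat. \<psi> k \<in> test_functions \<Omega>) \<and>
      (\<lambda>k. l2_norm \<Omega> (\<lambda>x. \<psi> k x - v x)) \<longlonglongrightarrow> 0 \<and>
      (\<lambda>k. l2_norm \<Omega> (\<lambda>x. grad (\<psi> k) x - wgrad \<Omega> v x)) \<longlonglongrightarrow> 0}"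

definition h10_inner :: "'a::euclidean_space set \<Rightarrow> ('a \<Rightarrow> real) \<Rightarrow> ('a \<Rightarrow> real) \<Rightarrow> real" where
  "h10_inner \<Omega> v w = l2_inner \<Omega> (wgrad \<Omega> v) (wgrad \<Omega> w)"

text \<open>Locally, \<open>\<Omega>\<close> lies strictly on one side of the graph of a Lipschitz function over the
  hyperplane orthogonal to a unit vector \<open>e\<close>.\<close>

definition lipschitz_boundary :: "'a::euclidean_space set \<Rightarrow> bool" where
  "lipschitz_boundary \<Omega> \<longleftrightarrow> (\<forall>x\<in>frontier \<Omega>. \<exists>U e \<gamma> L.
     open U \<and> x \<in> U \<and> norm e = 1 \<and> L-lipschitz_on {y. inner y e = 0} (\<gamma> :: 'a \<Rightarrow> real) \<and>
     \<Omega> \<inter> U = {y \<in> U. \<gamma> (y - inner y e *\<^sub>R e) < inner y e})"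

definition l2_simple :: "'a::euclidean_space set \<Rightarrow> (real \<Rightarrow> 'a \<Rightarrow> real) \<Rightarrow> bool" where
  "l2_simple \<Omega> s \<longleftrightarrow> (\<exists>(n::nat) E w. (\<forall>i<n. E i \<in> sets lebesgue \<and> w i \<in> L2 \<Omega>) \<and>
     s = (\<lambda>t x. \<Sum>i<n. indicator (E i) t * w i x))"

text \<open>The Bochner space of square integrable functions on \<open>(0, T)\<close>: strongly measurable, i.e. almost
  everywhere a limit of simple functions, with square integrable norm.\<close>

definition L2L2 :: "real \<Rightarrow> 'a::euclidean_space set \<Rightarrow> (real \<Rightarrow> 'a \<Rightarrow> real) set" where
  "L2L2 T \<Omega> = {z. (AE t in lebesgue_on {0<..<T}. z t \<in> L2 \<Omega>) \<and>
     (\<exists>s. (\<forall>k::nat. l2_simple \<Omega> (s k)) \<and>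
          (AE t in lebesgue_on {0<..<T}. (\<lambda>k. l2_norm \<Omega> (\<lambda>x. s k t x - z t x)) \<longlonglongrightarrow> 0)) \<and>
     integrable (lebesgue_on {0<..<T}) (\<lambda>t. (l2_norm \<Omega> (z t))\<^sup>2)}"

definition L2L2_norm :: "real \<Rightarrow> 'a::euclidean_space set \<Rightarrow> (real \<Rightarrow> 'a \<Rightarrow> real) \<Rightarrow> real" where
  "L2L2_norm T \<Omega> z = sqrt (LINT t|lebesgue_on {0<..<T}. (l2_norm \<Omega> (z t))\<^sup>2)"

text \<open>The defining identity, minus the integral of \<open>\<theta> z'\<close> equals the integral of \<open>\<theta>' z\<close>, is an identity
  between Bochner integrals in \<open>L2 \<Omega>\<close>; it is read off by pairing both sides with an arbitrary
  \<open>w \<in> L2 \<Omega>\<close>, which commutes with the Bochner integral.\<close>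

definition weak_time_deriv ::
  "real \<Rightarrow> 'a::euclidean_space set \<Rightarrow> (real \<Rightarrow> 'a \<Rightarrow> real) \<Rightarrow> (real \<Rightarrow> 'a \<Rightarrow> real) \<Rightarrow> bool" where
  "weak_time_deriv T \<Omega> z z' \<longleftrightarrow> z \<in> L2L2 T \<Omega> \<and> z' \<in> L2L2 T \<Omega> \<and>
     (\<forall>\<theta>\<in>test_functions {0<..<T}. \<forall>w\<in>L2 \<Omega>.
        (LINT t|lebesgue_on {0<..<T}. deriv \<theta> t * l2_inner \<Omega> (z t) w) =
        - (LINT t|lebesgue_on {0<..<T}. \<theta> t * l2_inner \<Omega> (z' t) w))"

definition continuous_in_time ::
  "real \<Rightarrow> 'a::euclidean_space set \<Rightarrow> (real \<Rightarrow> 'a \<Rightarrow> real) \<Rightarrow> bool" where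
  "continuous_in_time T \<Omega> z \<longleftrightarrow> (\<forall>t\<in>{0..T}. z t \<in> L2 \<Omega> \<and>
     ((\<lambda>s. l2_norm \<Omega> (\<lambda>x. z s x - z t x)) \<longlongrightarrow> 0) (at t within {0..T}))"

text \<open>\<open>z \<in> H\<^sup>k(0, T; L2 \<Omega>)\<close>, where \<open>Z j\<close> is the \<open>j\<close>-th weak time derivative of \<open>z = Z 0\<close>. The derivatives
  of order below \<open>k\<close> are given by their continuous representatives.\<close>

definition Hk_time ::
  "nat \<Rightarrow> real \<Rightarrow> 'a::euclidean_space set \<Rightarrow> (nat \<Rightarrow> real \<Rightarrow> 'a \<Rightarrow> real) \<Rightarrow> bool" where
  "Hk_time k T \<Omega> Z \<longleftrightarrow> Z 0 \<in> L2L2 T \<Omega> \<and>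
     (\<forall>j<k. continuous_in_time T \<Omega> (Z j) \<and> weak_time_deriv T \<Omega> (Z j) (Z (Suc j)))"

definition grid :: "real \<Rightarrow> nat \<Rightarrow> nat \<Rightarrow> real" where
  "grid T N n = real n * (T / real N)"

text \<open>\<open>half_avg z n\<close> is the average \<open>z\<close> at \<open>n + 1/2\<close>, and \<open>diff_quot dt z n\<close> is the difference quotient
  \<open>(z (n + 1) - z n) / dt\<close>, i.e. the backward quotient at index \<open>n + 1\<close>.\<close>

definition half_avg :: "(nat \<Rightarrow> 'a \<Rightarrow> real) \<Rightarrow> nat \<Rightarrow> 'a \<Rightarrow> real" where
  "half_avg z n x = (z (Suc n) x + z n x) / 2"

definition diff_quot :: "real \<Rightarrow> (nat \<Rightarrow> 'a \<Rightarrow> real) \<Rightarrow> nat \<Rightarrow> 'a \<Rightarrow> real" where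
  "diff_quot dt z n x = (z (Suc n) x - z n x) / dt"

text \<open>The argument \<open>ip\<close> below is the inner product of the Hilbert space used for the decomposition.
  Eigenpairs and modes are numbered from 1, vector entries from 0.\<close>

definition snapshots :: "real \<Rightarrow> nat \<Rightarrow> (real \<Rightarrow> 'a \<Rightarrow> real) \<Rightarrow> nat \<Rightarrow> 'a \<Rightarrow> real" where
  "snapshots T N u m =
     (if m \<le> N then u (grid T N m)
      else diff_quot (T / real N) (\<lambda>n. u (grid T N n)) (m - N - 1))"

definition pod_matrix ::
  "(('a \<Rightarrow> real) \<Rightarrow> ('a \<Rightarrow> real) \<Rightarrow> real) \<Rightarrow> nat \<Rightarrow> (nat \<Rightarrow> 'a \<Rightarrow> real) \<Rightarrow> real mat" where
  "pod_matrix ip N v =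
     Matrix.mat (2*N+1) (2*N+1) (\<lambda>(m, n). ip (v m) (v n) / real (2*N+1))"

definition ordered_eigensystem :: "real mat \<Rightarrow> (nat \<Rightarrow> real) \<Rightarrow> (nat \<Rightarrow> real Matrix.vec) \<Rightarrow> bool" where
  "ordered_eigensystem K lam z \<longleftrightarrow>
     (\<forall>i\<in>{1..dim_row K}. eigenvector K (z i) (lam i) \<and> 0 \<le> lam i) \<and>
     (\<forall>i\<in>{1..dim_row K}. \<forall>j\<in>{1..dim_row K}.
        scalar_prod (z i) (z j) = (if i = j then 1 else 0)) \<and>
     (\<forall>i\<in>{1..dim_row K}. \<forall>j\<in>{1..dim_row K}. i \<le> j \<longrightarrow> lam j \<le> lam i)"

definition pod_rank :: "nat \<Rightarrow> (nat \<Rightarrow> real) \<Rightarrow> nat" where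
  "pod_rank N lam = card {i\<in>{1..2*N+1}. 0 < lam i}"

definition pod_mode ::
  "nat \<Rightarrow> (nat \<Rightarrow> 'a \<Rightarrow> real) \<Rightarrow> (nat \<Rightarrow> real) \<Rightarrow> (nat \<Rightarrow> real Matrix.vec) \<Rightarrow> nat \<Rightarrow> 'a \<Rightarrow> real" where
  "pod_mode N v lam z i x =
     (\<Sum>m=0..2*N. vec_index (z i) m * v m x) / (sqrt (lam i) * sqrt (real (2*N+1)))"

definition pod_space :: "(nat \<Rightarrow> 'a \<Rightarrow> real) \<Rightarrow> nat \<Rightarrow> ('a \<Rightarrow> real) set" where
  "pod_space \<phi> r = {v. \<exists>c::nat \<Rightarrow> real. v = (\<lambda>x. \<Sum>i=1..r. c i * \<phi> i x)}"

definition ritz ::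
  "'a::euclidean_space set \<Rightarrow> ('a \<Rightarrow> real) set \<Rightarrow> ('a \<Rightarrow> real) \<Rightarrow> 'a \<Rightarrow> real" where
  "ritz \<Omega> Xr w = (THE p. p \<in> Xr \<and>
     (\<forall>v\<in>Xr. l2_inner \<Omega> (wgrad \<Omega> (\<lambda>x. w x - p x)) (wgrad \<Omega> v) = 0))"

definition cn_rom ::
  "'a::euclidean_space set \<Rightarrow> real \<Rightarrow> real \<Rightarrow> nat \<Rightarrow> (real \<Rightarrow> 'a \<Rightarrow> real) \<Rightarrow> ('a \<Rightarrow> real) set
    \<Rightarrow> (nat \<Rightarrow> 'a \<Rightarrow> real) \<Rightarrow> bool" where
  "cn_rom \<Omega> \<nu> T N f Xr ur \<longleftrightarrow> (\<forall>n\<le>N. ur n \<in> Xr) \<and>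
     (\<forall>n<N. \<forall>v\<in>Xr.
        l2_inner \<Omega> (diff_quot (T / real N) ur n) v
        + \<nu> * l2_inner \<Omega> (wgrad \<Omega> (half_avg ur n)) (wgrad \<Omega> v)
        = l2_inner \<Omega> (half_avg (\<lambda>k. f (grid T N k)) n) v)"

end

theory Submission
  imports Defs "HOL-Real_Asymp.Real_Asymp"
begin

text \<open>Write \<open>e\<^sup>n = \<eta>\<^sup>n - z\<^sup>n\<close> with \<open>\<eta>\<^sup>n = u\<^sup>n - R\<^sub>r u\<^sup>n\<close> and \<open>z\<^sup>n = u\<^sub>r\<^sup>n - R\<^sub>r u\<^sup>n\<close>.
  Averaging the heat equation over \<open>t\<^sub>n\<close> and \<open>t\<^sub>n\<^sub>+\<^sub>1\<close> treats the forcing exactly as the scheme does, so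
  \<open>z\<close> solves the scheme with right-hand side \<open>\<partial>\<eta> - \<tau>\<close>, where \<open>\<tau>\<close> is the error of the trapezoidal
  rule for \<open>u\<^sub>t\<close>; it is bounded by \<open>u\<^sub>t\<^sub>t\<^sub>t\<close> alone. Testing with the average of \<open>z\<close> gives stability.
  The snapshots contain both \<open>u\<^sup>n\<close> and \<open>\<partial>u\<^sup>n\<close>, so the sum of the squared projection errors
  of the snapshots, which equals the tail sum over the modes, controls \<open>\<partial>\<eta>\<close> and, through the increments,
  \<open>\<eta>\<close> at every single time level.

  The Ritz projection is characterised uniquely, as a function and not only up to null sets, because
  the first \<open>r\<close> modes are orthonormal in the inner product of the decomposition, and on \<open>H10 \<Omega>\<close> the
  \<open>L\<^sup>2\<close> norm and the norm of the gradient have the same null functions.\<close>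

section \<open>Smooth functions with compact support\<close>

text \<open>\<open>wgrad\<close> is an arbitrary choice of representative, so on the concrete spaces
  identities between gradients hold only almost everywhere. The numerical analysis is therefore
  carried out for two abstract semi-inner products; the concrete spaces enter afterwards, and the
  Poincare inequality serves to compare the null functions of the two forms. Regularity in time is
  handled through scalars: pairing with a fixed element of L2 turns a weak derivative of a Bochner
  function into a weak derivative of a real function, so no vector-valued integral occurs. The final
  constant is explicit in T and \<nu>. It does not grow with N because the difference quotients
  bound the variation of the projection errors over the whole grid; from the mean over the levels
  alone, a single level could be bounded only with the loss of a factor of order N.\<close>

lemma pderiv_dirI: "(f has_derivative f') (at x) \<Longrightarrow> pderiv_dir b f x = f' b"
  unfolding pderiv_dir_def by (metis frechet_derivative_at)

text \<open>The closure properties below rest on this rule: the usual differentiation rules supply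
  an explicit derivative, and the induction hypothesis handles its components.\<close>

lemma Ck_SucI:
  assumes "\<And>x. (f has_derivative f' x) (at x)"
    and "\<And>b. b \<in> Basis \<Longrightarrow> Ck k (\<lambda>x. f' x b)"
  shows "Ck (Suc k) f"
proof -
  have "pderiv_dir b f = (\<lambda>x. f' x b)" for b
    using assms(1) by (auto intro!: pderiv_dirI)
  then show ?thesis using assms by (auto simp: differentiable_def)
qed

lemma Ck_Suc_has_derivative:
  "Ck (Suc k) f \<Longrightarrow> (f has_derivative (\<lambda>h. frechet_derivative f (at x) h)) (at x)"
  by (simp add: frechet_derivative_works[symmetric])

lemma Ck_SucD: "Ck (Suc k) f \<Longrightarrow> b \<in> Basis \<Longrightarrow> Ck k (\<lambda>x. frechet_derivative f (at x) b)"
  by (auto simp: pderiv_dir_def[abs_def])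

text \<open>The derivative of a product, an inverse or a composition again contains the functions
  themselves, and the induction needs these at the lower order.\<close>

lemma Ck_Suc_imp: "Ck (Suc k) f \<Longrightarrow> Ck k f"
proof (induction k arbitrary: f)
  case 0
  then show ?case
    by (auto intro!: differentiable_imp_continuous_on simp: differentiable_on_def
        intro: differentiable_at_withinI)
next
  case (Suc k)
  then show ?case by (metis Ck.simps(2))
qed

lemma Ck_const: "Ck k (\<lambda>x. c)"
proof (induction k arbitrary: c)
  case (Suc k)
  show ?case by (rule Ck_SucI[where f' = "\<lambda>_ _. 0"]) (auto intro: Suc)
qed auto

lemma Ck_add: "Ck k f \<Longrightarrow> Ck k g \<Longrightarrow> Ck k (\<lambda>x. f x + g x)"
proof (induction k arbitrary: f g)
  case (Suc k)
  show ?case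
    by (rule Ck_SucI, rule has_derivative_add, rule Ck_Suc_has_derivative[OF Suc.prems(1)],
        rule Ck_Suc_has_derivative[OF Suc.prems(2)])
      (intro Suc.IH Ck_SucD[OF Suc.prems(1)] Ck_SucD[OF Suc.prems(2)])
qed (auto intro: continuous_intros)

lemma Ck_mult: "Ck k f \<Longrightarrow> Ck k g \<Longrightarrow> Ck k (\<lambda>x. f x * g x)"
proof (induction k arbitrary: f g)
  case (Suc k)
  show ?case
    by (rule Ck_SucI, rule has_derivative_mult, rule Ck_Suc_has_derivative[OF Suc.prems(1)],
        rule Ck_Suc_has_derivative[OF Suc.prems(2)])
      (intro Ck_add Suc.IH Ck_SucD[OF Suc.prems(1)] Ck_SucD[OF Suc.prems(2)] Ck_Suc_imp[OF Suc.prems(1)]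
        Ck_Suc_imp[OF Suc.prems(2)])
qed (auto intro: continuous_intros)

lemma Ck_cmult: "Ck k f \<Longrightarrow> Ck k (\<lambda>x. c * f x)"
  by (rule Ck_mult[OF Ck_const])

lemma Ck_diff: "Ck k f \<Longrightarrow> Ck k g \<Longrightarrow> Ck k (\<lambda>x. f x - g x)"
  using Ck_add[of k f "\<lambda>x. (-1) * g x"] Ck_cmult[of k g "-1"] by simp

lemma Ck_prod: "(\<And>i. i \<in> I \<Longrightarrow> Ck k (f i)) \<Longrightarrow> Ck k (\<lambda>x. \<Prod>i\<in>I. f i x)"
  by (induction I rule: infinite_finite_induct) (auto intro: Ck_const Ck_mult)

lemma Ck_inverse: "Ck k g \<Longrightarrow> (\<And>x. g x \<noteq> 0) \<Longrightarrow> Ck k (\<lambda>x. inverse (g x))"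
proof (induction k arbitrary: g)
  case (Suc k)
  have "((\<lambda>x. inverse (g x)) has_derivative
      (\<lambda>h. (-1) * (inverse (g x) * frechet_derivative g (at x) h * inverse (g x)))) (at x)" for x
    using Deriv.has_derivative_inverse[OF Suc.prems(2) Ck_Suc_has_derivative[OF Suc.prems(1)], of x] by simp
  then show ?case
    by (rule Ck_SucI) (intro Ck_cmult Ck_mult Suc Ck_SucD[OF Suc.prems(1)] Ck_Suc_imp[OF Suc.prems(1)])
qed (auto intro!: continuous_intros)

lemma Ck_compose:
  fixes g :: "real \<Rightarrow> real"
  shows "Ck k g \<Longrightarrow> Ck k q \<Longrightarrow> Ck k (\<lambda>x. g (q x))"
proof (induction k arbitrary: g q)
  case 0
  then show ?case by (auto intro: continuous_on_compose2)
next
  case (Suc k)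
  \<comment> \<open>A linear map on the reals is multiplication by its value at 1; this turns the
    chain rule into a product to which \<open>Ck_mult\<close> applies.\<close>
  have *: "frechet_derivative g (at y) h = h * frechet_derivative g (at y) 1" for y h
    using linear_scale[OF linear_frechet_derivative, of g "at y" h 1] Suc.prems(1) by simp
  have **: "((\<lambda>x. g (q x)) has_derivative
      (\<lambda>h. frechet_derivative q (at x) h * frechet_derivative g (at (q x)) 1)) (at x)" for x
    using has_derivative_compose[OF Ck_Suc_has_derivative[OF Suc.prems(2)]
        Ck_Suc_has_derivative[OF Suc.prems(1)], of x]
    by (rule has_derivative_eq_rhs) (simp add: fun_eq_iff *[symmetric])
  have "Ck k (\<lambda>x. frechet_derivative g (at (q x)) 1)"
    by (rule Suc.IH[where g = "\<lambda>y. frechet_derivative g (at y) 1"])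
      (use Ck_SucD[OF Suc.prems(1), of 1] Ck_Suc_imp[OF Suc.prems(2)] in auto)
  then show ?case
    by (intro Ck_SucI[OF **] Ck_mult Ck_SucD[OF Suc.prems(2)])
qed

lemma Ck_inner: "Ck k (\<lambda>x. inner x c)"
proof (cases k)
  case 0
  then show ?thesis by (auto intro!: continuous_intros)
next
  case (Suc m)
  show ?thesis unfolding Suc
    by (rule Ck_SucI[where f' = "\<lambda>x h. inner h c"])
      (auto intro!: derivative_eq_intros Ck_const)
qed

lemma Ck_norm_squared: "Ck k (\<lambda>x. inner (x - c) (x - c))"
proof (cases k)
  case 0
  then show ?thesis by (auto intro!: continuous_intros)
next
  case (Suc m)
  show ?thesis unfolding Suc
  proof (rule Ck_SucI[where f' = "\<lambda>x h. 2 * (inner x h - inner c h)"])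
    show "((\<lambda>x. inner (x - c) (x - c)) has_derivative (\<lambda>h. 2 * (inner x h - inner c h))) (at x)" for x
      by (auto intro!: derivative_eq_intros simp: inner_commute algebra_simps)
    show "Ck m (\<lambda>x. 2 * (inner x b - inner c b))" for b
      by (intro Ck_cmult Ck_diff Ck_inner Ck_const)
  qed
qed

text \<open>The products of a polynomial in 1/y with exp(-1/y), continued by zero, form a class
  closed under differentiation. The bumps use p = 1; general p makes the induction for smoothness go
  through.\<close>

definition flat_exp :: "real poly \<Rightarrow> real \<Rightarrow> real" where
  "flat_exp p y = (if 0 < y then poly p (1 / y) * exp (- 1 / y) else 0)"

lemma poly_exp_tendsto_0: "((\<lambda>w. poly p w * exp (- w)) \<longlongrightarrow> 0) (at_top :: real filter)"
proof -
  have "((\<lambda>w. \<Sum>i\<le>degree p. coeff p i * (w ^ i / exp w)) \<longlongrightarrow> (\<Sum>i\<le>degree p. coeff p i * 0)) at_top"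
    by (intro tendsto_intros tendsto_power_div_exp_0)
  moreover have "(\<lambda>w. \<Sum>i\<le>degree p. coeff p i * (w ^ i / exp w)) = (\<lambda>w. poly p w * exp (- w))"
    by (auto simp: poly_altdef sum_distrib_right exp_minus divide_inverse mult.assoc)
  ultimately show ?thesis by simp
qed

text \<open>With w = 1/y, the derivative of p(w) exp(-w) with respect to y is w^2 (p(w) - p'(w))
  exp(-w), and \<open>[:0, 0, 1:]\<close> is the monomial w^2. At the origin the exponential decay
  beats every polynomial.\<close>

lemma flat_exp_DERIV:
  "(flat_exp p has_real_derivative flat_exp ([:0, 0, 1:] * (p - pderiv p)) y) (at y)"
proof -
  consider "y > 0" | "y < 0" | "y = 0" by linarith
  then show ?thesis
  proof cases
    case 1
    have "((\<lambda>y. poly p (1 / y) * exp (- 1 / y)) has_real_derivative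
        flat_exp ([:0, 0, 1:] * (p - pderiv p)) y) (at y)"
      using 1 by (auto intro!: derivative_eq_intros DERIV_chain2[OF poly_DERIV]
          simp: flat_exp_def field_simps power2_eq_square)
    then show ?thesis
      by (rule has_field_derivative_transform_within_open[of _ _ _ "{0<..}"])
        (use 1 in \<open>auto simp: flat_exp_def\<close>)
  next
    case 2
    have "((\<lambda>y. 0) has_real_derivative flat_exp ([:0, 0, 1:] * (p - pderiv p)) y) (at y)"
      using 2 by (auto simp: flat_exp_def)
    then show ?thesis
      by (rule has_field_derivative_transform_within_open[of _ _ _ "{..<0}"])
        (use 2 in \<open>auto simp: flat_exp_def\<close>)
  next
    case 3
    \<comment> \<open>The difference quotient at the origin, taken at y = 1/w, is w p(w) exp(-w),
      and \<open>pCons 0 p\<close> is w p(w).\<close>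
    have "((\<lambda>w. poly (pCons 0 p) w * exp (- w)) \<longlongrightarrow> 0) (at_top :: real filter)"
      by (rule poly_exp_tendsto_0)
    then have "((\<lambda>y. poly (pCons 0 p) (inverse y) * exp (- inverse y)) \<longlongrightarrow> 0) (at_right (0::real))"
      by (rule filterlim_compose[OF _ filterlim_inverse_at_top_right])
    then have r: "((\<lambda>y. flat_exp p y / y) \<longlongrightarrow> 0) (at_right 0)"
      by (rule Lim_transform_eventually)
        (auto simp: eventually_at_right_field flat_exp_def field_simps intro!: exI[of _ 1])
    have l: "((\<lambda>y. flat_exp p y / y) \<longlongrightarrow> 0) (at_left 0)"
      by (rule Lim_transform_eventually[of "\<lambda>_. 0"])
        (auto simp: eventually_at_left_field flat_exp_def intro!: exI[of _ "-1"])
    have "((\<lambda>y. flat_exp p y / y) \<longlongrightarrow> 0) (at 0)"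
      using l r by (simp add: filterlim_split_at)
    then show ?thesis unfolding 3 by (simp add: DERIV_def flat_exp_def)
  qed
qed

lemma Ck_flat_exp: "Ck k (flat_exp p)"
proof (induction k arbitrary: p)
  case 0
  then show ?case
    using flat_exp_DERIV by (auto intro!: continuous_at_imp_continuous_on DERIV_isCont)
next
  case (Suc k)
  show ?case
    by (rule Ck_SucI, rule has_field_derivative_imp_has_derivative[OF flat_exp_DERIV])
      (use Suc in auto)
qed

lemma flat_exp_pos [simp]: "0 < flat_exp 1 y \<longleftrightarrow> 0 < y"
  and flat_exp_nonneg [simp]: "0 \<le> flat_exp 1 y"
  and flat_exp_le_1 [simp]: "flat_exp 1 y \<le> 1"
  and flat_exp_eq_0: "y \<le> 0 \<Longrightarrow> flat_exp 1 y = 0"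
  by (auto simp: flat_exp_def)

lemma flat_exp_tendsto_1: "filterlim f at_top F \<Longrightarrow> ((\<lambda>n. flat_exp 1 (f n)) \<longlongrightarrow> 1) F"
proof -
  have "((\<lambda>y::real. exp (- 1 / y)) \<longlongrightarrow> 1) at_top" by real_asymp
  then have "(flat_exp 1 \<longlongrightarrow> 1) at_top"
    by (rule Lim_transform_eventually) (auto simp: flat_exp_def intro!: eventually_mono[OF eventually_gt_at_top[of 0]])
  then show "filterlim f at_top F \<Longrightarrow> ((\<lambda>n. flat_exp 1 (f n)) \<longlongrightarrow> 1) F"
    by (rule filterlim_compose)
qed

lemma test_functionsI:
  assumes "\<And>k. Ck k \<psi>" "compact K" "K \<subseteq> \<Omega>" "\<And>x. x \<notin> K \<Longrightarrow> \<psi> x = 0"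
  shows "\<psi> \<in> test_functions \<Omega>"
proof -
  have "closure {x. \<psi> x \<noteq> 0} \<subseteq> K"
    using assms by (intro closure_minimal) (auto simp: compact_imp_closed)
  moreover from this have "compact (closure {x. \<psi> x \<noteq> 0})"
    using assms(2) by (meson closed_closure compact_eq_bounded_closed bounded_subset)
  ultimately show ?thesis using assms unfolding test_functions_def by auto
qed

text \<open>Smooth functions exhausting an open set: with balls \<open>ball (c i) (r i)\<close> covering it, one
  minus the product over \<open>i < n\<close> of one minus a bump on the \<open>i\<close>-th ball.\<close>

lemma test_functions_approx_indicator:
  fixes W :: "'a::euclidean_space set"
  assumes "open W"
  obtains \<psi> where "\<And>n. \<psi> n \<in> test_functions W" "\<And>n x. 0 \<le> \<psi> n x" "\<And>n x. \<psi> n x \<le> 1"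
    "\<And>x. (\<lambda>n::nat. \<psi> n x) \<longlonglongrightarrow> indicator W x"
proof -
  define D where "D = {B. \<exists>c r. 0 < r \<and> B = ball c r \<and> B \<subseteq> W}"
  have "\<And>S. S \<in> D \<Longrightarrow> open S" unfolding D_def by auto
  then obtain D' where D': "D' \<subseteq> D" "countable D'" "\<Union>D' = \<Union>D" by (rule Lindelof)
  have UD: "\<Union>D = W"
  proof
    show "W \<subseteq> \<Union>D"
    proof
      fix x assume "x \<in> W"
      then obtain e where "0 < e" "ball x e \<subseteq> W" using assms by (auto simp: open_contains_ball)
      then show "x \<in> \<Union>D" unfolding D_def by (intro UnionI[of "ball x e"]) auto
    qed
  qed (auto simp: D_def)
  \<comment> \<open>Adding the empty set, a ball of radius zero, lets \<open>from_nat_into\<close>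
    enumerate the family even if W is empty.\<close>
  define P where "P = insert {} D'"
  have "countable P" "P \<noteq> {}" unfolding P_def using D' by auto
  then have rg: "range (from_nat_into P) = P" by simp
  have "\<forall>i. \<exists>c r. 0 \<le> r \<and> from_nat_into P i = ball c r \<and> ball c r \<subseteq> W"
  proof
    fix i
    have "B = {} \<or> B \<in> D'" if "B \<in> P" for B using that P_def by auto
    then have "from_nat_into P i = {} \<or> from_nat_into P i \<in> D'"
      using \<open>P \<noteq> {}\<close> by (simp add: from_nat_into)
    then show "\<exists>c r. 0 \<le> r \<and> from_nat_into P i = ball c r \<and> ball c r \<subseteq> W"
    proof (rule disjE)
      assume "from_nat_into P i = {}"
      then show ?thesis by (intro exI[of _ 0] exI[of _ "0::real"]) auto
    next
      assume "from_nat_into P i \<in> D'"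
      then have "from_nat_into P i \<in> D" using D' by auto
      then show ?thesis unfolding D_def by (blast intro: less_imp_le)
    qed
  qed
  then obtain c r where cr: "\<And>i. 0 \<le> r i" "\<And>i. from_nat_into P i = ball (c i) (r i)"
    "\<And>i. ball (c i) (r i) \<subseteq> W" by metis
  have cover: "\<exists>i. x \<in> ball (c i) (r i)" if "x \<in> W" for x
  proof -
    have "x \<in> \<Union>D'" using that UD D'(3) by simp
    then obtain B where "B \<in> P" "x \<in> B" unfolding P_def by auto
    then obtain i where "B = from_nat_into P i" using rg by (metis imageE)
    then show ?thesis using \<open>x \<in> B\<close> cr(2) by auto
  qed
  \<comment> \<open>One parameter n serves two purposes: for n > 0 the bump vanishes off a compact
    subset of the i-th ball, and at a fixed point of that ball its argument tends to infinity with
    n, so that its value tends to 1.\<close>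
  define \<beta> where "\<beta> n i x = flat_exp 1 (real n * ((r i)\<^sup>2 - inner (x - c i) (x - c i)) - 1)" for n i x
  define \<psi> where "\<psi> n x = 1 - (\<Prod>i<n. 1 - \<beta> n i x)" for n x
  have b01: "0 \<le> \<beta> n i x" "\<beta> n i x \<le> 1" for n i x unfolding \<beta>_def by auto
  have beta0: "\<beta> n i x = 0" if "x \<notin> {x. inner (x - c i) (x - c i) \<le> (r i)\<^sup>2 - 1 / n}" for n i x
  proof (cases "n = 0")
    case False
    have "real n * ((r i)\<^sup>2 - inner (x - c i) (x - c i)) \<le> real n * (1 / n)"
      using that by (intro mult_left_mono) auto
    also have "\<dots> = 1" using False by simp
    finally show ?thesis unfolding \<beta>_def by (intro flat_exp_eq_0) simp
  qed (auto simp: \<beta>_def flat_exp_def)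
  define K where "K n i = {x. inner (x - c i) (x - c i) \<le> (r i)\<^sup>2 - 1 / n}" for n :: nat and i
  have compact_K: "compact (K n i)" for n i
  proof -
    have "closed (K n i)" unfolding K_def by (intro closed_Collect_le continuous_intros)
    moreover have "K n i \<subseteq> cball (c i) (r i)"
    proof
      fix x assume "x \<in> K n i"
      then have "(norm (x - c i))\<^sup>2 \<le> (r i)\<^sup>2"
        unfolding K_def by (auto simp: power2_norm_eq_inner intro: order_trans)
      then have "norm (x - c i) \<le> r i" using cr(1) power2_le_imp_le by blast
      then show "x \<in> cball (c i) (r i)" by (simp add: dist_norm norm_minus_commute)
    qed
    ultimately show ?thesis by (meson bounded_cball bounded_subset compact_eq_bounded_closed)
  qed
  have K_sub: "K n i \<subseteq> W" if "i < n" for n i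
  proof
    fix x assume "x \<in> K n i"
    moreover have "(0::real) < 1 / real n" using that by simp
    ultimately have "inner (x - c i) (x - c i) < (r i)\<^sup>2" unfolding K_def mem_Collect_eq by linarith
    then have "(norm (x - c i))\<^sup>2 < (r i)\<^sup>2" by (simp add: power2_norm_eq_inner)
    then have "norm (x - c i) < r i" using cr(1) power2_less_imp_less by blast
    then show "x \<in> W" using cr(3)[of i] by (auto simp: dist_norm norm_minus_commute subset_iff)
  qed
  show ?thesis
  proof (rule that[of \<psi>])
    show "\<psi> n \<in> test_functions W" for n
    proof (rule test_functionsI[where K = "\<Union>i<n. K n i"])
      show "Ck k (\<psi> n)" for k
        unfolding \<psi>_def[abs_def] \<beta>_def
        by (intro Ck_diff Ck_prod Ck_const Ck_compose[OF Ck_flat_exp] Ck_mult Ck_norm_squared)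
      show "\<psi> n x = 0" if "x \<notin> (\<Union>i<n. K n i)" for x
      proof -
        have "\<beta> n i x = 0" if "i < n" for i using beta0[of x i n] \<open>x \<notin> _\<close> that by (auto simp: K_def)
        then show ?thesis unfolding \<psi>_def by simp
      qed
      show "compact (\<Union>i<n. K n i)" using compact_K by (intro compact_UN) auto
      show "(\<Union>i<n. K n i) \<subseteq> W" using K_sub by blast
    qed
    show "0 \<le> \<psi> n x" for n x unfolding \<psi>_def using b01 by (auto intro!: prod_le_1)
    show "\<psi> n x \<le> 1" for n x unfolding \<psi>_def using b01 by (auto intro!: prod_nonneg)
    show "(\<lambda>n. \<psi> n x) \<longlonglongrightarrow> indicator W x" for x
    proof (cases "x \<in> W")
      case True
      then obtain j where "x \<in> ball (c j) (r j)" using cover by auto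
      then have "(norm (x - c j))\<^sup>2 < (r j)\<^sup>2"
        by (intro power_strict_mono) (auto simp: dist_norm norm_minus_commute)
      then have "(r j)\<^sup>2 - inner (x - c j) (x - c j) > 0" by (simp add: power2_norm_eq_inner)
      then have "filterlim (\<lambda>n::nat. real n * ((r j)\<^sup>2 - inner (x - c j) (x - c j)) - 1) at_top sequentially"
        by real_asymp
      then have "(\<lambda>n. \<beta> n j x) \<longlonglongrightarrow> 1" unfolding \<beta>_def by (rule flat_exp_tendsto_1)
      \<comment> \<open>All factors lie in the unit interval, so the product is at most the factor
        belonging to one ball around x.\<close>
      moreover have "eventually (\<lambda>n. \<beta> n j x \<le> \<psi> n x) sequentially"
        using eventually_gt_at_top[of j]
      proof eventually_elim
        case (elim n)
        have "(\<Prod>i<n. 1 - \<beta> n i x) = (1 - \<beta> n j x) * (\<Prod>i\<in>{..<n}-{j}. 1 - \<beta> n i x)"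
          using elim by (subst prod.remove[of _ j]) auto
        also have "\<dots> \<le> (1 - \<beta> n j x) * 1"
          using b01 by (intro mult_left_mono prod_le_1) auto
        finally show ?case unfolding \<psi>_def by simp
      qed
      moreover have "\<psi> n x \<le> 1" for n unfolding \<psi>_def using b01 by (auto intro!: prod_nonneg)
      ultimately have "(\<lambda>n. \<psi> n x) \<longlonglongrightarrow> 1"
        using tendsto_sandwich[of "\<lambda>n. \<beta> n j x" "\<lambda>n. \<psi> n x" sequentially "\<lambda>_. 1" 1]
        by (simp add: always_eventually)
      then show ?thesis using True by simp
    next
      case False
      have "\<psi> n x = 0" for n
      proof -
        have "\<beta> n i x = 0" if "i < n" for i using beta0[of x i n] K_sub[OF that] False by (auto simp: K_def)
        then show ?thesis unfolding \<psi>_def by simp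
      qed
      then show ?thesis using False by simp
    qed
  qed
qed

text \<open>The standard smooth transition from 0 to 1 on the unit interval. Differences of two
  rescaled translates will be the test functions in time that approximate the indicator of an
  interval.\<close>

definition smooth_step :: "real \<Rightarrow> real" where
  "smooth_step x = flat_exp 1 x * inverse (flat_exp 1 x + flat_exp 1 (1 - x))"

lemma smooth_step_denominator: "0 < flat_exp 1 x + flat_exp 1 (1 - x)"
  by (cases "x > 0") (auto intro: add_pos_nonneg add_nonneg_pos)

lemma Ck_smooth_step: "Ck k smooth_step"
proof -
  have *: "Ck k (\<lambda>x::real. 1 - x)" using Ck_diff[OF Ck_const Ck_inner[of k "1::real"]] by simp
  have "flat_exp 1 x + flat_exp 1 (1 - x) \<noteq> 0" for x using smooth_step_denominator[of x] by linarith
  then show ?thesis unfolding smooth_step_def[abs_def]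
    by (intro Ck_mult Ck_inverse Ck_add Ck_flat_exp Ck_compose[OF Ck_flat_exp *]) auto
qed

lemma smooth_step_eq_0: "x \<le> 0 \<Longrightarrow> smooth_step x = 0"
  and smooth_step_eq_1: "1 \<le> x \<Longrightarrow> smooth_step x = 1"
  and smooth_step_nonneg: "0 \<le> smooth_step x"
  and smooth_step_le_1: "smooth_step x \<le> 1"
proof -
  show "x \<le> 0 \<Longrightarrow> smooth_step x = 0" by (simp add: smooth_step_def flat_exp_eq_0)
  show "1 \<le> x \<Longrightarrow> smooth_step x = 1" by (simp add: smooth_step_def flat_exp_eq_0 flat_exp_def)
  show "0 \<le> smooth_step x" by (simp add: smooth_step_def)
  show "smooth_step x \<le> 1"
    using smooth_step_denominator[of x] by (simp add: smooth_step_def field_simps)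
qed

section \<open>Semi-inner products on function spaces\<close>

text \<open>Definiteness is left out because a function that vanishes almost everywhere is null
  without being zero. Values in a real vector space cover gradients as well as scalar
  functions.\<close>

locale semi_inner =
  fixes V :: "('x \<Rightarrow> 'b::real_vector) set" and B :: "('x \<Rightarrow> 'b) \<Rightarrow> ('x \<Rightarrow> 'b) \<Rightarrow> real"
  assumes zero: "(\<lambda>x. 0) \<in> V"
    and add: "f \<in> V \<Longrightarrow> g \<in> V \<Longrightarrow> (\<lambda>x. f x + g x) \<in> V"
    and scale: "f \<in> V \<Longrightarrow> (\<lambda>x. c *\<^sub>R f x) \<in> V"
    and sym: "f \<in> V \<Longrightarrow> g \<in> V \<Longrightarrow> B f g = B g f"
    and add_left: "f \<in> V \<Longrightarrow> g \<in> V \<Longrightarrow> h \<in> V \<Longrightarrow> B (\<lambda>x. f x + g x) h = B f h + B g h"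
    and scale_left: "f \<in> V \<Longrightarrow> h \<in> V \<Longrightarrow> B (\<lambda>x. c *\<^sub>R f x) h = c * B f h"
    and nonneg: "f \<in> V \<Longrightarrow> 0 \<le> B f f"
begin

definition nrm :: "('x \<Rightarrow> 'b) \<Rightarrow> real" where "nrm f = sqrt (B f f)"

lemma nrm_nonneg: "f \<in> V \<Longrightarrow> 0 \<le> nrm f"
  by (simp add: nrm_def nonneg)

lemma nrm_squared: "f \<in> V \<Longrightarrow> (nrm f)\<^sup>2 = B f f"
  by (simp add: nrm_def nonneg)

lemma diff: "f \<in> V \<Longrightarrow> g \<in> V \<Longrightarrow> (\<lambda>x. f x - g x) \<in> V"
  using add[of f "\<lambda>x. (-1) *\<^sub>R g x"] scale[of g "-1"] by simp

lemma diff_left: "f \<in> V \<Longrightarrow> g \<in> V \<Longrightarrow> h \<in> V \<Longrightarrow> B (\<lambda>x. f x - g x) h = B f h - B g h"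
  using add_left[of f "\<lambda>x. (-1) *\<^sub>R g x" h] scale[of g "-1"] scale_left[of g h "-1"] by simp

lemma add_right: "f \<in> V \<Longrightarrow> g \<in> V \<Longrightarrow> h \<in> V \<Longrightarrow> B h (\<lambda>x. f x + g x) = B h f + B h g"
  by (simp add: sym[of h] add add_left)

lemma diff_right: "f \<in> V \<Longrightarrow> g \<in> V \<Longrightarrow> h \<in> V \<Longrightarrow> B h (\<lambda>x. f x - g x) = B h f - B h g"
  by (simp add: sym[of h] diff diff_left)

lemma scale_right: "f \<in> V \<Longrightarrow> h \<in> V \<Longrightarrow> B h (\<lambda>x. c *\<^sub>R f x) = c * B h f"
  by (simp add: sym[of h] scale scale_left)

lemma zero_left: "h \<in> V \<Longrightarrow> B (\<lambda>x. 0) h = 0"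
  using scale_left[OF zero, of h 0] by simp

lemma sum_mem: "(\<And>i. i \<in> I \<Longrightarrow> f i \<in> V) \<Longrightarrow> (\<lambda>x. \<Sum>i\<in>I. c i *\<^sub>R f i x) \<in> V"
proof (induction I rule: infinite_finite_induct)
  case (insert j I)
  then show ?case using add[OF scale[of "f j" "c j"], of "\<lambda>x. \<Sum>i\<in>I. c i *\<^sub>R f i x"] by simp
qed (simp_all add: zero)

lemma sum_left:
  "(\<And>i. i \<in> I \<Longrightarrow> f i \<in> V) \<Longrightarrow> h \<in> V \<Longrightarrow>
    B (\<lambda>x. \<Sum>i\<in>I. c i *\<^sub>R f i x) h = (\<Sum>i\<in>I. c i * B (f i) h)"
  by (induction I rule: infinite_finite_induct)
    (auto simp: zero_left add_left scale_left scale sum_mem)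

lemma sum_right:
  "(\<And>i. i \<in> I \<Longrightarrow> f i \<in> V) \<Longrightarrow> h \<in> V \<Longrightarrow>
    B h (\<lambda>x. \<Sum>i\<in>I. c i *\<^sub>R f i x) = (\<Sum>i\<in>I. c i * B h (f i))"
  by (simp add: sym[of h] sum_mem sum_left)

lemma Cauchy_Schwarz: "f \<in> V \<Longrightarrow> g \<in> V \<Longrightarrow> (B f g)\<^sup>2 \<le> B f f * B g g"
proof -
  assume fg: "f \<in> V" "g \<in> V"
  have *: "0 \<le> s\<^sup>2 * B f f - 2 * s * t * B f g + t\<^sup>2 * B g g" for s t
  proof -
    have "0 \<le> B (\<lambda>x. s *\<^sub>R f x - t *\<^sub>R g x) (\<lambda>x. s *\<^sub>R f x - t *\<^sub>R g x)"
      using fg by (intro nonneg diff scale)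
    also have "\<dots> = s\<^sup>2 * B f f - 2 * s * t * B f g + t\<^sup>2 * B g g"
      using fg by (simp add: diff_left diff_right scale_left scale_right scale diff sym[of g f]
          power2_eq_square algebra_simps)
    finally show ?thesis .
  qed
  show ?thesis
  proof (cases "B g g = 0")
    case True
    show ?thesis
    proof (cases "B f g = 0")
      case False
      \<comment> \<open>For null g the quadratic expression is affine in t, and this t gives it the
        value -1.\<close>
      from *[of 1 "(B f f + 1) / (2 * B f g)"] True False have "0 \<le> - (1::real)" by simp
      then show ?thesis by simp
    qed (simp add: True)
  next
    case False
    then have p: "B g g > 0" using nonneg[OF fg(2)] by simp
    from *[of "B g g" "B f g"] have "0 \<le> B g g * (B f f * B g g - (B f g)\<^sup>2)"
      by (simp add: power2_eq_square algebra_simps)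
    then show ?thesis using p by (simp add: zero_le_mult_iff)
  qed
qed

lemma abs_le_nrm: "f \<in> V \<Longrightarrow> g \<in> V \<Longrightarrow> \<bar>B f g\<bar> \<le> nrm f * nrm g"
  unfolding nrm_def real_sqrt_mult[symmetric] using Cauchy_Schwarz
  by (metis real_sqrt_abs real_sqrt_le_mono)

text \<open>This is the substitute for definiteness: a null function is orthogonal to
  everything.\<close>

lemma null_right: "f \<in> V \<Longrightarrow> g \<in> V \<Longrightarrow> B g g = 0 \<Longrightarrow> B f g = 0"
  using Cauchy_Schwarz[of f g] by simp

lemma nrm_add_squared:
  "f \<in> V \<Longrightarrow> g \<in> V \<Longrightarrow> (nrm (\<lambda>x. f x + g x))\<^sup>2 = (nrm f)\<^sup>2 + 2 * B f g + (nrm g)\<^sup>2"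
  by (simp add: nrm_squared add add_left add_right sym[of g f])

lemma nrm_triangle: "f \<in> V \<Longrightarrow> g \<in> V \<Longrightarrow> nrm (\<lambda>x. f x + g x) \<le> nrm f + nrm g"
proof (rule power2_le_imp_le)
  assume fg: "f \<in> V" "g \<in> V"
  show "(nrm (\<lambda>x. f x + g x))\<^sup>2 \<le> (nrm f + nrm g)\<^sup>2"
    using abs_le_nrm[OF fg] fg by (simp add: nrm_add_squared power2_sum)
  show "0 \<le> nrm f + nrm g" using fg by (simp add: nrm_nonneg)
qed

lemma nrm_scale: "f \<in> V \<Longrightarrow> nrm (\<lambda>x. c *\<^sub>R f x) = \<bar>c\<bar> * nrm f"
  by (simp add: nrm_def scale_left scale_right scale real_sqrt_mult power2_eq_square[symmetric] mult.assoc[symmetric])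

lemma nrm_minus: "f \<in> V \<Longrightarrow> nrm (\<lambda>x. - f x) = nrm f"
  using nrm_scale[of f "-1"] by simp

lemma nrm_diff_le: "f \<in> V \<Longrightarrow> g \<in> V \<Longrightarrow> nrm (\<lambda>x. f x - g x) \<le> nrm f + nrm g"
  using nrm_triangle[of f "\<lambda>x. - g x"] scale[of g "-1"] by (simp add: nrm_minus)

lemma add_squared_le:
  "f \<in> V \<Longrightarrow> g \<in> V \<Longrightarrow> B (\<lambda>x. f x + g x) (\<lambda>x. f x + g x) \<le> 2 * B f f + 2 * B g g"
  using nonneg[OF diff[of f g]] by (simp add: add diff add_left add_right diff_left diff_right sym[of g f])

lemma diff_squared_le:
  "f \<in> V \<Longrightarrow> g \<in> V \<Longrightarrow> B (\<lambda>x. f x - g x) (\<lambda>x. f x - g x) \<le> 2 * B f f + 2 * B g g"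
  using nonneg[OF add[of f g]] by (simp add: add diff add_left add_right diff_left diff_right sym[of g f])

end

section \<open>Spans of finitely many modes\<close>

lemma pod_space_lin:
  assumes "u \<in> pod_space \<phi> r" "w \<in> pod_space \<phi> r"
  shows "(\<lambda>x. c * u x + d * w x) \<in> pod_space \<phi> r"
proof -
  obtain c1 c2 where "u = (\<lambda>x. \<Sum>i=1..r. c1 i * \<phi> i x)" "w = (\<lambda>x. \<Sum>i=1..r. c2 i * \<phi> i x)"
    using assms unfolding pod_space_def by auto
  then have "(\<lambda>x. c * u x + d * w x) = (\<lambda>x. \<Sum>i=1..r. (c * c1 i + d * c2 i) * \<phi> i x)"
    by (simp add: sum_distrib_left sum.distrib algebra_simps)
  then show ?thesis unfolding pod_space_def by (intro CollectI exI[of _ "\<lambda>i. c * c1 i + d * c2 i"])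
qed

lemma pod_space_Suc: 
  assumes "u \<in> pod_space \<phi> r"
  shows "(\<lambda>x. u x + d * \<phi> (Suc r) x) \<in> pod_space \<phi> (Suc r)"
proof -
  obtain c where "u = (\<lambda>x. \<Sum>i=1..r. c i * \<phi> i x)"
    using assms unfolding pod_space_def by auto
  then have "(\<lambda>x. u x + d * \<phi> (Suc r) x) = (\<lambda>x. \<Sum>i=1..Suc r. (c(Suc r := d)) i * \<phi> i x)"
    by (auto intro!: sum.cong)
  then show ?thesis unfolding pod_space_def by (intro CollectI exI[of _ "c(Suc r := d)"])
qed

lemma pod_space_SucE:
  assumes "w \<in> pod_space \<phi> (Suc r)"
  obtains u d where "u \<in> pod_space \<phi> r" "w = (\<lambda>x. u x + d * \<phi> (Suc r) x)"
proof -
  obtain c where "w = (\<lambda>x. \<Sum>i=1..Suc r. c i * \<phi> i x)"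
    using assms unfolding pod_space_def by auto
  then have "w = (\<lambda>x. (\<Sum>i=1..r. c i * \<phi> i x) + c (Suc r) * \<phi> (Suc r) x)" by simp
  then show ?thesis by (intro that[of "\<lambda>x. \<Sum>i=1..r. c i * \<phi> i x" "c (Suc r)"]) (auto simp: pod_space_def)
qed

lemma pod_space_mem:
  assumes "i \<in> {1..r}" shows "\<phi> i \<in> pod_space \<phi> r"
proof -
  have "(\<lambda>x. \<Sum>j=1..r. (if j = i then 1 else 0) * \<phi> j x) = \<phi> i"
    using assms by (simp add: if_distrib[of "\<lambda>c. c * _"] cong: if_cong)
  then show ?thesis unfolding pod_space_def
    by (intro CollectI exI[of _ "\<lambda>j. if j = i then 1 else 0"]) simp
qed

lemma pod_space_zero: "(\<lambda>x. 0) \<in> pod_space \<phi> r"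
  unfolding pod_space_def by (auto intro!: exI[of _ "\<lambda>_. 0"])

section \<open>Averages, difference quotients, projections and stability for real-valued
  functions\<close>

locale real_semi_inner = semi_inner V B for V :: "('x \<Rightarrow> real) set" and B
begin

lemmas rscale = scale[unfolded real_scaleR_def]
lemmas rscale_left = scale_left[unfolded real_scaleR_def]
lemmas rscale_right = scale_right[unfolded real_scaleR_def]
lemmas rsum_mem = sum_mem[unfolded real_scaleR_def]
lemmas rsum_left = sum_left[unfolded real_scaleR_def]
lemmas rsum_right = sum_right[unfolded real_scaleR_def]
lemmas rnrm_scale = nrm_scale[unfolded real_scaleR_def]

lemma pod_space_subset: "(\<And>i. i \<in> {1..r} \<Longrightarrow> \<phi> i \<in> V) \<Longrightarrow> w \<in> pod_space \<phi> r \<Longrightarrow> w \<in> V"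
  unfolding pod_space_def by (auto intro!: rsum_mem)

lemma half_avg_mem: "(\<And>n. n \<le> N \<Longrightarrow> z n \<in> V) \<Longrightarrow> n < N \<Longrightarrow> half_avg z n \<in> V"
  using rscale[of "\<lambda>x. z (Suc n) x + z n x" "1/2"] add[of "z (Suc n)" "z n"]
  by (simp add: half_avg_def[abs_def])

lemma diff_quot_mem: "(\<And>n. n \<le> N \<Longrightarrow> z n \<in> V) \<Longrightarrow> n < N \<Longrightarrow> diff_quot dt z n \<in> V"
  using rscale[of "\<lambda>x. z (Suc n) x - z n x" "1/dt"] diff[of "z (Suc n)" "z n"]
  by (simp add: diff_quot_def[abs_def])

lemma diff_quot_left:
  "(\<And>n. n \<le> N \<Longrightarrow> z n \<in> V) \<Longrightarrow> n < N \<Longrightarrow> h \<in> V \<Longrightarrow>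
    B (diff_quot dt z n) h = (B (z (Suc n)) h - B (z n) h) / dt"
  using rscale_left[of "\<lambda>x. z (Suc n) x - z n x" h "1/dt"] diff[of "z (Suc n)" "z n"]
  by (simp add: diff_quot_def[abs_def] diff_left)

lemma half_avg_left:
  "(\<And>n. n \<le> N \<Longrightarrow> z n \<in> V) \<Longrightarrow> n < N \<Longrightarrow> h \<in> V \<Longrightarrow>
    B (half_avg z n) h = (B (z (Suc n)) h + B (z n) h) / 2"
  using rscale_left[of "\<lambda>x. z (Suc n) x + z n x" h "1/2"] add[of "z (Suc n)" "z n"]
  by (simp add: half_avg_def[abs_def] add_left)

lemma half_avg_squared_le:
  "(\<And>n. n \<le> N \<Longrightarrow> z n \<in> V) \<Longrightarrow> n < N \<Longrightarrow>
    B (half_avg z n) (half_avg z n) \<le> (B (z (Suc n)) (z (Suc n)) + B (z n) (z n)) / 2"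
proof -
  assume z: "\<And>n. n \<le> N \<Longrightarrow> z n \<in> V" and n: "n < N"
  have V: "z (Suc n) \<in> V" "z n \<in> V" using z n by auto
  define w where "w = (\<lambda>x. z (Suc n) x + z n x)"
  have wV: "w \<in> V" unfolding w_def by (rule add[OF V])
  have "half_avg z n = (\<lambda>x. 1 / 2 * w x)" by (simp add: half_avg_def[abs_def] w_def)
  then have "B (half_avg z n) (half_avg z n) = B w w / 4"
    by (simp only: rscale_left[OF wV rscale[OF wV]] rscale_right[OF wV wV])
  also have "\<dots> \<le> (2 * B (z (Suc n)) (z (Suc n)) + 2 * B (z n) (z n)) / 4"
    using add_squared_le[OF V] unfolding w_def by (rule divide_right_mono) simp
  finally show ?thesis by (simp add: field_simps)
qed

text \<open>Gram-Schmidt without linear independence. Both w and the new mode are projected onto the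
  earlier span; q is the part of the new mode orthogonal to that span, and the component of the
  remainder of w along q is added to the projection.\<close>

lemma projection_exists:
  assumes "\<And>i. i \<in> {1..r} \<Longrightarrow> \<phi> i \<in> V" "w \<in> V"
  shows "\<exists>p\<in>pod_space \<phi> r. \<forall>v\<in>pod_space \<phi> r. B (\<lambda>x. w x - p x) v = 0"
  using assms
proof (induction r arbitrary: w)
  case 0
  have "pod_space \<phi> 0 = {\<lambda>x. 0}" by (auto simp: pod_space_def)
  then show ?case using 0 sym[of w "\<lambda>x. 0"] zero_left zero by (auto simp: zero)
next
  case (Suc r)
  have \<phi>: "i \<in> {1..r} \<Longrightarrow> \<phi> i \<in> V" for i using Suc.prems by auto
  have \<phi>r: "\<phi> (Suc r) \<in> V" using Suc.prems by auto
  note sub = pod_space_subset[OF \<phi>]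
  obtain p where p: "p \<in> pod_space \<phi> r" "\<And>v. v \<in> pod_space \<phi> r \<Longrightarrow> B (\<lambda>x. w x - p x) v = 0"
    using Suc.IH[OF \<phi> Suc.prems(2)] by auto
  obtain d where d: "d \<in> pod_space \<phi> r" "\<And>v. v \<in> pod_space \<phi> r \<Longrightarrow> B (\<lambda>x. \<phi> (Suc r) x - d x) v = 0"
    using Suc.IH[OF \<phi> \<phi>r] by auto
  define q where "q = (\<lambda>x. \<phi> (Suc r) x - d x)"
  define w' where "w' = (\<lambda>x. w x - p x)"
  \<comment> \<open>If q is null, the remainder w' is orthogonal to it by Cauchy-Schwarz, so the
    value 0 also satisfies B w' q = t * B q q.\<close>
  define t where "t = (if B q q = 0 then 0 else B w' q / B q q)"
  have V: "p \<in> V" "d \<in> V" "q \<in> V" "w' \<in> V"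
    using sub p d \<phi>r Suc.prems(2) unfolding q_def w'_def by (auto intro: diff)
  have w'q: "B w' q = t * B q q" using null_right[OF V(4) V(3)] by (simp add: t_def)
  define p' where "p' = (\<lambda>x. (1 * p x + (- t) * d x) + t * \<phi> (Suc r) x)"
  have p': "p' \<in> pod_space \<phi> (Suc r)" unfolding p'_def by (intro pod_space_Suc pod_space_lin p d)
  have e: "(\<lambda>x. w x - p' x) = (\<lambda>x. w' x - t * q x)" by (auto simp: p'_def w'_def q_def algebra_simps)
  have "B (\<lambda>x. w x - p' x) v = 0" if v: "v \<in> pod_space \<phi> (Suc r)" for v
  proof -
    obtain u c where u: "u \<in> pod_space \<phi> r" "v = (\<lambda>x. u x + c * \<phi> (Suc r) x)" using pod_space_SucE[OF v] .
    define u' where "u' = (\<lambda>x. 1 * u x + c * d x)"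
    have u': "u' \<in> pod_space \<phi> r" unfolding u'_def by (intro pod_space_lin u d)
    have v': "v = (\<lambda>x. u' x + c * q x)" unfolding u u'_def q_def by (auto simp: algebra_simps)
    have uV: "u' \<in> V" using sub u' by auto
    have "B (\<lambda>x. w' x - t * q x) v = B w' u' - t * B q u' + c * (B w' q - t * B q q)"
      unfolding v' using V uV
      by (simp add: diff_left add_right rscale_left rscale_right rscale diff algebra_simps)
    then show ?thesis unfolding e using p(2)[OF u'] d(2)[OF u'] w'q by (simp add: w'_def q_def)
  qed
  then show ?case using p' by blast
qed

text \<open>Test with \<open>half_avg z n\<close>. Telescoping the squared norms bounds the energy; cancelling the sum of
  the norms at consecutive levels bounds the norm itself, without a discrete Gronwall argument.\<close>

lemma cn_stability:
  fixes A :: "nat \<Rightarrow> real"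
  assumes "0 < dt"
    and z: "\<And>n. n \<le> N \<Longrightarrow> z n \<in> V" and g: "\<And>n. n < N \<Longrightarrow> g n \<in> V"
    and A: "\<And>n. n < N \<Longrightarrow> 0 \<le> A n"
    and eq: "\<And>n. n < N \<Longrightarrow> B (diff_quot dt z n) (half_avg z n) + A n = B (g n) (half_avg z n)"
  defines "P \<equiv> nrm (z 0) + dt * (\<Sum>n<N. nrm (g n))"
  shows "\<And>k. k \<le> N \<Longrightarrow> nrm (z k) \<le> P"
    and "2 * dt * (\<Sum>n<N. A n) \<le> 3 * P\<^sup>2"
proof -
  \<comment> \<open>Pairing the difference quotient with the average gives the difference of the
    squared norms over 2 dt. The triangle inequality for the average leaves the sum of the two norms
    on the right, a factor that also divides the difference of squares.\<close>
  have step: "(nrm (z (Suc n)))\<^sup>2 - (nrm (z n))\<^sup>2 + 2 * dt * A n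
      \<le> dt * nrm (g n) * (nrm (z (Suc n)) + nrm (z n))" if "n < N" for n
  proof -
    have V: "z (Suc n) \<in> V" "z n \<in> V" using z that by auto
    have dq: "diff_quot dt z n \<in> V" and ha: "half_avg z n \<in> V" 
      using diff_quot_mem half_avg_mem z that by blast+
    have h: "B (z k) (half_avg z n) = (B (z (Suc n)) (z k) + B (z n) (z k)) / 2" if "k \<le> N" for k
      using half_avg_left[of N z n "z k"] z \<open>n < N\<close> that sym[OF z[OF that] ha] by simp
    have "B (diff_quot dt z n) (half_avg z n) = (B (z (Suc n)) (half_avg z n) - B (z n) (half_avg z n)) / dt"
      using diff_quot_left[of N z n "half_avg z n" dt] z \<open>n < N\<close> ha by simp
    also have "B (z (Suc n)) (half_avg z n) - B (z n) (half_avg z n) = ((nrm (z (Suc n)))\<^sup>2 - (nrm (z n))\<^sup>2) / 2"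
      using h[of n] h[of "Suc n"] \<open>n < N\<close> sym[OF V] V by (simp add: nrm_squared field_simps)
    finally have "B (diff_quot dt z n) (half_avg z n) = ((nrm (z (Suc n)))\<^sup>2 - (nrm (z n))\<^sup>2) / (2 * dt)"
      by simp
    then have "(nrm (z (Suc n)))\<^sup>2 - (nrm (z n))\<^sup>2 + 2 * dt * A n = 2 * dt * B (g n) (half_avg z n)"
      using \<open>0 < dt\<close> by (simp flip: eq[OF that] add: field_simps)
    also have "\<dots> \<le> 2 * dt * (nrm (g n) * nrm (half_avg z n))"
      using abs_le_nrm[OF g[OF that] ha] \<open>0 < dt\<close> by (intro mult_left_mono) auto
    also have "\<dots> \<le> 2 * dt * (nrm (g n) * ((nrm (z (Suc n)) + nrm (z n)) / 2))"
    proof -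
      have "nrm (half_avg z n) \<le> (nrm (z (Suc n)) + nrm (z n)) / 2"
        using rnrm_scale[of "\<lambda>x. z (Suc n) x + z n x" "1/2"] nrm_triangle[OF V] add[OF V]
        by (simp add: half_avg_def[abs_def])
      then show ?thesis using \<open>0 < dt\<close> nrm_nonneg[OF g[OF that]] by (intro mult_left_mono) auto
    qed
    finally show ?thesis by (simp add: mult.assoc)
  qed
  have le: "nrm (z k) \<le> nrm (z 0) + dt * (\<Sum>n<k. nrm (g n))" if "k \<le> N" for k
    using that
  proof (induction k)
    case (Suc n)
    define x y where "x = nrm (z (Suc n))" and "y = nrm (z n)"
    have xy: "0 \<le> x" "0 \<le> y" using Suc.prems z by (auto simp: x_def y_def nrm_nonneg)
    have gn: "0 \<le> dt * nrm (g n)" using Suc.prems g nrm_nonneg \<open>0 < dt\<close> by simp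
    have "0 \<le> 2 * dt * A n" using A[of n] Suc.prems \<open>0 < dt\<close> by simp
    then have "x\<^sup>2 - y\<^sup>2 \<le> dt * nrm (g n) * (x + y)"
      using step[of n] Suc.prems unfolding x_def y_def by simp
    then have "(x - y) * (x + y) \<le> dt * nrm (g n) * (x + y)"
      by (simp add: power2_eq_square algebra_simps)
    \<comment> \<open>If x + y = 0, both norms vanish and the claim is trivial; otherwise the common
      factor cancels.\<close>
    then have "x - y \<le> dt * nrm (g n)"
      using xy gn by (cases "x + y = 0") (auto simp: mult_le_cancel_right)
    then show ?case using Suc unfolding x_def y_def by (simp add: distrib_left)
  qed simp
  have P0: "0 \<le> dt * (\<Sum>n<N. nrm (g n))"
    using g nrm_nonneg \<open>0 < dt\<close> by (intro mult_nonneg_nonneg sum_nonneg) auto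
  show bound: "nrm (z k) \<le> P" if "k \<le> N" for k
  proof -
    have "(\<Sum>n<k. nrm (g n)) \<le> (\<Sum>n<N. nrm (g n))"
      using that g nrm_nonneg by (intro sum_mono2) auto
    then have "dt * (\<Sum>n<k. nrm (g n)) \<le> dt * (\<Sum>n<N. nrm (g n))" using \<open>0 < dt\<close> by simp
    then show ?thesis using le[OF that] unfolding P_def by linarith
  qed
  have Pn: "0 \<le> P" using P0 nrm_nonneg[OF z[of 0]] unfolding P_def by simp
  \<comment> \<open>With every norm at most P, the right-hand sides add up to at most 2 P^2.
    Telescoping leaves the squared initial norm, again at most P^2, which accounts for the
    3.\<close>
  have "(\<Sum>n<N. (nrm (z (Suc n)))\<^sup>2 - (nrm (z n))\<^sup>2 + 2 * dt * A n) \<le> (\<Sum>n<N. dt * nrm (g n) * (2 * P))"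
  proof (rule sum_mono)
    fix n assume n: "n \<in> {..<N}"
    then have "nrm (z (Suc n)) + nrm (z n) \<le> 2 * P" using bound[of n] bound[of "Suc n"] by auto
    then have "dt * nrm (g n) * (nrm (z (Suc n)) + nrm (z n)) \<le> dt * nrm (g n) * (2 * P)"
      using \<open>0 < dt\<close> g nrm_nonneg n by (intro mult_left_mono mult_nonneg_nonneg) auto
    then show "(nrm (z (Suc n)))\<^sup>2 - (nrm (z n))\<^sup>2 + 2 * dt * A n \<le> dt * nrm (g n) * (2 * P)"
      using step[of n] n by simp
  qed
  also have "(\<Sum>n<N. dt * nrm (g n) * (2 * P)) = (dt * (\<Sum>n<N. nrm (g n))) * (2 * P)"
    by (simp add: sum_distrib_left sum_distrib_right)
  also have "\<dots> \<le> P * (2 * P)" using Pn nrm_nonneg[OF z[of 0]] unfolding P_def by (intro mult_right_mono) auto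
  finally have "(nrm (z N))\<^sup>2 - (nrm (z 0))\<^sup>2 + 2 * dt * (\<Sum>n<N. A n) \<le> 2 * P\<^sup>2"
    using sum_lessThan_telescope[of "\<lambda>n. (nrm (z n))\<^sup>2" N]
    by (simp only: sum.distrib sum_distrib_left[symmetric]) (simp add: power2_eq_square)
  moreover have "(nrm (z 0))\<^sup>2 \<le> P\<^sup>2"
    using bound[of 0] nrm_nonneg[OF z[of 0]] by (intro power_mono) auto
  ultimately show "2 * dt * (\<Sum>n<N. A n) \<le> 3 * P\<^sup>2" using zero_le_power2[of "nrm (z N)"] by linarith
qed

end

section \<open>The error of the reduced order model\<close>

lemma sum_lessThan_add: "(\<Sum>j<p + (q::nat). h j) = (\<Sum>j<p. h j) + (\<Sum>n<q. h (p + n) :: real)"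
  by (induction q) (auto simp: add.assoc)

lemma sum_squared_le: "(\<Sum>n<N. f n)\<^sup>2 \<le> real N * (\<Sum>n<N. (f n :: real)\<^sup>2)"
  using Cauchy_Schwarz_ineq_sum[of "\<lambda>_. 1" f "{..<N}"] by simp

text \<open>Here m stands for the L2 inner product and a for the inner product of gradients.
  Agreement of their null functions suffices as a link because the error estimates never compare the
  two norms.\<close>

locale two_forms = m: real_semi_inner V m + a: real_semi_inner X a
  for V X :: "('x \<Rightarrow> real) set" and m a +
  assumes X_sub: "v \<in> X \<Longrightarrow> v \<in> V"
    and null_iff: "v \<in> X \<Longrightarrow> m v v = 0 \<longleftrightarrow> a v v = 0"

text \<open>There are M snapshots v, the rows Z i are the eigenvectors and s is the rank. The inner
  product of the decomposition does not occur: its contribution is condensed into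
  \<open>null\<close> and \<open>definite\<close>, so both Hilbert spaces are treated
  together.\<close>

locale pod_rom = two_forms V X m a
  for V X :: "('x \<Rightarrow> real) set" and m a +
  fixes M s r :: nat and v :: "nat \<Rightarrow> 'x \<Rightarrow> real" and lam :: "nat \<Rightarrow> real"
    and Z :: "nat \<Rightarrow> nat \<Rightarrow> real" and \<phi> :: "nat \<Rightarrow> 'x \<Rightarrow> real"
  assumes v_in: "j < M \<Longrightarrow> v j \<in> X"
    and Z_col: "j < M \<Longrightarrow> k < M \<Longrightarrow> (\<Sum>i=1..M. Z i j * Z i k) = (if j = k then 1 else 0)"
    and rs: "r \<le> s" "s \<le> M"
    and lam_pos: "i \<in> {1..s} \<Longrightarrow> 0 < lam i"
    and phi: "i \<in> {1..s} \<Longrightarrow> \<phi> i = (\<lambda>x. (\<Sum>j<M. Z i j * v j x) / (sqrt (lam i) * sqrt (real M)))"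
    and null: "i \<in> {s+1..M} \<Longrightarrow> a (\<lambda>x. \<Sum>j<M. Z i j * v j x) (\<lambda>x. \<Sum>j<M. Z i j * v j x) = 0"
    and definite: "p \<in> pod_space \<phi> r \<Longrightarrow> a p p = 0 \<Longrightarrow> p = (\<lambda>x. 0)"
begin

abbreviation "Xr \<equiv> pod_space \<phi> r"

text \<open>The modes before normalisation. Unlike \<open>\<phi> i\<close> they remain meaningful
  for a vanishing eigenvalue, and they arise from the snapshots by an orthogonal
  transformation.\<close>

definition y :: "nat \<Rightarrow> 'x \<Rightarrow> real" where "y i = (\<lambda>x. \<Sum>j<M. Z i j * v j x)"

lemma y_in: "y i \<in> X"
  unfolding y_def using v_in by (intro a.rsum_mem) auto

lemma phi_y: "i \<in> {1..s} \<Longrightarrow> \<phi> i = (\<lambda>x. (1 / (sqrt (lam i) * sqrt (real M))) * y i x)"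
  by (simp add: phi y_def)

lemma phi_in: "i \<in> {1..s} \<Longrightarrow> \<phi> i \<in> X"
  unfolding phi_y by (intro a.rscale y_in)

lemma y_phi: "i \<in> {1..s} \<Longrightarrow> y i = (\<lambda>x. sqrt (lam i * real M) * \<phi> i x)"
  using lam_pos[of i] rs by (auto simp: phi_y real_sqrt_mult)

lemma Xr_sub: "w \<in> Xr \<Longrightarrow> w \<in> X"
  by (rule a.pod_space_subset[of r \<phi>]) (use phi_in rs in auto)

section \<open>The Ritz projection onto the span of the first r modes\<close>

definition R :: "('x \<Rightarrow> real) \<Rightarrow> 'x \<Rightarrow> real" where
  "R w = (THE p. p \<in> Xr \<and> (\<forall>v\<in>Xr. a (\<lambda>x. w x - p x) v = 0))"

lemma R_unique:
  assumes "w \<in> X" "p \<in> Xr" "\<And>v. v \<in> Xr \<Longrightarrow> a (\<lambda>x. w x - p x) v = 0"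
  shows "R w = p"
  unfolding R_def
proof (rule the_equality)
  show "p \<in> Xr \<and> (\<forall>v\<in>Xr. a (\<lambda>x. w x - p x) v = 0)" using assms by auto
  fix q assume q: "q \<in> Xr \<and> (\<forall>v\<in>Xr. a (\<lambda>x. w x - q x) v = 0)"
  have d: "(\<lambda>x. q x - p x) \<in> Xr" using pod_space_lin[of q \<phi> r p 1 "-1"] q assms by simp
  have X: "p \<in> X" "q \<in> X" using Xr_sub q assms by auto
  have "a (\<lambda>x. q x - p x) (\<lambda>x. q x - p x)
      = a (\<lambda>x. w x - p x) (\<lambda>x. q x - p x) - a (\<lambda>x. w x - q x) (\<lambda>x. q x - p x)"
    using X assms(1) Xr_sub[OF d] by (simp add: a.diff_left)
  also have "\<dots> = 0" using assms(3) q d by simp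
  finally have "(\<lambda>x. q x - p x) = (\<lambda>x. 0)" using definite d by blast
  then show "q = p" by (simp add: fun_eq_iff)
qed

lemma
  assumes "w \<in> X"
  shows R_mem: "R w \<in> Xr" and R_orth: "u \<in> Xr \<Longrightarrow> a (\<lambda>x. w x - R w x) u = 0"
proof -
  have "\<And>i. i \<in> {1..r} \<Longrightarrow> \<phi> i \<in> X" using phi_in rs by auto
  from a.projection_exists[OF this assms, of r id]
  obtain p where p: "p \<in> Xr" "\<And>v. v \<in> Xr \<Longrightarrow> a (\<lambda>x. w x - p x) v = 0" by auto
  moreover from this have "R w = p" using R_unique[OF assms] by auto
  ultimately show "R w \<in> Xr" "u \<in> Xr \<Longrightarrow> a (\<lambda>x. w x - R w x) u = 0" by auto
qed

lemma R_in: "w \<in> X \<Longrightarrow> R w \<in> X"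
  using R_mem Xr_sub by blast

text \<open>By uniqueness the projection is linear as a map on functions, not only almost
  everywhere. Hence it commutes with averages and difference quotients by plain equality.\<close>

lemma R_lin:
  assumes "w \<in> X" "u \<in> X"
  shows "R (\<lambda>x. c * w x + d * u x) = (\<lambda>x. c * R w x + d * R u x)"
proof (rule R_unique)
  show "(\<lambda>x. c * w x + d * u x) \<in> X" using assms by (intro a.add a.rscale)
  show "(\<lambda>x. c * R w x + d * R u x) \<in> Xr" using assms by (intro pod_space_lin R_mem)
  fix q assume q: "q \<in> Xr"
  have "a (\<lambda>x. c * (w x - R w x) + d * (u x - R u x)) q = 0"
    using assms q R_in by (simp add: a.add_left a.rscale_left a.rscale a.diff R_orth Xr_sub)
  moreover have "(\<lambda>x. c * (w x - R w x) + d * (u x - R u x))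
      = (\<lambda>x. c * w x + d * u x - (c * R w x + d * R u x))" by (simp add: algebra_simps)
  ultimately show "a (\<lambda>x. c * w x + d * u x - (c * R w x + d * R u x)) q = 0" by simp
qed

lemma R_orthogonal: "w \<in> X \<Longrightarrow> (\<And>u. u \<in> Xr \<Longrightarrow> a w u = 0) \<Longrightarrow> R w = (\<lambda>x. 0)"
  by (rule R_unique) (auto simp: pod_space_zero)

lemma R_id: "w \<in> Xr \<Longrightarrow> R w = w"
  by (rule R_unique) (auto simp: a.zero_left Xr_sub)

section \<open>Projection errors of snapshots and modes\<close>

definition eta :: "('x \<Rightarrow> real) \<Rightarrow> 'x \<Rightarrow> real" where "eta w = (\<lambda>x. w x - R w x)"

lemma eta_in: "w \<in> X \<Longrightarrow> eta w \<in> X"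
  unfolding eta_def by (intro a.diff R_in)

lemma eta_lin: "w \<in> X \<Longrightarrow> u \<in> X \<Longrightarrow> eta (\<lambda>x. c * w x + d * u x) = (\<lambda>x. c * eta w x + d * eta u x)"
  by (simp add: eta_def R_lin algebra_simps)

lemma eta_zero: "eta (\<lambda>x. 0) = (\<lambda>x. 0)"
  using R_id[OF pod_space_zero] by (simp add: eta_def)

lemma eta_scale: "w \<in> X \<Longrightarrow> eta (\<lambda>x. c * w x) = (\<lambda>x. c * eta w x)"
  using eta_lin[of w w c 0] by simp

lemma eta_sum: "(\<And>i. i \<in> I \<Longrightarrow> w i \<in> X) \<Longrightarrow> eta (\<lambda>x. \<Sum>i\<in>I. c i * w i x) = (\<lambda>x. \<Sum>i\<in>I. c i * eta (w i) x)"
proof (induction I rule: infinite_finite_induct)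
  case (insert j I)
  have "eta (\<lambda>x. c j * w j x + 1 * (\<Sum>i\<in>I. c i * w i x))
      = (\<lambda>x. c j * eta (w j) x + 1 * eta (\<lambda>x. \<Sum>i\<in>I. c i * w i x) x)"
    using insert.prems by (intro eta_lin a.rsum_mem) auto
  then show ?case using insert by simp
qed (auto simp: eta_zero)

text \<open>Summation over the rows of the orthogonal matrix \<open>Z\<close> turns the projection errors of the
  snapshots into those of the modes.\<close>

lemma sum_eta_snapshots:
  assumes W: "real_semi_inner W B" and sub: "\<And>w. w \<in> X \<Longrightarrow> w \<in> W"
    and nl: "\<And>w. w \<in> X \<Longrightarrow> a w w = 0 \<Longrightarrow> B w w = 0"
  shows "(\<Sum>j<M. B (eta (v j)) (eta (v j)))
    = real M * (\<Sum>i=r+1..s. lam i * B (eta (\<phi> i)) (eta (\<phi> i)))"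
proof -
  interpret W: real_semi_inner W B by (rule W)
  let ?e = "\<lambda>j. eta (v j)"
  have eW: "?e j \<in> W" if "j < M" for j using that by (intro sub eta_in v_in)
  have "B (eta (y i)) (eta (y i)) = (\<Sum>j<M. \<Sum>k<M. (Z i j * Z i k) * B (?e j) (?e k))" for i
  proof -
    have e: "eta (y i) = (\<lambda>x. \<Sum>j<M. Z i j * ?e j x)" unfolding y_def using v_in by (intro eta_sum) auto
    have m: "(\<lambda>x. \<Sum>j<M. Z i j * ?e j x) \<in> W" using eW by (intro W.rsum_mem) auto
    have "B (eta (y i)) (eta (y i)) = (\<Sum>j<M. Z i j * B (?e j) (\<lambda>x. \<Sum>k<M. Z i k * ?e k x))"
      unfolding e using eW m by (intro W.rsum_left) auto
    also have "\<dots> = (\<Sum>j<M. Z i j * (\<Sum>k<M. Z i k * B (?e j) (?e k)))"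
      using eW by (intro sum.cong arg_cong[where f = "\<lambda>t. _ * t"] W.rsum_right) auto
    finally show ?thesis by (simp add: sum_distrib_left mult.assoc)
  qed
  then have "(\<Sum>i=1..M. B (eta (y i)) (eta (y i)))
      = (\<Sum>i=1..M. \<Sum>j<M. \<Sum>k<M. (Z i j * Z i k) * B (?e j) (?e k))" by simp
  also have "\<dots> = (\<Sum>j<M. \<Sum>k<M. (\<Sum>i=1..M. Z i j * Z i k) * B (?e j) (?e k))"
    by (subst sum.swap, rule sum.cong[OF refl], subst sum.swap) (simp add: sum_distrib_right)
  also have "\<dots> = (\<Sum>j<M. \<Sum>k<M. if j = k then B (?e j) (?e k) else 0)"
    by (intro sum.cong refl) (simp add: Z_col del: One_nat_def)
  also have "\<dots> = (\<Sum>j<M. B (?e j) (?e j))" by simp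
  finally have 1: "(\<Sum>j<M. B (?e j) (?e j)) = (\<Sum>i=1..M. B (eta (y i)) (eta (y i)))" by simp
  \<comment> \<open>Beyond the rank \<open>y i\<close> is null, hence orthogonal to the span. Its
    projection is zero, so its projection error is \<open>y i\<close> itself, on which B vanishes
    too.\<close>
  have hi: "B (eta (y i)) (eta (y i)) = 0" if "i \<in> {s+1..M}" for i
  proof -
    have 0: "a (y i) (y i) = 0" using null[OF that] by (simp add: y_def)
    then have "a (y i) u = 0" if "u \<in> Xr" for u
      using a.null_right[of u "y i"] a.sym[of u "y i"] that Xr_sub y_in by simp
    then have "eta (y i) = y i" unfolding eta_def using R_orthogonal[OF y_in] by simp
    then show ?thesis using nl[OF y_in 0] by simp
  qed
  have lo: "B (eta (y i)) (eta (y i)) = real M * (lam i * B (eta (\<phi> i)) (eta (\<phi> i)))" if "i \<in> {1..s}" for i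
  proof -
    have pW: "eta (\<phi> i) \<in> W" using that by (intro sub eta_in phi_in)
    have "eta (y i) = (\<lambda>x. sqrt (lam i * real M) * eta (\<phi> i) x)"
      unfolding y_phi[OF that] by (rule eta_scale) (rule phi_in[OF that])
    then have "B (eta (y i)) (eta (y i)) = (sqrt (lam i * real M))\<^sup>2 * B (eta (\<phi> i)) (eta (\<phi> i))"
      using pW by (simp add: W.rscale_left W.rscale_right W.rscale power2_eq_square)
    then show ?thesis using lam_pos[OF that] by simp
  qed
  \<comment> \<open>The first r modes are reproduced by the projection, so that the sum starts at r
    + 1.\<close>
  have small: "B (eta (\<phi> i)) (eta (\<phi> i)) = 0" if "i \<in> {1..r}" for i
    using R_id[OF pod_space_mem[of i r \<phi>, OF that]] W.zero_left[OF W.zero] by (simp add: eta_def)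
  have "(\<Sum>i=1..M. B (eta (y i)) (eta (y i))) = (\<Sum>i=r+1..s. B (eta (y i)) (eta (y i)))"
  proof (rule sum.mono_neutral_right)
    show "\<forall>i\<in>{1..M} - {r+1..s}. B (eta (y i)) (eta (y i)) = 0"
    proof
      fix i assume "i \<in> {1..M} - {r+1..s}"
      then consider "i \<in> {1..r}" | "i \<in> {s+1..M}" by fastforce
      then show "B (eta (y i)) (eta (y i)) = 0"
        by cases (use small lo[of i] rs hi in auto)
    qed
  qed (use rs in auto)
  also have "\<dots> = (\<Sum>i=r+1..s. real M * (lam i * B (eta (\<phi> i)) (eta (\<phi> i))))"
    by (intro sum.cong lo) auto
  finally show ?thesis using 1 by (simp add: sum_distrib_left)
qed

lemma sum_eta_nonneg: "0 \<le> (\<Sum>i=r+1..s. lam i * m (eta (\<phi> i)) (eta (\<phi> i)))"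
  and sum_eta_nonneg': "0 \<le> (\<Sum>i=r+1..s. lam i * a (eta (\<phi> i)) (eta (\<phi> i)))"
proof -
  have l: "0 \<le> lam i" "eta (\<phi> i) \<in> X" if "i \<in> {r+1..s}" for i
    using lam_pos[of i] phi_in[of i] that by (auto intro!: eta_in less_imp_le)
  show "0 \<le> (\<Sum>i=r+1..s. lam i * m (eta (\<phi> i)) (eta (\<phi> i)))"
    by (intro sum_nonneg mult_nonneg_nonneg m.nonneg X_sub l)
  show "0 \<le> (\<Sum>i=r+1..s. lam i * a (eta (\<phi> i)) (eta (\<phi> i)))"
    by (intro sum_nonneg mult_nonneg_nonneg a.nonneg l)
qed

lemma eta_diff_quot:
  assumes "\<And>n. n \<le> N \<Longrightarrow> z n \<in> X" "n < N"
  shows "eta (diff_quot dt z n) = diff_quot dt (\<lambda>n. eta (z n)) n"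
proof -
  have "diff_quot dt z n = (\<lambda>x. (1/dt) * z (Suc n) x + (-1/dt) * z n x)"
    by (auto simp: diff_quot_def diff_divide_distrib)
  then show ?thesis using assms by (simp only: eta_lin) (auto simp: diff_quot_def diff_divide_distrib)
qed

lemma R_half_avg:
  assumes "\<And>n. n \<le> N \<Longrightarrow> z n \<in> X" "n < N"
  shows "R (half_avg z n) = half_avg (\<lambda>n. R (z n)) n"
proof -
  have "half_avg z n = (\<lambda>x. (1/2) * z (Suc n) x + (1/2) * z n x)"
    by (auto simp: half_avg_def)
  then show ?thesis using assms by (simp only: R_lin) (auto simp: half_avg_def)
qed

text \<open>The difference quotients among the snapshots control the increments of the projection error,
  so that averaging over the time levels \<open>j\<close> bounds the projection error at each single level.\<close>

lemma projection_error:
  assumes M: "M = 2 * N + 1" "1 \<le> N" and T: "0 < T" and dt: "dt = T / real N"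
    and us: "\<And>n. n \<le> N \<Longrightarrow> us n = v n"
    and dq: "\<And>n. n < N \<Longrightarrow> v (N + 1 + n) = diff_quot dt us n"
  defines "Sm \<equiv> \<Sum>i=r+1..s. lam i * m (eta (\<phi> i)) (eta (\<phi> i))"
    and "Sa \<equiv> \<Sum>i=r+1..s. lam i * a (eta (\<phi> i)) (eta (\<phi> i))"
  shows "dt * (\<Sum>n<N. m (eta (diff_quot dt us n)) (eta (diff_quot dt us n))) \<le> 3 * T * Sm" (is "?A")
    and "\<And>k. k \<le> N \<Longrightarrow> m (eta (us k)) (eta (us k)) \<le> (4 + 6 * T\<^sup>2) * Sm"
    and "dt * (\<Sum>n\<le>N. a (eta (us n)) (eta (us n))) \<le> 3 * T * Sa"
proof -
  let ?d = "\<lambda>n. eta (diff_quot dt us n)"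
  have dtp: "0 < dt" "dt * real N = T" using T M dt by auto
  have usX: "us n \<in> X" if "n \<le> N" for n using us v_in M that by simp
  have edq: "?d n = diff_quot dt (\<lambda>n. eta (us n)) n" if "n < N" for n
    using eta_diff_quot[of N us n dt] usX that by simp
  \<comment> \<open>Since N is at least 1, the number 2 N + 1 of snapshots is at most 3 N; this is
    the origin of 3 T.\<close>
  have M3: "dt * (real M * S) \<le> 3 * T * S" if "0 \<le> S" for S
  proof -
    have "dt * real M \<le> dt * (3 * real N)" using dtp M by (intro mult_left_mono) auto
    also have "\<dots> = 3 * T" using dtp by simp
    finally show ?thesis using that by (simp add: mult.assoc[symmetric] mult_right_mono)
  qed
  have split: "(\<Sum>j<M. g (v j)) = (\<Sum>n\<le>N. g (us n)) + (\<Sum>n<N. g (diff_quot dt us n))"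
    for g :: "('x \<Rightarrow> real) \<Rightarrow> real"
  proof -
    have "(\<Sum>j<M. g (v j)) = (\<Sum>j<N+1. g (v j)) + (\<Sum>n<N. g (v (N + 1 + n)))"
      using sum_lessThan_add[of "\<lambda>j. g (v j)" "N + 1" N] M by (simp add: mult_2)
    then show ?thesis using us dq by (simp add: lessThan_Suc_atMost)
  qed
  have m0: "0 \<le> m (eta (us n)) (eta (us n))" if "n \<le> N" for n
    by (intro m.nonneg X_sub eta_in usX that)
  have a0: "0 \<le> a (eta (us n)) (eta (us n))" if "n \<le> N" for n
    by (intro a.nonneg eta_in usX that)
  have dqX: "diff_quot dt us n \<in> X" if "n < N" for n
    using a.diff_quot_mem[of N us n dt] usX that by simp
  have md0: "0 \<le> m (?d n) (?d n)" if "n < N" for n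
    by (intro m.nonneg X_sub eta_in dqX that)
  have ad0: "0 \<le> a (?d n) (?d n)" if "n < N" for n
    by (intro a.nonneg eta_in dqX that)
  have mS: "(\<Sum>n\<le>N. m (eta (us n)) (eta (us n)))
      + (\<Sum>n<N. m (?d n) (?d n)) = real M * Sm"
    unfolding Sm_def split[of "\<lambda>w. m (eta w) (eta w)", symmetric]
    by (rule sum_eta_snapshots[of V m]) (use m.real_semi_inner_axioms X_sub null_iff in auto)
  have aS: "(\<Sum>n\<le>N. a (eta (us n)) (eta (us n)))
      + (\<Sum>n<N. a (?d n) (?d n)) = real M * Sa"
    unfolding Sa_def split[of "\<lambda>w. a (eta w) (eta w)", symmetric]
    by (rule sum_eta_snapshots[of X a]) (use a.real_semi_inner_axioms in auto)
  have "0 \<le> Sm" "0 \<le> Sa" unfolding Sm_def Sa_def by (rule sum_eta_nonneg sum_eta_nonneg')+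
  have le: "(\<Sum>n<N. m (?d n) (?d n)) \<le> real M * Sm"
    "(\<Sum>n\<le>N. m (eta (us n)) (eta (us n))) \<le> real M * Sm"
    "(\<Sum>n\<le>N. a (eta (us n)) (eta (us n))) \<le> real M * Sa"
    using mS aS sum_nonneg[of "{..N}" "\<lambda>n. m (eta (us n)) (eta (us n))"]
      sum_nonneg[of "{..<N}" "\<lambda>n. m (?d n) (?d n)"]
      sum_nonneg[of "{..<N}" "\<lambda>n. a (?d n) (?d n)"] m0 md0 ad0
    by auto
  show A: ?A
    using mult_left_mono[OF le(1), of dt] dtp M3[OF \<open>0 \<le> Sm\<close>] by linarith
  show "dt * (\<Sum>n\<le>N. a (eta (us n)) (eta (us n))) \<le> 3 * T * Sa"
    using mult_left_mono[OF le(3), of dt] dtp M3[OF \<open>0 \<le> Sa\<close>] by linarith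
  \<comment> \<open>D bounds the total variation, over the grid, of the norm of the projection
    error. Cauchy-Schwarz over the N steps reduces its square to the sum of squares bounded
    before.\<close>
  define D where "D = dt * (\<Sum>n<N. m.nrm (?d n))"
  have D0: "0 \<le> D" unfolding D_def using dtp
    by (intro mult_nonneg_nonneg sum_nonneg m.nrm_nonneg X_sub eta_in dqX) auto
  have D2: "D\<^sup>2 \<le> 3 * T\<^sup>2 * Sm"
  proof -
    have "D\<^sup>2 \<le> dt\<^sup>2 * (real N * (\<Sum>n<N. (m.nrm (?d n))\<^sup>2))"
      unfolding D_def power_mult_distrib by (intro mult_left_mono sum_squared_le) auto
    also have "(\<Sum>n<N. (m.nrm (?d n))\<^sup>2)
        = (\<Sum>n<N. m (?d n) (?d n))"
      by (intro sum.cong refl m.nrm_squared X_sub eta_in dqX) simp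
    also have "dt\<^sup>2 * (real N * (\<Sum>n<N. m (?d n) (?d n)))
        = T * (dt * (\<Sum>n<N. m (?d n) (?d n)))"
      unfolding dtp(2)[symmetric] by (simp add: power2_eq_square)
    also have "\<dots> \<le> T * (3 * T * Sm)" using A T by (intro mult_left_mono) auto
    finally show ?thesis by (simp add: power2_eq_square)
  qed
  have eX: "eta (us n) \<in> V" if "n \<le> N" for n by (intro X_sub eta_in usX that)
  have up: "m.nrm (eta (us k)) \<le> m.nrm (eta (us j)) + D" if "j \<le> N" "k \<le> N" for j k
  proof -
    have inc: "m.nrm (\<lambda>x. eta (us (Suc n)) x - eta (us n) x) = dt * m.nrm (?d n)" if "n < N" for n
    proof -
      have "(\<lambda>x. eta (us (Suc n)) x - eta (us n) x) = (\<lambda>x. dt * ?d n x)"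
        unfolding edq[OF that] using dtp by (simp add: diff_quot_def)
      then show ?thesis using m.rnrm_scale[OF X_sub[OF eta_in[OF dqX[OF that]]]] dtp by simp
    qed
    have st: "\<bar>m.nrm (eta (us (Suc n))) - m.nrm (eta (us n))\<bar> \<le> dt * m.nrm (?d n)"
      if "n < N" for n
    proof -
      have V: "eta (us (Suc n)) \<in> V" "eta (us n) \<in> V" using eX that by auto
      have "m.nrm (eta (us (Suc n))) \<le> m.nrm (\<lambda>x. eta (us (Suc n)) x - eta (us n) x) + m.nrm (eta (us n))"
        using m.nrm_triangle[OF m.diff[OF V] V(2)] by simp
      moreover have "m.nrm (eta (us n)) \<le> m.nrm (eta (us (Suc n))) + m.nrm (\<lambda>x. eta (us (Suc n)) x - eta (us n) x)"
        using m.nrm_diff_le[OF V(1) m.diff[OF V]] by simp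
      ultimately show ?thesis using inc[OF that] by linarith
    qed
    have tel: "\<bar>m.nrm (eta (us q)) - m.nrm (eta (us p))\<bar> \<le> D" if "p \<le> q" "q \<le> N" for p q
    proof -
      have "\<bar>m.nrm (eta (us q)) - m.nrm (eta (us p))\<bar>
          = \<bar>\<Sum>n=p..<q. m.nrm (eta (us (Suc n))) - m.nrm (eta (us n))\<bar>"
        using sum_Suc_diff'[OF that(1), of "\<lambda>n. m.nrm (eta (us n))"] by simp
      also have "\<dots> \<le> (\<Sum>n=p..<q. dt * m.nrm (?d n))"
      proof (rule order_trans[OF sum_abs], rule sum_mono)
        fix n assume "n \<in> {p..<q}"
        then show "\<bar>m.nrm (eta (us (Suc n))) - m.nrm (eta (us n))\<bar> \<le> dt * m.nrm (?d n)"
          using that by (intro st) auto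
      qed
      also have "\<dots> \<le> (\<Sum>n<N. dt * m.nrm (?d n))"
      proof (rule sum_mono2)
        show "finite {..<N}" by simp
        show "{p..<q} \<subseteq> {..<N}" using that(2) by (simp add: subset_iff)
        show "0 \<le> dt * m.nrm (?d n)" if "n \<in> {..<N} - {p..<q}" for n
        proof -
          have "n < N" using that by simp
          then show ?thesis using dtp(1) m.nrm_nonneg[OF X_sub[OF eta_in[OF dqX]]] by (intro mult_nonneg_nonneg) simp_all
        qed
      qed
      finally show ?thesis by (simp add: D_def sum_distrib_left)
    qed
    show ?thesis using tel[of j k] tel[of k j] that by (cases "j \<le> k") auto
  qed
  fix k assume k: "k \<le> N"
  have each: "m (eta (us k)) (eta (us k)) \<le> 2 * m (eta (us j)) (eta (us j)) + 6 * T\<^sup>2 * Sm" if "j \<le> N" for j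
  proof -
    have "(m.nrm (eta (us k)))\<^sup>2 \<le> (m.nrm (eta (us j)) + D)\<^sup>2"
      using up[OF that k] m.nrm_nonneg[OF eX[OF k]] by (intro power_mono) auto
    also have "\<dots> \<le> 2 * (m.nrm (eta (us j)))\<^sup>2 + 2 * D\<^sup>2"
      using sum_squares_bound[of "m.nrm (eta (us j))" D] by (simp add: power2_sum)
    finally show ?thesis using D2 k that by (simp add: m.nrm_squared eX)
  qed
  \<comment> \<open>Summing over all N + 1 levels j replaces the unknown error at j by the sum of
    the squared snapshot errors. As M is at most 2 (N + 1), this gives the 4, while 6 T^2 stems from
    2 D^2.\<close>
  have "(\<Sum>j\<le>N. m (eta (us k)) (eta (us k))) \<le> (\<Sum>j\<le>N. 2 * m (eta (us j)) (eta (us j)) + 6 * T\<^sup>2 * Sm)"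
    by (intro sum_mono each) simp
  then have "(real N + 1) * m (eta (us k)) (eta (us k))
      \<le> 2 * (\<Sum>j\<le>N. m (eta (us j)) (eta (us j))) + (real N + 1) * (6 * T\<^sup>2 * Sm)"
    by (simp add: sum.distrib sum_distrib_left algebra_simps)
  also have "\<dots> \<le> 2 * (real M * Sm) + (real N + 1) * (6 * T\<^sup>2 * Sm)" using le(2) by simp
  also have "\<dots> \<le> 2 * ((2 * (real N + 1)) * Sm) + (real N + 1) * (6 * T\<^sup>2 * Sm)"
    using M \<open>0 \<le> Sm\<close> by (intro add_right_mono mult_left_mono mult_right_mono) auto
  also have "\<dots> = (real N + 1) * ((4 + 6 * T\<^sup>2) * Sm)" by (simp add: algebra_simps)
  finally show "m (eta (us k)) (eta (us k)) \<le> (4 + 6 * T\<^sup>2) * Sm"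
    by (rule mult_left_le_imp_le) simp
qed

text \<open>The error is the projection error minus the discrete part z, which
  \<open>cn_stability\<close> controls. In C, the term 8 + 12 T^2 is twice the pointwise constant of
  \<open>projection_error\<close>, 6 T comes from the gradients of the projection errors, and the
  last factor dominates the coefficients in the bound for P^2. That bound enters with weight 2 from
  splitting the error and 3 / \<nu> from the energy part of the stability estimate.\<close>

lemma rom_error:
  assumes M: "M = 2 * N + 1" "1 \<le> N" and T: "0 < T" "0 < \<nu>" and dt: "dt = T / real N"
    and us: "\<And>n. n \<le> N \<Longrightarrow> us n = v n"
    and dq: "\<And>n. n < N \<Longrightarrow> v (N + 1 + n) = diff_quot dt us n"
    and ur: "\<And>n. n \<le> N \<Longrightarrow> ur n \<in> Xr" and tau: "\<And>n. n < N \<Longrightarrow> \<tau> n \<in> V"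
    and eq: "\<And>n w. n < N \<Longrightarrow> w \<in> Xr \<Longrightarrow>
      m (diff_quot dt ur n) w + \<nu> * a (half_avg ur n) w
      = m (diff_quot dt us n) w - m (\<tau> n) w + \<nu> * a (half_avg us n) w"
    and Q: "dt * (\<Sum>n<N. m (\<tau> n) (\<tau> n)) \<le> Q"
  defines "Sm \<equiv> \<Sum>i=r+1..s. lam i * m (eta (\<phi> i)) (eta (\<phi> i))"
    and "Sa \<equiv> \<Sum>i=r+1..s. lam i * a (eta (\<phi> i)) (eta (\<phi> i))"
    and "p0 \<equiv> m (\<lambda>x. ur 0 x - R (us 0) x) (\<lambda>x. ur 0 x - R (us 0) x)"
    and "e \<equiv> \<lambda>k x. us k x - ur k x"
    and "C \<equiv> 8 + 12 * T\<^sup>2 + 6 * T + (2 + 3 / \<nu>) * (2 + 12 * T\<^sup>2 + 4 * T)"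
  shows "k \<le> N \<Longrightarrow> m (e k) (e k) \<le> C * (Sm + p0 + Q)"
    and "m (e N) (e N) + dt * (\<Sum>n<N. a (half_avg e n) (half_avg e n)) \<le> C * (Sm + Sa + p0 + Q)"
proof -
  let ?d = "\<lambda>n. eta (diff_quot dt us n)"
  have dtp: "0 < dt" "dt * real N = T" using T M dt by auto
  have usX: "us n \<in> X" if "n \<le> N" for n using us v_in M that by simp
  have edq: "?d n = diff_quot dt (\<lambda>n. eta (us n)) n" if "n < N" for n
    using eta_diff_quot[of N us n dt] usX that by simp
  have dqX: "diff_quot dt us n \<in> X" if "n < N" for n
    using a.diff_quot_mem[of N us n dt] usX that by simp
  have urX: "ur n \<in> X" if "n \<le> N" for n using Xr_sub ur that by blast
  have S0: "0 \<le> Sm" "0 \<le> Sa" unfolding Sm_def Sa_def by (rule sum_eta_nonneg sum_eta_nonneg')+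
  note pe0 = projection_error[OF M T(1) dt us dq, folded Sm_def Sa_def]
  have pe1: "dt * (\<Sum>n<N. m (?d n) (?d n)) \<le> 3 * T * Sm"
    and pe2: "\<And>k. k \<le> N \<Longrightarrow> m (eta (us k)) (eta (us k)) \<le> (4 + 6 * T\<^sup>2) * Sm"
    and pe3: "dt * (\<Sum>n\<le>N. a (eta (us n)) (eta (us n))) \<le> 3 * T * Sa"
    using pe0 by simp_all
  define z where "z = (\<lambda>n x. ur n x - R (us n) x)"
  let ?h = "half_avg z"
  have zXr: "z n \<in> Xr" if "n \<le> N" for n
    using pod_space_lin[of "ur n" \<phi> r "R (us n)" 1 "-1"] ur R_mem usX that by (simp add: z_def)
  have zX: "z n \<in> X" if "n \<le> N" for n using zXr Xr_sub that by blast
  define g where "g = (\<lambda>n x. ?d n x - \<tau> n x)"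
  have etaV: "?d n \<in> V" if "n < N" for n by (intro X_sub eta_in dqX that)
  have gV: "g n \<in> V" if "n < N" for n
    unfolding g_def using etaV tau that by (intro m.diff) auto
  have hz: "half_avg z n \<in> Xr" if "n < N" for n
  proof -
    have "half_avg z n = (\<lambda>x. (1/2) * z (Suc n) x + (1/2) * z n x)" by (auto simp: half_avg_def)
    then show ?thesis using zXr that by (simp only:) (intro pod_space_lin, auto)
  qed
  have err: "m (diff_quot dt z n) w + \<nu> * a (half_avg z n) w = m (g n) w" if n: "n < N" and w: "w \<in> Xr" for n w
  proof -
    have wX: "w \<in> X" "w \<in> V" using Xr_sub X_sub w by auto
    \<comment> \<open>The projection is written as the function minus its projection error, so that
      the difference quotient of the latter appears as data for z.\<close>
    have dz: "diff_quot dt z n = (\<lambda>x. diff_quot dt ur n x - (diff_quot dt us n x - ?d n x))"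
      unfolding edq[OF n] by (auto simp: diff_quot_def z_def eta_def diff_divide_distrib)
    have az: "half_avg z n = (\<lambda>x. half_avg ur n x - R (half_avg us n) x)"
      using R_half_avg[of N us n] usX n by (auto simp: half_avg_def z_def diff_divide_distrib add_divide_distrib)
    have mem: "diff_quot dt ur n \<in> X" "half_avg ur n \<in> X" "half_avg us n \<in> X"
      using a.diff_quot_mem[of N ur n dt] a.half_avg_mem[of N _ n] usX urX n by auto
    have 1: "m (diff_quot dt z n) w = m (diff_quot dt ur n) w - (m (diff_quot dt us n) w - m (?d n) w)"
      unfolding dz using wX mem dqX[OF n] etaV[OF n] by (simp add: m.diff_left m.diff X_sub)
    have 2: "a (half_avg z n) w = a (half_avg ur n) w - a (R (half_avg us n)) w"
      unfolding az using wX mem R_in by (simp add: a.diff_left)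
    \<comment> \<open>Here the choice of the Ritz projection pays off: the gradient of the
      projection error disappears from the equation for z.\<close>
    have 3: "a (half_avg us n) w = a (R (half_avg us n)) w"
      using R_orth[OF mem(3) w] wX mem R_in by (simp add: a.diff_left)
    have 4: "m (g n) w = m (?d n) w - m (\<tau> n) w"
      unfolding g_def using etaV[OF n] tau[OF n] wX by (simp add: m.diff_left)
    show ?thesis unfolding 1 2 4 using eq[OF n w] 3 by (simp add: algebra_simps)
  qed
  define P where "P = m.nrm (z 0) + dt * (\<Sum>n<N. m.nrm (g n))"
  have zV: "z n \<in> V" if "n \<le> N" for n using zX X_sub that by blast
  have A0: "0 \<le> \<nu> * a (?h n) (?h n)" if "n < N" for n
    using T Xr_sub[OF hz[OF that]] a.nonneg by simp
  note cs0 = m.cn_stability[of dt N z g "\<lambda>n. \<nu> * a (?h n) (?h n)", folded P_def]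
  have cs1: "m.nrm (z k) \<le> P" if "k \<le> N" for k
    using cs0(1)[OF dtp(1) zV gV A0 err[OF _ hz] that] by simp
  have cs2: "2 * dt * (\<Sum>n<N. \<nu> * a (?h n) (?h n)) \<le> 3 * P\<^sup>2"
    using cs0(2)[OF dtp(1) zV gV A0 err[OF _ hz]] by simp
  have P2: "P\<^sup>2 \<le> 2 * p0 + 12 * T\<^sup>2 * Sm + 4 * T * Q"
  proof -
    have "(dt * (\<Sum>n<N. m.nrm (g n)))\<^sup>2 \<le> dt\<^sup>2 * (real N * (\<Sum>n<N. (m.nrm (g n))\<^sup>2))"
      unfolding power_mult_distrib by (intro mult_left_mono sum_squared_le) auto
    also have "\<dots> = T * (dt * (\<Sum>n<N. m (g n) (g n)))"
      unfolding dtp(2)[symmetric] using gV by (simp add: power2_eq_square m.nrm_squared[unfolded power2_eq_square])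
    also have "(\<Sum>n<N. m (g n) (g n))
        \<le> (\<Sum>n<N. 2 * m (?d n) (?d n) + 2 * m (\<tau> n) (\<tau> n))"
      unfolding g_def using etaV tau by (intro sum_mono m.diff_squared_le) auto
    finally have "(dt * (\<Sum>n<N. m.nrm (g n)))\<^sup>2
        \<le> T * (2 * (dt * (\<Sum>n<N. m (?d n) (?d n)))
            + 2 * (dt * (\<Sum>n<N. m (\<tau> n) (\<tau> n))))"
      using T dtp by (simp add: sum.distrib sum_distrib_left algebra_simps mult_left_mono)
    also have "\<dots> \<le> T * (2 * (3 * T * Sm) + 2 * Q)"
      using pe1 Q T by (intro mult_left_mono add_mono) auto
    finally have G: "(dt * (\<Sum>n<N. m.nrm (g n)))\<^sup>2 \<le> 6 * T\<^sup>2 * Sm + 2 * T * Q"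
      by (simp add: power2_eq_square algebra_simps)
    have "P\<^sup>2 \<le> 2 * (m.nrm (z 0))\<^sup>2 + 2 * (dt * (\<Sum>n<N. m.nrm (g n)))\<^sup>2"
      unfolding P_def using sum_squares_bound[of "m.nrm (z 0)" "dt * (\<Sum>n<N. m.nrm (g n))"]
      by (simp add: power2_sum)
    moreover have "(m.nrm (z 0))\<^sup>2 = p0" using zV[of 0] by (simp add: m.nrm_squared p0_def z_def)
    ultimately show ?thesis using G by linarith
  qed
  have e_eq: "e k = (\<lambda>x. eta (us k) x - z k x)" for k by (auto simp: e_def eta_def z_def)
  have etaX: "eta (us k) \<in> X" if "k \<le> N" for k by (intro eta_in usX that)
  have ek: "m (e k) (e k) \<le> (8 + 12 * T\<^sup>2) * Sm + 2 * P\<^sup>2" if k: "k \<le> N" for k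
  proof -
    have "m (e k) (e k) \<le> 2 * m (eta (us k)) (eta (us k)) + 2 * m (z k) (z k)"
      unfolding e_eq using X_sub[OF etaX[OF k]] zV[OF k] by (intro m.diff_squared_le)
    moreover have "m (z k) (z k) \<le> P\<^sup>2"
      using cs1[OF k] zV[OF k] m.nrm_nonneg[OF zV[OF k]] by (simp add: m.nrm_squared[symmetric] power_mono)
    ultimately show ?thesis using pe2[OF k] by (simp add: algebra_simps)
  qed
  have "0 \<le> (\<Sum>n<N. m (\<tau> n) (\<tau> n))" using tau by (intro sum_nonneg m.nonneg) simp
  then have Q0: "0 \<le> Q" using Q mult_nonneg_nonneg[of dt] dtp(1) by (meson less_imp_le order_trans)
  have p00: "0 \<le> p0" using m.nonneg[OF zV[of 0]] by (simp add: p0_def z_def)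
  have n0: "0 \<le> 3 / \<nu>" using T by simp
  define K where "K = 2 + 12 * T\<^sup>2 + 4 * T"
  have K: "2 \<le> K" "12 * T\<^sup>2 \<le> K" "4 * T \<le> K" "0 \<le> K" using T by (auto simp: K_def)
  have PK: "P\<^sup>2 \<le> K * (Sm + p0 + Q)"
  proof -
    have "2 * p0 + 12 * T\<^sup>2 * Sm + 4 * T * Q \<le> K * p0 + K * Sm + K * Q"
      using K Q0 p00 S0 by (intro add_mono mult_right_mono) auto
    then show ?thesis using P2 by (simp add: algebra_simps)
  qed
  have T0: "0 \<le> T\<^sup>2" "0 \<le> T" using T by auto
  have C: "C = (8 + 12 * T\<^sup>2) + 6 * T + (2 + 3 / \<nu>) * K" by (simp add: C_def K_def)
  define W where "W = Sm + p0 + Q"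
  have W: "0 \<le> W" "Sm \<le> W" using S0 p00 Q0 by (auto simp: W_def)
  have SW: "(8 + 12 * T\<^sup>2) * Sm \<le> (8 + 12 * T\<^sup>2) * W" using W T0 by (intro mult_left_mono) auto
  show "m (e k) (e k) \<le> C * (Sm + p0 + Q)" if "k \<le> N"
  proof -
    have "m (e k) (e k) \<le> (8 + 12 * T\<^sup>2) * W + 2 * (K * W)"
      using ek[OF that] PK SW by (simp add: W_def)
    also have "\<dots> \<le> (8 + 12 * T\<^sup>2) * W + 2 * (K * W) + (6 * T * W + 3 / \<nu> * (K * W))"
      using T0 W K n0 by simp
    also have "\<dots> = C * W" unfolding C by (simp add: algebra_simps)
    finally show ?thesis by (simp add: W_def)
  qed
  have eXX: "e k \<in> X" if "k \<le> N" for k unfolding e_def using usX urX that by (intro a.diff) auto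
  have en: "dt * (\<Sum>n<N. a (half_avg e n) (half_avg e n)) \<le> 6 * T * Sa + 3 / \<nu> * P\<^sup>2"
  proof -
    let ?E = "\<lambda>n. a (eta (us n)) (eta (us n))"
    have E0: "0 \<le> ?E n" if "n \<le> N" for n using etaX that by (intro a.nonneg)
    have "a (half_avg e n) (half_avg e n) \<le> (?E (Suc n) + ?E n) + 2 * a (?h n) (?h n)"
      if n: "n < N" for n
    proof -
      have h: "half_avg e n = (\<lambda>x. half_avg (\<lambda>k. eta (us k)) n x - half_avg z n x)"
        by (simp add: fun_eq_iff half_avg_def e_eq add_divide_distrib diff_divide_distrib)
      have "a (half_avg e n) (half_avg e n)
          \<le> 2 * a (half_avg (\<lambda>k. eta (us k)) n) (half_avg (\<lambda>k. eta (us k)) n) + 2 * a (?h n) (?h n)"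
        unfolding h using a.half_avg_mem[of N _ n] etaX zX n by (intro a.diff_squared_le) auto
      moreover have "a (half_avg (\<lambda>k. eta (us k)) n) (half_avg (\<lambda>k. eta (us k)) n) \<le> (?E (Suc n) + ?E n) / 2"
        using a.half_avg_squared_le[of N "\<lambda>k. eta (us k)" n] etaX n by simp
      ultimately show ?thesis by simp
    qed
    then have "(\<Sum>n<N. a (half_avg e n) (half_avg e n))
        \<le> (\<Sum>n<N. (?E (Suc n) + ?E n) + 2 * a (?h n) (?h n))"
      by (intro sum_mono) simp
    also have "\<dots> = (\<Sum>n<N. ?E (Suc n)) + (\<Sum>n<N. ?E n) + 2 * (\<Sum>n<N. a (?h n) (?h n))"
      by (simp add: sum.distrib sum_distrib_left)
    \<comment> \<open>Each time level occurs in at most two of the averages.\<close>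
    also have "\<dots> \<le> (\<Sum>n\<le>N. ?E n) + (\<Sum>n\<le>N. ?E n) + 2 * (\<Sum>n<N. a (?h n) (?h n))"
    proof -
      have "(\<Sum>n<N. ?E (Suc n)) \<le> (\<Sum>n\<le>N. ?E n)"
        using E0[of 0] by (simp add: sum.atMost_shift)
      moreover have "(\<Sum>n<N. ?E n) \<le> (\<Sum>n\<le>N. ?E n)"
        using E0 by (intro sum_mono2) auto
      ultimately show ?thesis by simp
    qed
    finally have "dt * (\<Sum>n<N. a (half_avg e n) (half_avg e n))
        \<le> dt * ((\<Sum>n\<le>N. ?E n) + (\<Sum>n\<le>N. ?E n) + 2 * (\<Sum>n<N. a (?h n) (?h n)))"
      using dtp by (intro mult_left_mono) auto
    also have "\<dots> = 2 * (dt * (\<Sum>n\<le>N. ?E n)) + 2 * dt * (\<Sum>n<N. a (?h n) (?h n))"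
      by (simp add: algebra_simps)
    finally have "dt * (\<Sum>n<N. a (half_avg e n) (half_avg e n))
        \<le> 2 * (dt * (\<Sum>n\<le>N. ?E n)) + 2 * dt * (\<Sum>n<N. a (?h n) (?h n))" .
    moreover have "2 * dt * (\<Sum>n<N. a (?h n) (?h n)) \<le> 3 / \<nu> * P\<^sup>2"
      using cs2 T by (simp add: sum_distrib_left[symmetric] field_simps)
    ultimately show ?thesis using pe3 by simp
  qed
  show "m (e N) (e N) + dt * (\<Sum>n<N. a (half_avg e n) (half_avg e n)) \<le> C * (Sm + Sa + p0 + Q)"
  proof -
    have PP: "3 / \<nu> * P\<^sup>2 \<le> 3 / \<nu> * (K * W)" using PK n0 by (intro mult_left_mono) (auto simp: W_def)
    have "m (e N) (e N) + dt * (\<Sum>n<N. a (half_avg e n) (half_avg e n))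
        \<le> (8 + 12 * T\<^sup>2) * W + 2 * (K * W) + 6 * T * Sa + 3 / \<nu> * (K * W)"
      using ek[of N] en PK SW PP by (simp add: W_def)
    \<comment> \<open>The bracket is the nonnegative amount missing to a common factor C: before it,
      W carries the coefficient C - 6 T and Sa the coefficient 6 T.\<close>
    also have "\<dots> \<le> (8 + 12 * T\<^sup>2) * W + 2 * (K * W) + 6 * T * Sa + 3 / \<nu> * (K * W)
        + (6 * T * W + (C - 6 * T) * Sa)"
    proof -
      have "0 \<le> C - 6 * T" unfolding C using T0 n0 K by simp
      then show ?thesis using T0 W S0 by simp
    qed
    also have "\<dots> = C * (W + Sa)" unfolding C by (simp add: algebra_simps add_divide_distrib)
    finally show ?thesis by (simp add: W_def add_ac)
  qed
qed

end

section \<open>Eigensystems of the correlation matrix and the resulting modes\<close>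

lemma downward_closed_eq_atLeastAtMost_card:
  assumes "\<And>i j. i \<in> {1..M} \<Longrightarrow> j \<in> {1..M} \<Longrightarrow> i \<le> j \<Longrightarrow> P j \<Longrightarrow> P i"
  shows "{i\<in>{1..M::nat}. P i} = {1..card {i\<in>{1..M}. P i}}"
proof (cases "{i\<in>{1..M}. P i} = {}")
  case False
  let ?A = "{i\<in>{1..M}. P i}"
  have fin: "finite ?A" by simp
  have k: "Max ?A \<in> ?A" using False fin by (intro Max_in) auto
  have "?A = {1..Max ?A}"
  proof
    show "?A \<subseteq> {1..Max ?A}" using Max_ge[OF fin] by auto
    show "{1..Max ?A} \<subseteq> ?A"
    proof
      fix i assume "i \<in> {1..Max ?A}"
      then show "i \<in> ?A" using k assms[of i "Max ?A"] by simp
    qed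
  qed
  then show ?thesis by (metis card_atLeastAtMost diff_Suc_1 One_nat_def Suc_eq_plus1)
qed simp

text \<open>Here the matrix formulation is left behind: all that is used later about the eigensystem
  is expressed by finite sums over entries.\<close>

lemma ordered_eigensystem_pod_matrix:
  fixes z :: "nat \<Rightarrow> real Matrix.vec"
  assumes "ordered_eigensystem (pod_matrix h N v) lam z"
  defines "M \<equiv> 2 * N + 1"
  shows "i \<in> {1..M} \<Longrightarrow> l \<in> {1..M} \<Longrightarrow>
      (\<Sum>j<M. vec_index (z i) j * vec_index (z l) j) = (if i = l then 1 else 0)"
    and "j < M \<Longrightarrow> k < M \<Longrightarrow>
      (\<Sum>i=1..M. vec_index (z i) j * vec_index (z i) k) = (if j = k then 1 else 0)"
    and "i \<in> {1..M} \<Longrightarrow> j < M \<Longrightarrow>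
      (\<Sum>k<M. vec_index (z i) k * h (v j) (v k)) = real M * lam i * vec_index (z i) j"
    and "i \<in> {1..M} \<Longrightarrow> 0 \<le> lam i"
    and "i \<in> {1..pod_rank N lam} \<longleftrightarrow> i \<in> {1..M} \<and> 0 < lam i"
    and "pod_rank N lam \<le> M"
proof -
  let ?K = "pod_matrix h N v"
  have dim: "dim_row ?K = M" "dim_col ?K = M" by (auto simp: pod_matrix_def M_def)
  note oe = assms(1)[unfolded ordered_eigensystem_def dim]
  have ev: "eigenvector ?K (z i) (lam i)" and lam0: "0 \<le> lam i" if "i \<in> {1..M}" for i
    using bspec[OF conjunct1[OF oe] that] by simp_all
  have antimono: "lam j \<le> lam i" if "i \<in> {1..M}" "j \<in> {1..M}" "i \<le> j" for i j
    using bspec[OF bspec[OF conjunct2[OF conjunct2[OF oe]] that(1)] that(2)] that(3) by simp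
  have carr: "z i \<in> carrier_vec M" if "i \<in> {1..M}" for i
    using ev[OF that] dim by (simp add: eigenvector_def)
  show row: "(\<Sum>j<M. vec_index (z i) j * vec_index (z l) j) = (if i = l then 1 else 0)"
    if "i \<in> {1..M}" "l \<in> {1..M}" for i l
  proof -
    have "scalar_prod (z i) (z l) = (if i = l then 1 else 0)"
      by (rule bspec[OF bspec[OF conjunct1[OF conjunct2[OF oe]] that(1)] that(2)])
    then show ?thesis using carr[OF that(2)] by (simp add: scalar_prod_def atLeast0LessThan)
  qed
  \<comment> \<open>The eigenvectors become the rows; eigenpairs are numbered from 1 and rows from
    0, hence the successor.\<close>
  define A where "A = Matrix.mat M M (\<lambda>(i, j). vec_index (z (Suc i)) j)"
  have A: "A \<in> carrier_mat M M" "transpose_mat A \<in> carrier_mat M M" by (auto simp: A_def)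
  have AA: "A * transpose_mat A = 1\<^sub>m M"
  proof (rule eq_matI)
    fix i j assume ij: "i < dim_row (1\<^sub>m M :: real mat)" "j < dim_col (1\<^sub>m M :: real mat)"
    then have "index_mat (A * transpose_mat A) (i, j)
        = (\<Sum>k<M. vec_index (z (Suc i)) k * vec_index (z (Suc j)) k)"
      by (simp add: A_def scalar_prod_def atLeast0LessThan)
    also have "\<dots> = (if Suc i = Suc j then 1 else 0)" using ij by (intro row) auto
    finally show "index_mat (A * transpose_mat A) (i, j) = index_mat (1\<^sub>m M) (i, j)" using ij by simp
  qed (auto simp: A_def)
  \<comment> \<open>A one-sided inverse of a square matrix is two-sided, so orthonormal rows imply
    orthonormal columns.\<close>
  have At: "transpose_mat A * A = 1\<^sub>m M" by (rule mat_mult_left_right_inverse[OF A AA])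
  show "(\<Sum>i=1..M. vec_index (z i) j * vec_index (z i) k) = (if j = k then 1 else 0)"
    if "j < M" "k < M" for j k
  proof -
    have "index_mat (transpose_mat A * A) (j, k) = (\<Sum>i<M. vec_index (z (Suc i)) j * vec_index (z (Suc i)) k)"
      using that by (simp add: A_def scalar_prod_def atLeast0LessThan)
    moreover have "index_mat (transpose_mat A * A) (j, k) = (if j = k then 1 else 0)"
      unfolding At using that by simp
    moreover have "(\<Sum>i=1..M. vec_index (z i) j * vec_index (z i) k)
        = (\<Sum>i<M. vec_index (z (Suc i)) j * vec_index (z (Suc i)) k)"
      by (simp add: sum.atLeast1_atMost_eq)
    ultimately show ?thesis by simp
  qed
  show "(\<Sum>k<M. vec_index (z i) k * h (v j) (v k)) = real M * lam i * vec_index (z i) j"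
    if i: "i \<in> {1..M}" and j: "j < M" for i j
  proof -
    have "vec_index (mult_mat_vec ?K (z i)) j = vec_index (smult_vec (lam i) (z i)) j"
      using ev[OF i] by (simp add: eigenvector_def)
    moreover have "vec_index (mult_mat_vec ?K (z i)) j = (\<Sum>k<M. h (v j) (v k) / real M * vec_index (z i) k)"
      using j dim carr[OF i] by (simp add: pod_matrix_def scalar_prod_def atLeast0LessThan M_def)
    moreover have "vec_index (smult_vec (lam i) (z i)) j = lam i * vec_index (z i) j"
      using j carr[OF i] by simp
    ultimately have "(\<Sum>k<M. h (v j) (v k) / real M * vec_index (z i) k) = lam i * vec_index (z i) j" by simp
    then have "real M * (\<Sum>k<M. h (v j) (v k) / real M * vec_index (z i) k) = real M * (lam i * vec_index (z i) j)"
      by simp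
    moreover have "real M * (\<Sum>k<M. h (v j) (v k) / real M * vec_index (z i) k)
        = (\<Sum>k<M. vec_index (z i) k * h (v j) (v k))"
      unfolding sum_distrib_left by (intro sum.cong refl) (simp add: M_def)
    ultimately show ?thesis by (simp only: mult.assoc)
  qed
  show "0 \<le> lam i" if "i \<in> {1..M}" for i by (rule lam0[OF that])
  \<comment> \<open>Since the eigenvalues are ordered decreasingly, the positive ones occupy an
    initial segment, which is determined by their number.\<close>
  have "{i\<in>{1..M}. 0 < lam i} = {1..card {i\<in>{1..M}. 0 < lam i}}"
    using less_le_trans[OF _ antimono] by (intro downward_closed_eq_atLeastAtMost_card)
  then have s: "{i\<in>{1..M}. 0 < lam i} = {1..pod_rank N lam}" by (simp add: pod_rank_def M_def)
  then show "i \<in> {1..pod_rank N lam} \<longleftrightarrow> i \<in> {1..M} \<and> 0 < lam i" for i by blast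
  have "card {i\<in>{1..M}. 0 < lam i} \<le> card {1..M}" by (intro card_mono) auto
  then show "pod_rank N lam \<le> M" by (simp add: pod_rank_def M_def)
qed

text \<open>By the eigenvector equation the unnormalised modes are orthogonal for h with squared
  norms \<open>real M * lam i\<close>. So the modes are orthonormal and those beyond the rank are
  null for h, which transfers to a because both forms have the same null functions in X.\<close>

lemma pod_rom_of_eigensystem:
  fixes z :: "nat \<Rightarrow> real Matrix.vec"
  assumes "two_forms V X m a" and "real_semi_inner W h"
    and sub: "\<And>w. w \<in> X \<Longrightarrow> w \<in> W" and nl: "\<And>w. w \<in> X \<Longrightarrow> h w w = 0 \<longleftrightarrow> a w w = 0"
    and v: "\<And>j. j < 2 * N + 1 \<Longrightarrow> v j \<in> X"
    and es: "ordered_eigensystem (pod_matrix h N v) lam z" and r: "r \<le> pod_rank N lam"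
  defines "\<phi> \<equiv> pod_mode N v lam z"
  shows "pod_rom V X m a (2 * N + 1) (pod_rank N lam) r v lam (\<lambda>i. vec_index (z i)) \<phi>"
    and "\<And>i l. i \<in> {1..pod_rank N lam} \<Longrightarrow> l \<in> {1..pod_rank N lam} \<Longrightarrow>
      h (\<phi> i) (\<phi> l) = (if i = l then 1 else 0)"
proof -
  define M where "M = 2 * N + 1"
  let ?s = "pod_rank N lam"
  interpret two_forms V X m a by fact
  interpret W: real_semi_inner W h by fact
  note E = ordered_eigensystem_pod_matrix[OF es, folded M_def]
  define y where "y i = (\<lambda>x. \<Sum>j<M. vec_index (z i) j * v j x)" for i
  have vX: "v j \<in> X" if "j < M" for j using v that by (simp add: M_def)
  have yX: "y i \<in> X" for i unfolding y_def using vX by (intro a.rsum_mem) simp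
  have M0: "real M > 0" by (simp add: M_def)
  have phi: "\<phi> i = (\<lambda>x. (\<Sum>j<M. vec_index (z i) j * v j x) / (sqrt (lam i) * sqrt (real M)))" for i
    unfolding \<phi>_def M_def by (auto simp: pod_mode_def atLeast0AtMost lessThan_Suc_atMost)
  have phi_y: "\<phi> i = (\<lambda>x. 1 / (sqrt (lam i) * sqrt (real M)) * y i x)" for i
    by (simp add: phi y_def)
  have phiX: "\<phi> i \<in> X" for i unfolding phi_y by (intro a.rscale yX)
  have hy: "h (y i) (y l) = (if i = l then real M * lam l else 0)" if "i \<in> {1..M}" "l \<in> {1..M}" for i l
  proof -
    have "h (y i) (y l) = (\<Sum>j<M. vec_index (z i) j * h (v j) (y l))"
      unfolding y_def[of i] using vX sub yX by (intro W.rsum_left) auto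
    also have "\<dots> = (\<Sum>j<M. vec_index (z i) j * (\<Sum>k<M. vec_index (z l) k * h (v j) (v k)))"
      unfolding y_def using vX sub by (intro sum.cong arg_cong[where f = "\<lambda>t. _ * t"] W.rsum_right) auto
    also have "\<dots> = (\<Sum>j<M. (real M * lam l) * (vec_index (z i) j * vec_index (z l) j))"
      using that E(3)[of l] by (intro sum.cong) auto
    also have "\<dots> = (real M * lam l) * (\<Sum>j<M. vec_index (z i) j * vec_index (z l) j)"
      by (simp add: sum_distrib_left)
    finally show ?thesis using E(1)[OF that] by simp
  qed
  show hphi: "h (\<phi> i) (\<phi> l) = (if i = l then 1 else 0)" if "i \<in> {1..?s}" "l \<in> {1..?s}" for i l
  proof -
    have il: "i \<in> {1..M}" "l \<in> {1..M}" "0 < lam i" using that E(5) by auto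
    have "h (\<phi> i) (\<phi> l) = 1 / (sqrt (lam i) * sqrt (real M)) * (1 / (sqrt (lam l) * sqrt (real M)) * h (y i) (y l))"
      unfolding phi_y using sub[OF yX] by (simp only: W.rscale_left W.rscale_right W.rscale)
    then show ?thesis unfolding hy[OF il(1,2)] using il(3) M0 by (auto simp: field_simps)
  qed
  have "pod_rom V X m a M ?s r v lam (\<lambda>i. vec_index (z i)) \<phi>"
  proof unfold_locales
    show "v j \<in> X" if "j < M" for j by (rule vX[OF that])
    show "(\<Sum>i=1..M. vec_index (z i) j * vec_index (z i) k) = (if j = k then 1 else 0)"
      if "j < M" "k < M" for j k by (rule E(2)[OF that])
    show "r \<le> ?s" "?s \<le> M" using r E(6) by auto
    show "0 < lam i" if "i \<in> {1..?s}" for i using E(5) that by auto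
    show "\<phi> i = (\<lambda>x. (\<Sum>j<M. vec_index (z i) j * v j x) / (sqrt (lam i) * sqrt (real M)))" for i by (rule phi)
    show "a (\<lambda>x. \<Sum>j<M. vec_index (z i) j * v j x) (\<lambda>x. \<Sum>j<M. vec_index (z i) j * v j x) = 0"
      if "i \<in> {?s + 1..M}" for i
    proof -
      have i: "i \<in> {1..M}" "\<not> 0 < lam i" using that E(5)[of i] by auto
      then have "lam i = 0" using E(4)[of i] by simp
      then show ?thesis using hy[OF i(1) i(1)] nl[OF yX, of i] by (simp add: y_def)
    qed
    show "p = (\<lambda>x. 0)" if p: "p \<in> pod_space \<phi> r" and 0: "a p p = 0" for p
    proof -
      obtain c where c: "p = (\<lambda>x. \<Sum>i=1..r. c i * \<phi> i x)" using p by (auto simp: pod_space_def)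
      have pX: "p \<in> X" unfolding c using phiX by (intro a.rsum_mem)
      \<comment> \<open>The coefficients are recovered through orthonormality for h. As p is null
        for h, each of them is zero, so p vanishes at every point.\<close>
      have "c l = 0" if l: "l \<in> {1..r}" for l
      proof -
        have "h p (\<phi> l) = (\<Sum>i=1..r. c i * h (\<phi> i) (\<phi> l))"
          unfolding c using phiX sub by (intro W.rsum_left) auto
        also have "\<dots> = (\<Sum>i=1..r. if i = l then c i else 0)"
          using r l by (intro sum.cong refl) (auto simp: hphi)
        also have "\<dots> = c l" using l by simp
        finally have "c l = h p (\<phi> l)" by simp
        also have "\<dots> = h (\<phi> l) p" by (rule W.sym[OF sub[OF pX] sub[OF phiX]])
        also have "\<dots> = 0" using nl[OF pX] 0 by (intro W.null_right[OF sub[OF phiX] sub[OF pX]]) simp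
        finally show ?thesis .
      qed
      then show ?thesis unfolding c by simp
    qed
  qed
  then show "pod_rom V X m a (2 * N + 1) ?s r v lam (\<lambda>i. vec_index (z i)) \<phi>" by (simp add: M_def)
qed

section \<open>Square integrable functions\<close>

lemma L2_measurable: "v \<in> L2 \<Omega> \<Longrightarrow> v \<in> borel_measurable (lebesgue_on \<Omega>)"
  and L2_integrable_norm: "v \<in> L2 \<Omega> \<Longrightarrow> integrable (lebesgue_on \<Omega>) (\<lambda>x. (norm (v x))\<^sup>2)"
  by (auto simp: L2_def)

lemma L2_bound:
  assumes "integrable (lebesgue_on \<Omega>) w" "v \<in> borel_measurable (lebesgue_on \<Omega>)"
    "\<And>x. x \<in> \<Omega> \<Longrightarrow> (norm (v x))\<^sup>2 \<le> w x"
  shows "v \<in> L2 \<Omega>"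
proof -
  have "integrable (lebesgue_on \<Omega>) (\<lambda>x. (norm (v x))\<^sup>2)"
  proof (rule Bochner_Integration.integrable_bound[OF assms(1)])
    show "AE x in lebesgue_on \<Omega>. norm ((norm (v x))\<^sup>2) \<le> norm (w x)"
      using assms(3) by (intro AE_I2) (fastforce simp: space_restrict_space intro: order_trans[OF _ abs_ge_self])
  qed (use assms(2) in measurable)
  then show ?thesis using assms by (simp add: L2_def)
qed

lemma L2_add: "f \<in> L2 \<Omega> \<Longrightarrow> g \<in> L2 \<Omega> \<Longrightarrow> (\<lambda>x. f x + g x) \<in> L2 \<Omega>"
proof (rule L2_bound)
  assume fg: "f \<in> L2 \<Omega>" "g \<in> L2 \<Omega>"
  show "integrable (lebesgue_on \<Omega>) (\<lambda>x. 2 * (norm (f x))\<^sup>2 + 2 * (norm (g x))\<^sup>2)"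
    using fg by (intro Bochner_Integration.integrable_add Bochner_Integration.integrable_mult_right L2_integrable_norm)
  show "(\<lambda>x. f x + g x) \<in> borel_measurable (lebesgue_on \<Omega>)"
    using fg by (intro borel_measurable_add L2_measurable)
  show "(norm (f x + g x))\<^sup>2 \<le> 2 * (norm (f x))\<^sup>2 + 2 * (norm (g x))\<^sup>2" for x
  proof -
    have "(norm (f x + g x))\<^sup>2 \<le> (norm (f x) + norm (g x))\<^sup>2"
      by (intro power_mono norm_triangle_ineq) simp
    then show ?thesis using sum_squares_bound[of "norm (f x)" "norm (g x)"] by (simp add: power2_sum)
  qed
qed

lemma L2_scale: "f \<in> L2 \<Omega> \<Longrightarrow> (\<lambda>x. c *\<^sub>R f x) \<in> L2 \<Omega>"
proof (rule L2_bound)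
  assume f: "f \<in> L2 \<Omega>"
  show "integrable (lebesgue_on \<Omega>) (\<lambda>x. c\<^sup>2 * (norm (f x))\<^sup>2)"
    using f by (intro Bochner_Integration.integrable_mult_right L2_integrable_norm)
  show "(\<lambda>x. c *\<^sub>R f x) \<in> borel_measurable (lebesgue_on \<Omega>)"
    using L2_measurable[OF f] by simp
qed (simp add: power_mult_distrib)

lemma L2_integrable_inner:
  assumes "f \<in> L2 \<Omega>" "g \<in> L2 \<Omega>"
  shows "integrable (lebesgue_on \<Omega>) (\<lambda>x. inner (f x) (g x))"
proof (rule Bochner_Integration.integrable_bound)
  show "integrable (lebesgue_on \<Omega>) (\<lambda>x. (norm (f x))\<^sup>2 + (norm (g x))\<^sup>2)"
    using assms by (intro Bochner_Integration.integrable_add L2_integrable_norm)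
  show "(\<lambda>x. inner (f x) (g x)) \<in> borel_measurable (lebesgue_on \<Omega>)"
    using assms by (intro borel_measurable_inner L2_measurable)
  show "AE x in lebesgue_on \<Omega>. norm (inner (f x) (g x)) \<le> norm ((norm (f x))\<^sup>2 + (norm (g x))\<^sup>2)"
  proof (rule AE_I2)
    fix x
    have "\<bar>inner (f x) (g x)\<bar> \<le> norm (f x) * norm (g x)" by (rule Cauchy_Schwarz_ineq2)
    also have "\<dots> \<le> (norm (f x))\<^sup>2 + (norm (g x))\<^sup>2"
    proof -
      have "0 \<le> norm (f x) * norm (g x)" by simp
      then show ?thesis using sum_squares_bound[of "norm (f x)" "norm (g x)"] by linarith
    qed
    finally show "norm (inner (f x) (g x)) \<le> norm ((norm (f x))\<^sup>2 + (norm (g x))\<^sup>2)" by simp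
  qed
qed

lemma L2_integrable_mult:
  fixes f g :: "'a::euclidean_space \<Rightarrow> real"
  assumes "f \<in> L2 \<Omega>" "g \<in> L2 \<Omega>"
  shows "integrable (lebesgue_on \<Omega>) (\<lambda>x. f x * g x)"
  using L2_integrable_inner[OF assms] by simp

lemma L2_semi_inner: "semi_inner (L2 \<Omega>) (l2_inner \<Omega>)"
proof
  show "(\<lambda>x. 0) \<in> L2 \<Omega>" by (auto simp: L2_def)
  show "l2_inner \<Omega> f g = l2_inner \<Omega> g f" for f g :: "'a \<Rightarrow> 'b"
    by (simp add: l2_inner_def inner_commute)
  show "l2_inner \<Omega> (\<lambda>x. f x + g x) h = l2_inner \<Omega> f h + l2_inner \<Omega> g h"
    if "f \<in> L2 \<Omega>" "g \<in> L2 \<Omega>" "h \<in> L2 \<Omega>" for f g h :: "'a \<Rightarrow> 'b"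
    unfolding l2_inner_def inner_add_left using that
    by (intro Bochner_Integration.integral_add L2_integrable_inner)
  show "l2_inner \<Omega> (\<lambda>x. c *\<^sub>R f x) h = c * l2_inner \<Omega> f h" for f h :: "'a \<Rightarrow> 'b" and c
    by (simp add: l2_inner_def)
  show "0 \<le> l2_inner \<Omega> f f" for f :: "'a \<Rightarrow> 'b"
    by (simp add: l2_inner_def)
qed (rule L2_add L2_scale; assumption)+

global_interpretation L2: semi_inner "L2 \<Omega>" "l2_inner \<Omega>" for \<Omega>
  by (rule L2_semi_inner)

lemma L2_real_semi_inner: "real_semi_inner (L2 \<Omega>) (l2_inner \<Omega>)"
  by (simp add: real_semi_inner_def L2_semi_inner)

lemma l2_norm_eq: "l2_norm \<Omega> = L2.nrm \<Omega>"
  by (auto simp: l2_norm_def L2.nrm_def)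

lemma l2_norm_squared: "(l2_norm \<Omega> v)\<^sup>2 = l2_inner \<Omega> v v"
  by (simp add: l2_norm_def l2_inner_def)

lemma l2_inner_self: "l2_inner \<Omega> v v = (LINT x|lebesgue_on \<Omega>. (norm (v x))\<^sup>2)"
  by (simp add: l2_inner_def power2_norm_eq_inner)

lemma l2_inner_eq_0_iff:
  assumes "v \<in> L2 \<Omega>"
  shows "l2_inner \<Omega> v v = 0 \<longleftrightarrow> (AE x in lebesgue_on \<Omega>. v x = 0)"
  unfolding l2_inner_self
  by (subst integral_nonneg_eq_0_iff_AE[OF L2_integrable_norm[OF assms]]) auto

lemma l2_inner_cong_AE:
  assumes "f \<in> L2 \<Omega>" "f' \<in> L2 \<Omega>" "g \<in> L2 \<Omega>" "g' \<in> L2 \<Omega>"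
    and "AE x in lebesgue_on \<Omega>. f x = f' x" "AE x in lebesgue_on \<Omega>. g x = g' x"
  shows "l2_inner \<Omega> f g = l2_inner \<Omega> f' g'"
  unfolding l2_inner_def
proof (rule integral_cong_AE)
  show "AE x in lebesgue_on \<Omega>. inner (f x) (g x) = inner (f' x) (g' x)"
    using assms(5,6) by eventually_elim simp
qed (rule borel_measurable_inner[OF L2_measurable[OF assms(1)] L2_measurable[OF assms(3)]]
      borel_measurable_inner[OF L2_measurable[OF assms(2)] L2_measurable[OF assms(4)]])+

lemma open_in_lebesgue: "open S \<Longrightarrow> S \<in> sets lebesgue"
  by (simp add: sets_completionI_sets)

lemma borel_measurable_lebesgue_on_continuous:
  fixes f :: "'a::euclidean_space \<Rightarrow> 'b::euclidean_space"
  assumes "continuous_on UNIV f"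
  shows "f \<in> borel_measurable (lebesgue_on \<Omega>)"
proof (rule measurable_restrict_space1)
  have "f \<in> borel_measurable lborel" using borel_measurable_continuous_onI[OF assms] by simp
  then show "f \<in> borel_measurable lebesgue" by (rule measurable_completion)
qed

lemma indicator_measurable_lebesgue_on:
  "A \<in> sets borel \<Longrightarrow> indicat_real A \<in> borel_measurable (lebesgue_on \<Omega>)"
  by (intro measurable_restrict_space1 borel_measurable_indicator) (simp add: sets_completionI_sets)

lemma integrable_indicator_mult_lebesgue_on:
  fixes h :: "'a::euclidean_space \<Rightarrow> real"
  assumes "A \<in> sets borel" "integrable (lebesgue_on \<Omega>) h"
  shows "integrable (lebesgue_on \<Omega>) (\<lambda>t. indicator A t * h t)"
proof (rule Bochner_Integration.integrable_bound[OF assms(2)])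
  show "(\<lambda>x. indicator A x * h x) \<in> borel_measurable (lebesgue_on \<Omega>)"
    using assms by (intro borel_measurable_times indicator_measurable_lebesgue_on) auto
qed (auto intro!: AE_I2 simp: indicator_def)

lemma L2_of_bounded:
  fixes f :: "'a::euclidean_space \<Rightarrow> 'b::euclidean_space"
  assumes "bounded \<Omega>" "\<Omega> \<in> sets lebesgue" "f \<in> borel_measurable (lebesgue_on \<Omega>)"
    and "\<And>x. x \<in> \<Omega> \<Longrightarrow> norm (f x) \<le> c"
  shows "f \<in> L2 \<Omega>"
proof (rule L2_bound[OF _ assms(3)])
  have "\<Omega> \<in> lmeasurable" using assms(1,2) by (rule bounded_set_imp_lmeasurable)
  then interpret finite_measure "lebesgue_on \<Omega>" by (rule finite_measure_lebesgue_on)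
  show "integrable (lebesgue_on \<Omega>) (\<lambda>_. c\<^sup>2)" by simp
  show "(norm (f x))\<^sup>2 \<le> c\<^sup>2" if "x \<in> \<Omega>" for x using assms(4)[OF that] by (intro power_mono) auto
qed

text \<open>The fundamental lemma of the calculus of variations. Test functions exhausting an open
  set show that the integral of h over it vanishes; decreasing intersections and null sets extend
  this to all measurable sets.\<close>

lemma AE_eq_0_of_test_functions:
  fixes h :: "'a::euclidean_space \<Rightarrow> real"
  assumes "open \<Omega>" and h: "integrable (lebesgue_on \<Omega>) h"
    and test: "\<And>\<psi>. \<psi> \<in> test_functions \<Omega> \<Longrightarrow> (LINT x|lebesgue_on \<Omega>. h x * \<psi> x) = 0"
  shows "AE x in lebesgue_on \<Omega>. h x = 0"
proof -
  define H where "H = (\<lambda>x. indicator \<Omega> x * h x)"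
  have \<Omega>: "\<Omega> \<in> sets lebesgue" by (rule open_in_lebesgue[OF assms(1)])
  have H: "integrable lebesgue H" using h \<Omega> by (simp add: H_def integrable_restrict_space)
  have Hm[measurable]: "H \<in> borel_measurable lebesgue" using H by auto
  have dom: "AE x in lebesgue. norm (w x * H x) \<le> \<bar>H x\<bar>" if "\<And>x. \<bar>w x\<bar> \<le> 1" for w
    using that by (intro AE_I2) (simp add: abs_mult mult_left_le_one_le)
  have op: "(LINT x|lebesgue. indicator W x * H x) = 0" if "open W" for W
  proof -
    have "open (W \<inter> \<Omega>)" using that assms(1) by auto
    from test_functions_approx_indicator[OF this] obtain \<psi> where
      \<psi>: "\<And>n. \<psi> n \<in> test_functions (W \<inter> \<Omega>)" "\<And>n x. 0 \<le> \<psi> n x" "\<And>n x. \<psi> n x \<le> 1"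
      "\<And>x. (\<lambda>n. \<psi> n x) \<longlonglongrightarrow> indicator (W \<inter> \<Omega>) x" by blast
    have zero: "(LINT x|lebesgue. \<psi> n x * H x) = 0" for n
    proof -
      have "\<psi> n \<in> test_functions \<Omega>" using \<psi>(1)[of n] by (auto simp: test_functions_def)
      from test[OF this] show ?thesis
        using \<Omega> by (simp add: integral_restrict_space H_def mult_ac)
    qed
    have "(\<lambda>n. LINT x|lebesgue. \<psi> n x * H x) \<longlonglongrightarrow> (LINT x|lebesgue. indicator (W \<inter> \<Omega>) x * H x)"
    proof (rule integral_dominated_convergence[where w = "\<lambda>x. \<bar>H x\<bar>"])
      show "(\<lambda>x. indicator (W \<inter> \<Omega>) x * H x) \<in> borel_measurable lebesgue"
        using open_in_lebesgue[OF \<open>open (W \<inter> \<Omega>)\<close>] by measurable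
      show "(\<lambda>x. \<psi> n x * H x) \<in> borel_measurable lebesgue" for n
      proof -
        have "Ck 0 (\<psi> n)" using \<psi>(1)[of n] unfolding test_functions_def by blast
        then have "\<psi> n \<in> borel_measurable (lebesgue_on UNIV)"
          by (intro borel_measurable_lebesgue_on_continuous) simp
        then show ?thesis by (simp add: restrict_UNIV)
      qed
      show "AE x in lebesgue. (\<lambda>n. \<psi> n x * H x) \<longlonglongrightarrow> indicator (W \<inter> \<Omega>) x * H x"
        using \<psi>(4) by (intro AE_I2 tendsto_mult) auto
      show "AE x in lebesgue. norm (\<psi> n x * H x) \<le> \<bar>H x\<bar>" for n
        using \<psi>(2,3) by (intro dom) simp
    qed (use H in simp)
    then have "(LINT x|lebesgue. indicator (W \<inter> \<Omega>) x * H x) = 0"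
      by (simp add: zero LIMSEQ_const_iff)
    moreover have "(\<lambda>x. indicator (W \<inter> \<Omega>) x * H x) = (\<lambda>x. indicator W x * H x)"
      by (auto simp: H_def indicator_def)
    ultimately show ?thesis by simp
  qed
  have "AE x in lebesgue. H x = 0"
  proof (rule density_unique_real[OF H])
    show "integrable lebesgue (\<lambda>x::'a. 0::real)" by simp
    fix A :: "'a set" assume A: "A \<in> sets lebesgue"
    obtain C N where C: "gdelta C" "N \<in> null_sets lebesgue" "A \<union> N = C" "disjnt A N"
      by (rule lebesgue_set_almost_gdelta[OF A])
    obtain F :: "nat \<Rightarrow> 'a set" where F: "\<And>n. open (F n)" "C = (\<Inter>n. F n)"
      using C(1) by (auto elim: gdelta.cases)
    \<comment> \<open>The G-delta set C is written as a decreasing limit of open sets, so that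
      dominated convergence applies.\<close>
    define G where "G n = (\<Inter>k\<le>n. F k)" for n
    have G: "open (G n)" for n unfolding G_def using F by (intro open_INT) auto
    have GC: "(\<Inter>n. G n) = C" unfolding G_def F(2) by auto
    have dec: "decseq G" unfolding G_def decseq_def by auto
    have "(\<lambda>n. LINT x|lebesgue. indicator (G n) x * H x) \<longlonglongrightarrow> (LINT x|lebesgue. indicator C x * H x)"
    proof (rule integral_dominated_convergence[where w = "\<lambda>x. \<bar>H x\<bar>"])
      have "C \<in> sets lebesgue" using A C(2,3) by (metis null_setsD2 sets.Un)
      then show "(\<lambda>x. indicator C x * H x) \<in> borel_measurable lebesgue" by measurable
      show "(\<lambda>x. indicator (G n) x * H x) \<in> borel_measurable lebesgue" for n
        using open_in_lebesgue[OF G] by measurable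
      show "AE x in lebesgue. (\<lambda>n. indicator (G n) x * H x) \<longlonglongrightarrow> indicator C x * H x"
        unfolding GC[symmetric] using LIMSEQ_indicator_decseq[OF dec] by (intro AE_I2 tendsto_mult) auto
      show "AE x in lebesgue. norm (indicator (G n) x * H x) \<le> \<bar>H x\<bar>" for n
        by (intro dom) (simp add: indicator_def)
    qed (use H in simp)
    then have z: "(LINT x|lebesgue. indicator C x * H x) = 0" by (simp add: op[OF G] LIMSEQ_const_iff)
    have "AE x in lebesgue. x \<notin> N" using C(2) by (rule AE_not_in)
    then have "AE x in lebesgue. indicator A x * H x = indicator C x * H x"
      by eventually_elim (use C(3) in \<open>auto simp: indicator_def\<close>)
    then have "(LINT x|lebesgue. indicator A x * H x) = (LINT x|lebesgue. indicator C x * H x)"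
      by (intro integral_cong_AE) (use A C in \<open>auto intro!: borel_measurable_times borel_measurable_indicator\<close>)
    then show "(LINT x:A|lebesgue. H x) = (LINT x:A|lebesgue. 0)" using z by (simp add: set_lebesgue_integral_def)
  qed
  then have "AE x in lebesgue. x \<in> \<Omega> \<longrightarrow> h x = 0" by eventually_elim (auto simp: H_def)
  then show ?thesis using \<Omega> by (simp add: AE_restrict_space_iff)
qed

section \<open>Test functions and the Poincare inequality\<close>

lemma test_functions_Ck: "\<psi> \<in> test_functions \<Omega> \<Longrightarrow> Ck k \<psi>"
  unfolding test_functions_def by blast

lemma test_functionsE:
  assumes "\<psi> \<in> test_functions \<Omega>"
  obtains K where "compact K" "K \<subseteq> \<Omega>" "\<And>x. x \<notin> K \<Longrightarrow> \<psi> x = 0"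
    "\<And>x b. x \<notin> K \<Longrightarrow> pderiv_dir b \<psi> x = 0"
proof (rule that[of "closure {x. \<psi> x \<noteq> 0}"])
  let ?K = "closure {x. \<psi> x \<noteq> 0}"
  show "compact ?K" "?K \<subseteq> \<Omega>" using assms by (auto simp: test_functions_def)
  show z: "\<psi> x = 0" if "x \<notin> ?K" for x using that closure_subset[of "{x. \<psi> x \<noteq> 0}"] by auto
  show "pderiv_dir b \<psi> x = 0" if "x \<notin> ?K" for x b
  proof (rule pderiv_dirI[of _ "\<lambda>_. 0"])
    show "(\<psi> has_derivative (\<lambda>_. 0)) (at x)"
    proof (rule has_derivative_transform_within_open)
      show "((\<lambda>_. 0) has_derivative (\<lambda>_. 0)) (at x)" by simp
      show "open (- ?K)" by (simp add: open_Compl)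
      show "x \<in> - ?K" using that by simp
      show "0 = \<psi> y" if "y \<in> - ?K" for y using z[of y] that by simp
    qed
  qed
qed

lemma pderiv_dir_continuous:
  assumes "\<And>k. Ck k \<psi>" "b \<in> Basis" shows "continuous_on UNIV (pderiv_dir b \<psi>)"
  using assms(1)[of "Suc 0"] assms(2) by simp

lemma test_functions_lin:
  assumes "\<psi> \<in> test_functions \<Omega>" "\<theta> \<in> test_functions \<Omega>"
  shows "(\<lambda>x. c * \<psi> x + d * \<theta> x) \<in> test_functions \<Omega>"
proof -
  obtain K K' where "compact K" "K \<subseteq> \<Omega>" "\<And>x. x \<notin> K \<Longrightarrow> \<psi> x = 0"
    "compact K'" "K' \<subseteq> \<Omega>" "\<And>x. x \<notin> K' \<Longrightarrow> \<theta> x = 0"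
    using assms by (meson test_functionsE)
  then show ?thesis
    by (intro test_functionsI[of _ "K \<union> K'"] Ck_add Ck_cmult test_functions_Ck[OF assms(1)]
        test_functions_Ck[OF assms(2)]) auto
qed

lemma pderiv_dir_lin:
  assumes "Ck (Suc 0) \<psi>" "Ck (Suc 0) \<theta>"
  shows "pderiv_dir b (\<lambda>x. c * \<psi> x + d * \<theta> x) x = c * pderiv_dir b \<psi> x + d * pderiv_dir b \<theta> x"
  unfolding pderiv_dir_def[of b \<psi>] pderiv_dir_def[of b \<theta>]
  by (rule pderiv_dirI)
    (intro has_derivative_add has_derivative_mult_right Ck_Suc_has_derivative[OF assms(1)] Ck_Suc_has_derivative[OF assms(2)])

lemma grad_lin:
  assumes "\<psi> \<in> test_functions \<Omega>" "\<theta> \<in> test_functions \<Omega>"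
  shows "grad (\<lambda>x. c * \<psi> x + d * \<theta> x) x = c *\<^sub>R grad \<psi> x + d *\<^sub>R grad \<theta> x"
  by (simp add: grad_def pderiv_dir_lin[OF test_functions_Ck[OF assms(1)] test_functions_Ck[OF assms(2)]]
      scaleR_add_left sum.distrib scaleR_sum_right)

lemma grad_continuous: "\<psi> \<in> test_functions \<Omega> \<Longrightarrow> continuous_on UNIV (grad \<psi>)"
  unfolding grad_def[abs_def]
  by (intro continuous_on_sum continuous_on_scaleR continuous_on_const pderiv_dir_continuous)
    (auto intro: test_functions_Ck)

lemma compact_support_bounded:
  fixes f :: "'a::euclidean_space \<Rightarrow> 'b::euclidean_space"
  assumes "continuous_on UNIV f" "compact K" "\<And>x. x \<notin> K \<Longrightarrow> f x = 0"
  obtains B where "0 \<le> B" "\<And>x. norm (f x) \<le> B"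
proof -
  have "compact (f ` K)" using assms by (intro compact_continuous_image) (auto intro: continuous_on_subset)
  then obtain B where "\<And>y. y \<in> f ` K \<Longrightarrow> norm y \<le> B" by (metis compact_imp_bounded bounded_iff)
  then have "norm (f x) \<le> max B 0" for x using assms(3)[of x] by (cases "x \<in> K") (auto simp: le_max_iff_disj)
  then show ?thesis by (intro that[of "max B 0"]) auto
qed

lemma
  assumes "\<psi> \<in> test_functions \<Omega>" "bounded \<Omega>" "open \<Omega>"
  shows test_functions_L2: "\<psi> \<in> L2 \<Omega>"
    and pderiv_dir_L2: "b \<in> Basis \<Longrightarrow> pderiv_dir b \<psi> \<in> L2 \<Omega>"
    and grad_L2: "grad \<psi> \<in> L2 \<Omega>"
proof -
  obtain K where K: "compact K" "\<And>x. x \<notin> K \<Longrightarrow> \<psi> x = 0" "\<And>x b. x \<notin> K \<Longrightarrow> pderiv_dir b \<psi> x = 0"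
    using assms(1) by (meson test_functionsE)
  have main: "f \<in> L2 \<Omega>" if f: "continuous_on UNIV f" "\<And>x. x \<notin> K \<Longrightarrow> f x = 0"
    for f :: "'a \<Rightarrow> 'c::euclidean_space"
  proof -
    obtain B where "\<And>x. norm (f x) \<le> B" using compact_support_bounded[OF f(1) K(1) f(2)] by blast
    then show ?thesis
      by (intro L2_of_bounded assms(2) open_in_lebesgue[OF assms(3)] borel_measurable_lebesgue_on_continuous f(1))
  qed
  show "\<psi> \<in> L2 \<Omega>" using test_functions_Ck[OF assms(1), of 0] K by (intro main) auto
  show "pderiv_dir b \<psi> \<in> L2 \<Omega>" if "b \<in> Basis"
    using pderiv_dir_continuous[OF test_functions_Ck[OF assms(1)] that] K by (intro main) auto
  show "grad \<psi> \<in> L2 \<Omega>" 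
    using grad_continuous[OF assms(1)] K by (intro main) (auto simp: grad_def)
qed

text \<open>The limit of the integrals of the difference quotients of \<open>g\<close>, which vanish by translation
  invariance.\<close>

lemma integral_pderiv_dir_eq_0:
  fixes g :: "'a::euclidean_space \<Rightarrow> real"
  assumes g: "Ck (Suc 0) g" and K: "compact K" "\<And>x. x \<notin> K \<Longrightarrow> g x = 0"
    "\<And>x. x \<notin> K \<Longrightarrow> pderiv_dir b g x = 0" and b: "b \<in> Basis"
  shows "(LINT x|lborel. pderiv_dir b g x) = 0"
proof -
  have cont: "continuous_on UNIV g" "continuous_on UNIV (pderiv_dir b g)"
    using g Ck_Suc_imp[OF g] b by auto
  obtain B where B: "0 \<le> B" "\<And>x. norm (pderiv_dir b g x) \<le> B"
    using compact_support_bounded[OF cont(2) K(1,3)] by blast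
  obtain A where A: "0 \<le> A" "\<And>x. norm (g x) \<le> A"
    using compact_support_bounded[OF cont(1) K(1,2)] by blast
  obtain R where R: "\<And>x. x \<in> K \<Longrightarrow> norm x \<le> R" using K(1) compact_imp_bounded bounded_iff by metis
  have der: "((\<lambda>t. g (x + t *\<^sub>R b)) has_real_derivative pderiv_dir b g (x + t *\<^sub>R b)) (at t)" for x t
  proof -
    have "((\<lambda>t. x + t *\<^sub>R b) has_derivative (\<lambda>h. h *\<^sub>R b)) (at t)" by (auto intro!: derivative_eq_intros)
    from has_derivative_compose[OF this Ck_Suc_has_derivative[OF g]]
    have "((\<lambda>t. g (x + t *\<^sub>R b)) has_derivative (\<lambda>h. frechet_derivative g (at (x + t *\<^sub>R b)) (h *\<^sub>R b))) (at t)" .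
    moreover have "frechet_derivative g (at y) (h *\<^sub>R b) = pderiv_dir b g y * h" for y h
      using linear_scale[OF linear_frechet_derivative, of g "at y" h b] g by (simp add: pderiv_dir_def)
    ultimately show ?thesis by (simp add: has_field_derivative_def)
  qed
  define q where "q n x = (g (x + (1 / real (Suc n)) *\<^sub>R b) - g x) * real (Suc n)" for n x
  have bor: "g \<in> borel_measurable borel" "pderiv_dir b g \<in> borel_measurable borel"
    using cont by (auto intro: borel_measurable_continuous_onI)
  have shift: "(\<lambda>x. g (x + c)) \<in> borel_measurable borel" for c
    by (rule measurable_compose[OF _ bor(1)]) simp
  have int_ind: "integrable lborel (\<lambda>x::'a. C * indicator (cball 0 r) x :: real)" for C :: real and r
    by (intro Bochner_Integration.integrable_mult_right integrable_real_indicator)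
      (use emeasure_bounded_finite[OF bounded_cball, of "0::'a" r] in auto)
  have gint: "integrable lborel g"
    by (rule Bochner_Integration.integrable_bound[OF int_ind[of A R]])
      (use bor A K(2) R in \<open>auto simp: indicator_def split: if_splits\<close>)
  have z: "(LINT x|lborel. q n x) = 0" for n
  proof -
    let ?c = "(1 / real (Suc n)) *\<^sub>R b"
    have d: "distr lborel borel (\<lambda>x. x + ?c) = lborel"
    proof -
      have "(\<lambda>x. x + ?c) = (+) ?c" by (auto simp: fun_eq_iff add.commute)
      then show ?thesis using lborel_distr_plus[of ?c] by simp
    qed
    have "integrable (distr lborel borel (\<lambda>x. x + ?c)) g" unfolding d by (rule gint)
    then have i: "integrable lborel (\<lambda>x. g (x + ?c))" by (subst (asm) integrable_distr_eq) (use bor in auto)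
    have "(LINT x|lborel. g x) = (LINT x|distr lborel borel (\<lambda>x. x + ?c). g x)" by (simp only: d)
    also have "\<dots> = (LINT x|lborel. g (x + ?c))" by (rule integral_distr) (use bor in auto)
    finally show ?thesis using i gint unfolding q_def by simp
  qed
  have "(\<lambda>n. LINT x|lborel. q n x) \<longlonglongrightarrow> (LINT x|lborel. pderiv_dir b g x)"
  proof (rule integral_dominated_convergence[where w = "\<lambda>x. B * indicator (cball 0 (R + 1)) x"])
    show "pderiv_dir b g \<in> borel_measurable lborel" using bor by simp
    show "q n \<in> borel_measurable lborel" for n unfolding q_def[abs_def] using bor shift by measurable
    show "integrable lborel (\<lambda>x::'a. B * indicator (cball 0 (R + 1)) x)" by (rule int_ind)
    show "AE x in lborel. (\<lambda>n. q n x) \<longlonglongrightarrow> pderiv_dir b g x"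
    proof (rule AE_I2)
      fix x :: 'a
      have "((\<lambda>h. (g (x + h *\<^sub>R b) - g x) / h) \<longlongrightarrow> pderiv_dir b g x) (at 0)"
        using der[of x 0] by (simp add: DERIV_def)
      moreover have "filterlim (\<lambda>n. 1 / real (Suc n)) (at 0) sequentially"
        by real_asymp
      ultimately have "(\<lambda>n. (g (x + (1 / real (Suc n)) *\<^sub>R b) - g x) / (1 / real (Suc n))) \<longlonglongrightarrow> pderiv_dir b g x"
        by (rule filterlim_compose)
      then show "(\<lambda>n. q n x) \<longlonglongrightarrow> pderiv_dir b g x" by (simp add: q_def)
    qed
    \<comment> \<open>The steps have length at most 1, so outside the ball of radius R + 1 both
      evaluation points miss K. Inside it the mean value theorem turns the quotient into a value of
      the derivative.\<close>
    show "AE x in lborel. norm (q n x) \<le> B * indicator (cball 0 (R + 1)) x" for n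
    proof (rule AE_I2)
      fix x :: 'a
      let ?t = "1 / real (Suc n)"
      show "norm (q n x) \<le> B * indicator (cball 0 (R + 1)) x"
      proof (cases "x \<in> cball 0 (R + 1)")
        case True
        obtain \<xi> where "0 < \<xi>" "\<xi> < ?t"
          "g (x + ?t *\<^sub>R b) - g (x + 0 *\<^sub>R b) = (?t - 0) * pderiv_dir b g (x + \<xi> *\<^sub>R b)"
          using MVT2[of 0 ?t "\<lambda>t. g (x + t *\<^sub>R b)" "\<lambda>t. pderiv_dir b g (x + t *\<^sub>R b)"] der by auto
        then have "q n x = pderiv_dir b g (x + \<xi> *\<^sub>R b)" by (simp add: q_def)
        then show ?thesis using B(2) True by simp
      next
        case False
        then have nx: "norm x > R + 1" by simp
        have "norm x \<le> norm (x + ?t *\<^sub>R b) + norm (?t *\<^sub>R b)"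
          using norm_triangle_ineq4[of "x + ?t *\<^sub>R b" "?t *\<^sub>R b"] by simp
        moreover have "norm (?t *\<^sub>R b) \<le> 1" using b by simp
        ultimately have "norm (x + ?t *\<^sub>R b) > R" using nx by linarith
        then have "x + ?t *\<^sub>R b \<notin> K" "x \<notin> K" using R nx by force+
        then show ?thesis using K(2) False by (simp add: q_def)
      qed
    qed
  qed
  then show ?thesis by (simp add: z LIMSEQ_const_iff)
qed

lemma integral_lebesgue_on_eq_lborel:
  fixes F :: "'a::euclidean_space \<Rightarrow> real"
  assumes "open \<Omega>" "F \<in> borel_measurable borel" "\<And>x. x \<notin> \<Omega> \<Longrightarrow> F x = 0"
  shows "(LINT x|lebesgue_on \<Omega>. F x) = (LINT x|lborel. F x)"
proof -
  have "(LINT x|lebesgue_on \<Omega>. F x) = (LINT x|lebesgue. indicator \<Omega> x * F x)"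
    using open_in_lebesgue[OF assms(1)] by (simp add: integral_restrict_space)
  also have "(\<lambda>x. indicator \<Omega> x * F x) = F" using assms(3) by (auto simp: fun_eq_iff indicator_def)
  also have "(LINT x|lebesgue. F x) = (LINT x|lborel. F x)"
    using assms(2) by (intro integral_completion) simp
  finally show ?thesis .
qed

text \<open>Integrate the derivative of \<open>x\<^sub>b \<psi>\<^sup>2\<close> in a coordinate direction \<open>b\<close>.\<close>

lemma poincare_test_functions:
  fixes \<Omega> :: "'a::euclidean_space set"
  assumes "open \<Omega>" "\<And>x. x \<in> \<Omega> \<Longrightarrow> norm x \<le> R" "\<psi> \<in> test_functions \<Omega>"
  shows "l2_inner \<Omega> \<psi> \<psi> \<le> 4 * R\<^sup>2 * l2_inner \<Omega> (grad \<psi>) (grad \<psi>)"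
proof -
  have bd: "bounded \<Omega>" using assms(2) bounded_iff by blast
  obtain b :: 'a where b: "b \<in> Basis" using nonempty_Basis by blast
  obtain K where K: "compact K" "K \<subseteq> \<Omega>" "\<And>x. x \<notin> K \<Longrightarrow> \<psi> x = 0" "\<And>x b. x \<notin> K \<Longrightarrow> pderiv_dir b \<psi> x = 0"
    using test_functionsE[OF assms(3)] by blast
  note Ck = test_functions_Ck[OF assms(3)]
  define g where "g = (\<lambda>x. inner x b * (\<psi> x * \<psi> x))"
  have Ckg: "Ck k g" for k unfolding g_def by (intro Ck_mult Ck_inner Ck)
  have pg: "pderiv_dir b g x = \<psi> x * \<psi> x + 2 * inner x b * \<psi> x * pderiv_dir b \<psi> x" for x
  proof -
    have "(g has_derivative (\<lambda>h. inner x b * (\<psi> x * frechet_derivative \<psi> (at x) h + frechet_derivative \<psi> (at x) h * \<psi> x)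
        + inner h b * (\<psi> x * \<psi> x))) (at x)"
      unfolding g_def
      by (intro has_derivative_mult Ck_Suc_has_derivative[OF Ck[of "Suc 0"]] has_derivative_inner_left has_derivative_ident)
    then show ?thesis using b by (simp add: pderiv_dirI pderiv_dir_def[of b \<psi>] algebra_simps)
  qed
  have "(LINT x|lborel. pderiv_dir b g x) = 0"
    by (rule integral_pderiv_dir_eq_0[OF Ckg K(1)]) (use K b pg in \<open>auto simp: g_def\<close>)
  moreover have "(LINT x|lebesgue_on \<Omega>. pderiv_dir b g x) = (LINT x|lborel. pderiv_dir b g x)"
  proof (rule integral_lebesgue_on_eq_lborel[OF assms(1)])
    show "pderiv_dir b g \<in> borel_measurable borel"
      using pderiv_dir_continuous[OF Ckg b] by (rule borel_measurable_continuous_onI)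
    show "pderiv_dir b g x = 0" if "x \<notin> \<Omega>" for x
    proof -
      have "\<psi> x = 0" using K(2,3) that by blast
      then show ?thesis by (simp add: pg)
    qed
  qed
  ultimately have 0: "(LINT x|lebesgue_on \<Omega>. pderiv_dir b g x) = 0" by simp
  have i1: "integrable (lebesgue_on \<Omega>) (\<lambda>x. (norm (\<psi> x))\<^sup>2)"
    by (intro L2_integrable_norm test_functions_L2 assms bd)
  have i2: "integrable (lebesgue_on \<Omega>) (\<lambda>x. (norm (grad \<psi> x))\<^sup>2)"
    by (intro L2_integrable_norm grad_L2 assms bd)
  have gL: "pderiv_dir b g \<in> L2 \<Omega>"
    by (rule pderiv_dir_L2[OF test_functionsI[OF Ckg K(1,2)] bd assms(1) b]) (use K in \<open>auto simp: g_def\<close>)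
  have one: "(\<lambda>x. 1 :: real) \<in> L2 \<Omega>"
    by (rule L2_of_bounded[OF bd open_in_lebesgue[OF assms(1)], of _ 1]) auto
  have i3: "integrable (lebesgue_on \<Omega>) (pderiv_dir b g)" using L2_integrable_mult[OF gL one] by simp
  \<comment> \<open>The square of \<open>\<psi>\<close> is the derivative of g minus a mixed term.
    Young's inequality with weights 1/2 and 2 lets half of the square be absorbed on the left, which
    produces the constant 4 R^2.\<close>
  have pt: "(norm (\<psi> x))\<^sup>2 \<le> pderiv_dir b g x + (1 / 2 * (norm (\<psi> x))\<^sup>2 + 2 * R\<^sup>2 * (norm (grad \<psi> x))\<^sup>2)"
    if x: "x \<in> \<Omega>" for x
  proof -
    have "pderiv_dir b \<psi> x = inner (grad \<psi> x) b"
      using b by (simp add: grad_def inner_sum_left inner_Basis if_distrib cong: if_cong)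
    then have "\<bar>pderiv_dir b \<psi> x\<bar> \<le> norm (grad \<psi> x)" using Basis_le_norm[OF b, of "grad \<psi> x"] by simp
    moreover have "\<bar>inner x b\<bar> \<le> R" using Basis_le_norm[OF b, of x] assms(2)[OF x] by linarith
    ultimately have "\<bar>inner x b\<bar> * \<bar>pderiv_dir b \<psi> x\<bar> \<le> R * norm (grad \<psi> x)" by (intro mult_mono) auto
    then have "(\<bar>inner x b\<bar> * \<bar>pderiv_dir b \<psi> x\<bar>)\<^sup>2 \<le> (R * norm (grad \<psi> x))\<^sup>2"
      by (intro power_mono) auto
    then have "(inner x b * pderiv_dir b \<psi> x)\<^sup>2 \<le> (R * norm (grad \<psi> x))\<^sup>2"
      by (simp add: power_mult_distrib)
    moreover have "- 2 * (\<psi> x * (inner x b * pderiv_dir b \<psi> x)) \<le> 1 / 2 * (\<psi> x)\<^sup>2 + 2 * (inner x b * pderiv_dir b \<psi> x)\<^sup>2"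
      using zero_le_power2[of "\<psi> x + 2 * (inner x b * pderiv_dir b \<psi> x)"]
      by (simp add: power2_sum power_mult_distrib)
    ultimately show ?thesis unfolding pg by (simp add: power_mult_distrib power2_eq_square mult_ac)
  qed
  have "(LINT x|lebesgue_on \<Omega>. (norm (\<psi> x))\<^sup>2)
      \<le> (LINT x|lebesgue_on \<Omega>. pderiv_dir b g x + (1 / 2 * (norm (\<psi> x))\<^sup>2 + 2 * R\<^sup>2 * (norm (grad \<psi> x))\<^sup>2))"
    using pt i1 i2 i3
    by (intro integral_mono Bochner_Integration.integrable_add Bochner_Integration.integrable_mult_right)
      (auto simp: space_restrict_space)
  also have "\<dots> = 1 / 2 * (LINT x|lebesgue_on \<Omega>. (norm (\<psi> x))\<^sup>2) + 2 * R\<^sup>2 * (LINT x|lebesgue_on \<Omega>. (norm (grad \<psi> x))\<^sup>2)"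
    using i1 i2 i3 0 by (simp add: Bochner_Integration.integral_add)
  finally show ?thesis by (simp add: l2_inner_self)
qed

section \<open>The space \<open>H10 \<Omega>\<close>\<close>

lemma L2_component: "g \<in> L2 \<Omega> \<Longrightarrow> b \<in> Basis \<Longrightarrow> (\<lambda>x. inner (g x) b) \<in> L2 \<Omega>"
proof (rule L2_bound)
  assume g: "g \<in> L2 \<Omega>" and b: "b \<in> Basis"
  show "integrable (lebesgue_on \<Omega>) (\<lambda>x. (norm (g x))\<^sup>2)" by (rule L2_integrable_norm[OF g])
  show "(\<lambda>x. inner (g x) b) \<in> borel_measurable (lebesgue_on \<Omega>)"
    using L2_measurable[OF g] by simp
  show "(norm (inner (g x) b))\<^sup>2 \<le> (norm (g x))\<^sup>2" for x
    using Basis_le_norm[OF b, of "g x"] by (intro power_mono) auto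
qed

locale bounded_open_set =
  fixes \<Omega> :: "'a::euclidean_space set"
  assumes open_domain: "open \<Omega>" and bounded_domain: "bounded \<Omega>"
begin

lemmas test_L2 = test_functions_L2[OF _ bounded_domain open_domain]
lemmas test_grad_L2 = grad_L2[OF _ bounded_domain open_domain]
lemmas test_pderiv_L2 = pderiv_dir_L2[OF _ bounded_domain open_domain]

text \<open>The fundamental lemma in each component. The functions v and w may differ on a null set
  so that the case w = 0 is covered: a function that vanishes almost everywhere has a null
  gradient.\<close>

lemma weak_gradient_unique:
  assumes "v \<in> L2 \<Omega>" "w \<in> L2 \<Omega>" "AE x in lebesgue_on \<Omega>. v x = w x"
    and g: "g \<in> L2 \<Omega>" "weak_gradient \<Omega> v g" and g': "g' \<in> L2 \<Omega>" "weak_gradient \<Omega> w g'"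
  shows "AE x in lebesgue_on \<Omega>. g x = g' x"
proof -
  have comp: "AE x in lebesgue_on \<Omega>. inner (g x) b - inner (g' x) b = 0" if b: "b \<in> Basis" for b
  proof (rule AE_eq_0_of_test_functions[OF open_domain])
    have c: "(\<lambda>x. inner (g x) b) \<in> L2 \<Omega>" "(\<lambda>x. inner (g' x) b) \<in> L2 \<Omega>"
      using g g' b by (auto intro: L2_component)
    have one: "(\<lambda>x. 1 :: real) \<in> L2 \<Omega>"
      by (rule L2_of_bounded[OF bounded_domain open_in_lebesgue[OF open_domain], of _ 1]) auto
    show "integrable (lebesgue_on \<Omega>) (\<lambda>x. inner (g x) b - inner (g' x) b)"
      using L2_integrable_mult[OF c(1) one] L2_integrable_mult[OF c(2) one] by simp
    fix \<psi> assume \<psi>: "\<psi> \<in> test_functions \<Omega>"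
    have "(LINT x|lebesgue_on \<Omega>. (inner (g x) b - inner (g' x) b) * \<psi> x)
        = (LINT x|lebesgue_on \<Omega>. inner (g x) b * \<psi> x) - (LINT x|lebesgue_on \<Omega>. inner (g' x) b * \<psi> x)"
      unfolding left_diff_distrib
      by (intro Bochner_Integration.integral_diff L2_integrable_mult c test_L2 \<psi>)
    also have "\<dots> = (LINT x|lebesgue_on \<Omega>. w x * pderiv_dir b \<psi> x) - (LINT x|lebesgue_on \<Omega>. v x * pderiv_dir b \<psi> x)"
      using g(2) g'(2) b \<psi> unfolding weak_gradient_def by simp
    also have "(LINT x|lebesgue_on \<Omega>. w x * pderiv_dir b \<psi> x) = (LINT x|lebesgue_on \<Omega>. v x * pderiv_dir b \<psi> x)"
    proof (rule integral_cong_AE)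
      show "AE x in lebesgue_on \<Omega>. w x * pderiv_dir b \<psi> x = v x * pderiv_dir b \<psi> x"
        using assms(3) by eventually_elim simp
    qed (intro borel_measurable_integrable L2_integrable_mult assms test_pderiv_L2 \<psi> b)+
    finally show "(LINT x|lebesgue_on \<Omega>. (inner (g x) b - inner (g' x) b) * \<psi> x) = 0" by simp
  qed
  have "AE x in lebesgue_on \<Omega>. \<forall>b\<in>Basis. inner (g x) b - inner (g' x) b = 0"
    using comp by (intro AE_finite_allI) auto
  then show ?thesis by eventually_elim (auto intro: euclidean_eqI)
qed

lemma weak_gradient_lin:
  assumes "v \<in> L2 \<Omega>" "g \<in> L2 \<Omega>" "weak_gradient \<Omega> v g" "w \<in> L2 \<Omega>" "g' \<in> L2 \<Omega>" "weak_gradient \<Omega> w g'"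
  shows "weak_gradient \<Omega> (\<lambda>x. c * v x + d * w x) (\<lambda>x. c *\<^sub>R g x + d *\<^sub>R g' x)"
  unfolding weak_gradient_def
proof (intro ballI)
  fix \<psi> and b :: 'a assume \<psi>: "\<psi> \<in> test_functions \<Omega>" and b: "b \<in> Basis"
  have i: "integrable (lebesgue_on \<Omega>) (\<lambda>x. v x * pderiv_dir b \<psi> x)"
    "integrable (lebesgue_on \<Omega>) (\<lambda>x. w x * pderiv_dir b \<psi> x)"
    "integrable (lebesgue_on \<Omega>) (\<lambda>x. inner (g x) b * \<psi> x)"
    "integrable (lebesgue_on \<Omega>) (\<lambda>x. inner (g' x) b * \<psi> x)"
    by (intro L2_integrable_mult L2_component assms test_pderiv_L2 test_L2 \<psi> b)+
  have "(LINT x|lebesgue_on \<Omega>. (c * v x + d * w x) * pderiv_dir b \<psi> x)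
      = c * (LINT x|lebesgue_on \<Omega>. v x * pderiv_dir b \<psi> x) + d * (LINT x|lebesgue_on \<Omega>. w x * pderiv_dir b \<psi> x)"
    using i(1,2) by (simp add: distrib_right mult.assoc Bochner_Integration.integral_add)
  also have "\<dots> = - (c * (LINT x|lebesgue_on \<Omega>. inner (g x) b * \<psi> x) + d * (LINT x|lebesgue_on \<Omega>. inner (g' x) b * \<psi> x))"
    using assms(3,6) \<psi> b unfolding weak_gradient_def by simp
  also have "c * (LINT x|lebesgue_on \<Omega>. inner (g x) b * \<psi> x) + d * (LINT x|lebesgue_on \<Omega>. inner (g' x) b * \<psi> x)
      = (LINT x|lebesgue_on \<Omega>. inner (c *\<^sub>R g x + d *\<^sub>R g' x) b * \<psi> x)"
    using i(3,4) by (simp add: inner_add_left distrib_right mult.assoc Bochner_Integration.integral_add)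
  finally show "(LINT x|lebesgue_on \<Omega>. (c * v x + d * w x) * pderiv_dir b \<psi> x)
      = - (LINT x|lebesgue_on \<Omega>. inner (c *\<^sub>R g x + d *\<^sub>R g' x) b * \<psi> x)" .
qed

lemma L2_lin:
  fixes f g :: "'a \<Rightarrow> 'b::euclidean_space"
  shows "f \<in> L2 \<Omega> \<Longrightarrow> g \<in> L2 \<Omega> \<Longrightarrow> (\<lambda>x. c *\<^sub>R f x + d *\<^sub>R g x) \<in> L2 \<Omega>"
  by (intro L2_add L2_scale)

lemma L2_real_lin:
  fixes f g :: "'a \<Rightarrow> real"
  shows "f \<in> L2 \<Omega> \<Longrightarrow> g \<in> L2 \<Omega> \<Longrightarrow> (\<lambda>x. c * f x + d * g x) \<in> L2 \<Omega>"
  using L2_lin[of f g c d] by simp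

lemma H1_L2: "v \<in> H1 \<Omega> \<Longrightarrow> v \<in> L2 \<Omega>"
  by (simp add: H1_def)

lemma wgrad:
  assumes "v \<in> H1 \<Omega>" shows "wgrad \<Omega> v \<in> L2 \<Omega>" "weak_gradient \<Omega> v (wgrad \<Omega> v)"
proof -
  have "\<exists>g. g \<in> L2 \<Omega> \<and> weak_gradient \<Omega> v g" using assms by (auto simp: H1_def)
  from someI_ex[OF this] show "wgrad \<Omega> v \<in> L2 \<Omega>" "weak_gradient \<Omega> v (wgrad \<Omega> v)"
    unfolding wgrad_def by auto
qed

text \<open>The combination of two chosen gradients is a weak gradient of the combination, but it
  need not be the chosen one; uniqueness gives equality almost everywhere.\<close>

lemma H1_lin:
  assumes "v \<in> H1 \<Omega>" "w \<in> H1 \<Omega>"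
  shows "(\<lambda>x. c * v x + d * w x) \<in> H1 \<Omega>"
    and "AE x in lebesgue_on \<Omega>. wgrad \<Omega> (\<lambda>x. c * v x + d * w x) x = c *\<^sub>R wgrad \<Omega> v x + d *\<^sub>R wgrad \<Omega> w x"
proof -
  note a = assms[THEN H1_L2] and g = wgrad[OF assms(1)] wgrad[OF assms(2)]
  have m: "(\<lambda>x. c * v x + d * w x) \<in> L2 \<Omega>" by (intro L2_real_lin a)
  have gm: "(\<lambda>x. c *\<^sub>R wgrad \<Omega> v x + d *\<^sub>R wgrad \<Omega> w x) \<in> L2 \<Omega>" by (intro L2_lin g)
  note wg = weak_gradient_lin[OF a(1) g(1,2) a(2) g(3,4), of c d]
  show H: "(\<lambda>x. c * v x + d * w x) \<in> H1 \<Omega>" using m gm wg unfolding H1_def by blast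
  show "AE x in lebesgue_on \<Omega>. wgrad \<Omega> (\<lambda>x. c * v x + d * w x) x = c *\<^sub>R wgrad \<Omega> v x + d *\<^sub>R wgrad \<Omega> w x"
    by (rule weak_gradient_unique[OF m m _ wgrad[OF H] gm wg]) simp
qed

text \<open>The limit h is tied to f and g only almost everywhere because it will be the chosen weak
  gradient of a linear combination.\<close>

lemma l2_norm_tendsto_lin:
  fixes f g :: "'a \<Rightarrow> 'b::euclidean_space"
  assumes "\<And>k. F k \<in> L2 \<Omega>" "\<And>k. G k \<in> L2 \<Omega>" "f \<in> L2 \<Omega>" "g \<in> L2 \<Omega>" "h \<in> L2 \<Omega>"
    and "(\<lambda>k. l2_norm \<Omega> (\<lambda>x. F k x - f x)) \<longlonglongrightarrow> 0" "(\<lambda>k. l2_norm \<Omega> (\<lambda>x. G k x - g x)) \<longlonglongrightarrow> 0"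
    and "AE x in lebesgue_on \<Omega>. h x = c *\<^sub>R f x + d *\<^sub>R g x"
  shows "(\<lambda>k. l2_norm \<Omega> (\<lambda>x. (c *\<^sub>R F k x + d *\<^sub>R G k x) - h x)) \<longlonglongrightarrow> 0"
proof (rule tendsto_sandwich[where f = "\<lambda>_. 0"])
  have D: "(\<lambda>x. F k x - f x) \<in> L2 \<Omega>" "(\<lambda>x. G k x - g x) \<in> L2 \<Omega>" for k
    using assms by (auto intro: L2.diff)
  show "(\<lambda>k. \<bar>c\<bar> * l2_norm \<Omega> (\<lambda>x. F k x - f x) + \<bar>d\<bar> * l2_norm \<Omega> (\<lambda>x. G k x - g x)) \<longlonglongrightarrow> 0"
    by (rule tendsto_eq_intros assms refl | simp)+
  have M: "(\<lambda>x. (c *\<^sub>R F k x + d *\<^sub>R G k x) - h x) \<in> L2 \<Omega>" for k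
    by (intro L2.diff L2_lin assms)
  show "\<forall>\<^sub>F k in sequentially. 0 \<le> l2_norm \<Omega> (\<lambda>x. (c *\<^sub>R F k x + d *\<^sub>R G k x) - h x)"
    using M by (simp add: l2_norm_eq L2.nrm_nonneg)
  show "\<forall>\<^sub>F k in sequentially. l2_norm \<Omega> (\<lambda>x. (c *\<^sub>R F k x + d *\<^sub>R G k x) - h x)
      \<le> \<bar>c\<bar> * l2_norm \<Omega> (\<lambda>x. F k x - f x) + \<bar>d\<bar> * l2_norm \<Omega> (\<lambda>x. G k x - g x)"
  proof (rule always_eventually, rule allI)
    fix k
    let ?E = "\<lambda>x. c *\<^sub>R (F k x - f x) + d *\<^sub>R (G k x - g x)"
    have ae: "AE x in lebesgue_on \<Omega>. (c *\<^sub>R F k x + d *\<^sub>R G k x) - h x = ?E x"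
      using assms(8) by eventually_elim (simp add: algebra_simps)
    have E: "?E \<in> L2 \<Omega>" by (intro L2_lin D)
    have "l2_norm \<Omega> (\<lambda>x. (c *\<^sub>R F k x + d *\<^sub>R G k x) - h x) = l2_norm \<Omega> ?E"
      unfolding l2_norm_def l2_inner_cong_AE[OF M E M E ae ae] ..
    also have "\<dots> \<le> l2_norm \<Omega> (\<lambda>x. c *\<^sub>R (F k x - f x)) + l2_norm \<Omega> (\<lambda>x. d *\<^sub>R (G k x - g x))"
      unfolding l2_norm_eq by (intro L2.nrm_triangle L2_scale D)
    also have "\<dots> = \<bar>c\<bar> * l2_norm \<Omega> (\<lambda>x. F k x - f x) + \<bar>d\<bar> * l2_norm \<Omega> (\<lambda>x. G k x - g x)"
      using D by (simp add: l2_norm_eq L2.nrm_scale)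
    finally show "l2_norm \<Omega> (\<lambda>x. (c *\<^sub>R F k x + d *\<^sub>R G k x) - h x)
      \<le> \<bar>c\<bar> * l2_norm \<Omega> (\<lambda>x. F k x - f x) + \<bar>d\<bar> * l2_norm \<Omega> (\<lambda>x. G k x - g x)" .
  qed
qed simp

lemma H10_H1: "v \<in> H10 \<Omega> \<Longrightarrow> v \<in> H1 \<Omega>"
  by (simp add: H10_def)

lemma H10_L2: "v \<in> H10 \<Omega> \<Longrightarrow> v \<in> L2 \<Omega>"
  by (intro H1_L2 H10_H1)

lemma H10_lin:
  assumes "v \<in> H10 \<Omega>" "w \<in> H10 \<Omega>"
  shows "(\<lambda>x. c * v x + d * w x) \<in> H10 \<Omega>"
proof -
  obtain \<psi> where \<psi>: "\<And>k::nat. \<psi> k \<in> test_functions \<Omega>"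
    "(\<lambda>k. l2_norm \<Omega> (\<lambda>x. \<psi> k x - v x)) \<longlonglongrightarrow> 0"
    "(\<lambda>k. l2_norm \<Omega> (\<lambda>x. grad (\<psi> k) x - wgrad \<Omega> v x)) \<longlonglongrightarrow> 0" using assms(1) by (auto simp: H10_def)
  obtain \<theta> where \<theta>: "\<And>k::nat. \<theta> k \<in> test_functions \<Omega>"
    "(\<lambda>k. l2_norm \<Omega> (\<lambda>x. \<theta> k x - w x)) \<longlonglongrightarrow> 0"
    "(\<lambda>k. l2_norm \<Omega> (\<lambda>x. grad (\<theta> k) x - wgrad \<Omega> w x)) \<longlonglongrightarrow> 0" using assms(2) by (auto simp: H10_def)
  note H1 = assms[THEN H10_H1]
  note lin = H1_lin[OF H1, of c d]
  have "(\<lambda>k. l2_norm \<Omega> (\<lambda>x. (c *\<^sub>R \<psi> k x + d *\<^sub>R \<theta> k x) - (c * v x + d * w x))) \<longlonglongrightarrow> 0"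
    by (rule l2_norm_tendsto_lin[OF test_L2[OF \<psi>(1)] test_L2[OF \<theta>(1)] H1_L2[OF H1(1)] H1_L2[OF H1(2)]
          H1_L2[OF lin(1)] \<psi>(2) \<theta>(2)]) simp
  moreover have "(\<lambda>k. l2_norm \<Omega> (\<lambda>x. (c *\<^sub>R grad (\<psi> k) x + d *\<^sub>R grad (\<theta> k) x) - wgrad \<Omega> (\<lambda>x. c * v x + d * w x) x)) \<longlonglongrightarrow> 0"
    by (rule l2_norm_tendsto_lin[OF _ _ _ _ _ \<psi>(3) \<theta>(3) lin(2)])
      (intro test_grad_L2 \<psi> \<theta> wgrad H1 lin)+
  ultimately show ?thesis
    unfolding H10_def mem_Collect_eq
    by (intro conjI lin(1) exI[of _ "\<lambda>k x. c * \<psi> k x + d * \<theta> k x"] allI test_functions_lin \<psi>(1) \<theta>(1))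
      (simp_all add: grad_lin[OF \<psi>(1) \<theta>(1)])
qed

lemma zero_H10: "(\<lambda>x. 0) \<in> H10 \<Omega>"
proof -
  have z: "(\<lambda>x. 0) \<in> L2 \<Omega>" "(\<lambda>x. 0 :: 'a) \<in> L2 \<Omega>" by (rule L2.zero)+
  have wz: "weak_gradient \<Omega> (\<lambda>x. 0) (\<lambda>x. 0)" by (simp add: weak_gradient_def)
  have H1: "(\<lambda>x. 0) \<in> H1 \<Omega>" using z wz unfolding H1_def by blast
  have ae: "AE x in lebesgue_on \<Omega>. wgrad \<Omega> (\<lambda>x. 0) x = 0"
    by (rule weak_gradient_unique[OF z(1) z(1) _ wgrad[OF H1] z(2) wz]) simp
  have test0: "(\<lambda>x. 0) \<in> test_functions \<Omega>"
    by (rule test_functionsI[of _ "{}"]) (auto intro: Ck_const)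
  have g0: "grad (\<lambda>x::'a. 0) x = 0" for x
    using grad_lin[OF test0 test0, of 0 0 x] by simp
  have m: "(\<lambda>x. - wgrad \<Omega> (\<lambda>x. 0) x) \<in> L2 \<Omega>" using L2_scale[OF wgrad(1)[OF H1], of "-1"] by simp
  have "l2_inner \<Omega> (\<lambda>x. - wgrad \<Omega> (\<lambda>x. 0) x) (\<lambda>x. - wgrad \<Omega> (\<lambda>x. 0) x) = 0"
    unfolding l2_inner_eq_0_iff[OF m] using ae by eventually_elim simp
  then have "l2_norm \<Omega> (\<lambda>x. grad (\<lambda>x. 0) x - wgrad \<Omega> (\<lambda>x. 0) x) = 0"
    by (simp add: l2_norm_def g0)
  moreover have "l2_norm \<Omega> (\<lambda>x. 0 - 0 :: real) = 0" by (simp add: l2_norm_def l2_inner_def)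
  ultimately show ?thesis unfolding H10_def using H1 test0
    by (auto intro!: exI[of _ "\<lambda>k x. 0"])
qed

lemma h10_inner_lin_left:
  assumes "f \<in> H10 \<Omega>" "g \<in> H10 \<Omega>" "h \<in> H10 \<Omega>"
  shows "h10_inner \<Omega> (\<lambda>x. c * f x + d * g x) h = c * h10_inner \<Omega> f h + d * h10_inner \<Omega> g h"
proof -
  note H = assms[THEN H10_H1]
  note W = wgrad(1)[OF H(1)] wgrad(1)[OF H(2)] wgrad(1)[OF H(3)] wgrad(1)[OF H1_lin(1)[OF H(1,2), of c d]]
  have "h10_inner \<Omega> (\<lambda>x. c * f x + d * g x) h
      = l2_inner \<Omega> (\<lambda>x. c *\<^sub>R wgrad \<Omega> f x + d *\<^sub>R wgrad \<Omega> g x) (wgrad \<Omega> h)"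
    unfolding h10_inner_def
    by (rule l2_inner_cong_AE[OF W(4) L2_lin[OF W(1,2)] W(3) W(3) H1_lin(2)[OF H(1,2)]]) simp
  then show ?thesis
    using W by (simp add: h10_inner_def L2.add_left L2.scale_left L2_scale)
qed

lemma H10_real_semi_inner: "real_semi_inner (H10 \<Omega>) (h10_inner \<Omega>)"
proof
  show "(\<lambda>x. 0) \<in> H10 \<Omega>" by (rule zero_H10)
  show "(\<lambda>x. f x + g x) \<in> H10 \<Omega>" if "f \<in> H10 \<Omega>" "g \<in> H10 \<Omega>" for f g
    using H10_lin[OF that, of 1 1] by simp
  show "(\<lambda>x. c *\<^sub>R f x) \<in> H10 \<Omega>" if "f \<in> H10 \<Omega>" for f c
    using H10_lin[OF that that, of c 0] by simp
  show "h10_inner \<Omega> f g = h10_inner \<Omega> g f" if "f \<in> H10 \<Omega>" "g \<in> H10 \<Omega>" for f g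
    unfolding h10_inner_def using that by (intro L2.sym wgrad H10_H1)
  show "h10_inner \<Omega> (\<lambda>x. f x + g x) h = h10_inner \<Omega> f h + h10_inner \<Omega> g h"
    if "f \<in> H10 \<Omega>" "g \<in> H10 \<Omega>" "h \<in> H10 \<Omega>" for f g h
    using h10_inner_lin_left[OF that, of 1 1] by simp
  show "h10_inner \<Omega> (\<lambda>x. c *\<^sub>R f x) h = c * h10_inner \<Omega> f h" if "f \<in> H10 \<Omega>" "h \<in> H10 \<Omega>" for f h c
    using h10_inner_lin_left[OF that(1) that(1) that(2), of c 0] by simp
  show "0 \<le> h10_inner \<Omega> f f" if "f \<in> H10 \<Omega>" for f
    unfolding h10_inner_def using that by (intro L2.nonneg wgrad H10_H1)
qed

text \<open>One direction is uniqueness of weak gradients. For the other, the Poincare inequality is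
  available for test functions only and is carried to the limit along an approximating
  sequence.\<close>

lemma H10_null_iff:
  assumes "v \<in> H10 \<Omega>"
  shows "l2_inner \<Omega> v v = 0 \<longleftrightarrow> h10_inner \<Omega> v v = 0"
proof
  note H = H10_H1[OF assms]
  assume "l2_inner \<Omega> v v = 0"
  then have ae: "AE x in lebesgue_on \<Omega>. v x = 0" using l2_inner_eq_0_iff[OF H1_L2[OF H]] by simp
  have z: "(\<lambda>x. 0) \<in> L2 \<Omega>" "(\<lambda>x. 0 :: 'a) \<in> L2 \<Omega>" by (rule L2.zero)+
  have "weak_gradient \<Omega> (\<lambda>x. 0) (\<lambda>x. 0)" by (simp add: weak_gradient_def)
  from weak_gradient_unique[OF H1_L2[OF H] z(1) ae wgrad[OF H] z(2) this]
  show "h10_inner \<Omega> v v = 0" unfolding h10_inner_def using l2_inner_eq_0_iff[OF wgrad(1)[OF H]] by simp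
next
  note H = H10_H1[OF assms]
  assume "h10_inner \<Omega> v v = 0"
  then have g0: "l2_norm \<Omega> (wgrad \<Omega> v) = 0" by (simp add: h10_inner_def l2_norm_def)
  obtain R where R: "\<And>x. x \<in> \<Omega> \<Longrightarrow> norm x \<le> R" using bounded_domain bounded_iff by metis
  obtain \<psi> where \<psi>: "\<And>k::nat. \<psi> k \<in> test_functions \<Omega>"
    "(\<lambda>k. l2_norm \<Omega> (\<lambda>x. \<psi> k x - v x)) \<longlonglongrightarrow> 0"
    "(\<lambda>k. l2_norm \<Omega> (\<lambda>x. grad (\<psi> k) x - wgrad \<Omega> v x)) \<longlonglongrightarrow> 0" using assms(1) by (auto simp: H10_def)
  \<comment> \<open>As the gradient of v is null, that of \<open>\<psi> k\<close> is no larger in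
    norm than the gradient error. Hence both terms on the right tend to zero.\<close>
  have le: "l2_norm \<Omega> v \<le> l2_norm \<Omega> (\<lambda>x. \<psi> k x - v x)
      + sqrt (4 * R\<^sup>2) * l2_norm \<Omega> (\<lambda>x. grad (\<psi> k) x - wgrad \<Omega> v x)" for k
  proof -
    have L: "\<psi> k \<in> L2 \<Omega>" "v \<in> L2 \<Omega>" "grad (\<psi> k) \<in> L2 \<Omega>" "wgrad \<Omega> v \<in> L2 \<Omega>"
      by (intro test_L2 test_grad_L2 \<psi> H1_L2 H wgrad)+
    have "l2_norm \<Omega> v = l2_norm \<Omega> (\<lambda>x. \<psi> k x - (\<psi> k x - v x))" by simp
    also have "\<dots> \<le> l2_norm \<Omega> (\<psi> k) + l2_norm \<Omega> (\<lambda>x. \<psi> k x - v x)"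
      unfolding l2_norm_eq by (intro L2.nrm_diff_le L2.diff L)
    finally have 1: "l2_norm \<Omega> v \<le> l2_norm \<Omega> (\<psi> k) + l2_norm \<Omega> (\<lambda>x. \<psi> k x - v x)" .
    have 2: "l2_norm \<Omega> (\<psi> k) \<le> sqrt (4 * R\<^sup>2) * l2_norm \<Omega> (grad (\<psi> k))"
      unfolding l2_norm_def real_sqrt_mult[symmetric]
      by (intro real_sqrt_le_mono poincare_test_functions open_domain R \<psi>)
    have "l2_norm \<Omega> (grad (\<psi> k)) = l2_norm \<Omega> (\<lambda>x. (grad (\<psi> k) x - wgrad \<Omega> v x) + wgrad \<Omega> v x)" by simp
    also have "\<dots> \<le> l2_norm \<Omega> (\<lambda>x. grad (\<psi> k) x - wgrad \<Omega> v x) + l2_norm \<Omega> (wgrad \<Omega> v)"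
      unfolding l2_norm_eq by (intro L2.nrm_triangle L2.diff L)
    finally have "sqrt (4 * R\<^sup>2) * l2_norm \<Omega> (grad (\<psi> k))
        \<le> sqrt (4 * R\<^sup>2) * l2_norm \<Omega> (\<lambda>x. grad (\<psi> k) x - wgrad \<Omega> v x)"
      unfolding g0 by (intro mult_left_mono) auto
    then show ?thesis using 1 2 by linarith
  qed
  have "(\<lambda>k. l2_norm \<Omega> (\<lambda>x. \<psi> k x - v x)
      + sqrt (4 * R\<^sup>2) * l2_norm \<Omega> (\<lambda>x. grad (\<psi> k) x - wgrad \<Omega> v x)) \<longlonglongrightarrow> 0 + sqrt (4 * R\<^sup>2) * 0"
    by (intro tendsto_intros \<psi>)
  from LIMSEQ_le_const[OF this] le have "l2_norm \<Omega> v \<le> 0" by simp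
  then show "l2_inner \<Omega> v v = 0" using L2.nonneg[OF H1_L2[OF H]] by (simp add: l2_norm_def)
qed

lemma H10_two_forms: "two_forms (L2 \<Omega>) (H10 \<Omega>) (l2_inner \<Omega>) (h10_inner \<Omega>)"
proof -
  interpret m: real_semi_inner "L2 \<Omega>" "l2_inner \<Omega> :: ('a \<Rightarrow> real) \<Rightarrow> _" by (rule L2_real_semi_inner)
  interpret a: real_semi_inner "H10 \<Omega>" "h10_inner \<Omega>" by (rule H10_real_semi_inner)
  show ?thesis by unfold_locales (auto simp: H10_L2 H10_null_iff)
qed

end

section \<open>Weak derivatives in time\<close>

lemma smooth_step_derivative:
  obtains s' where "\<And>x. (smooth_step has_real_derivative s' x) (at x)" "continuous_on UNIV s'"
    "\<And>x. x \<notin> {0..1} \<Longrightarrow> s' x = 0"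
proof -
  define s' where "s' = pderiv_dir 1 smooth_step"
  have C: "Ck (Suc 0) smooth_step" by (rule Ck_smooth_step)
  have d: "(smooth_step has_real_derivative s' x) (at x)" for x
  proof -
    have "frechet_derivative smooth_step (at x) h = s' x * h" for h
      using linear_scale[OF linear_frechet_derivative, of smooth_step "at x" h 1] C
      by (simp add: s'_def pderiv_dir_def)
    then show ?thesis using Ck_Suc_has_derivative[OF C, of x] by (simp add: has_field_derivative_def)
  qed
  have const: "s' x = 0" if S: "open S" "x \<in> S" "\<And>y. y \<in> S \<Longrightarrow> smooth_step y = c" for S x c
  proof -
    have "((\<lambda>_. c) has_real_derivative s' x) (at x)"
      by (rule has_field_derivative_transform_within_open[OF d S(1,2) S(3)])
    then show ?thesis using DERIV_unique[OF _ DERIV_const] by blast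
  qed
  have "s' x = 0" if "x \<notin> {0..1}" for x
  proof (cases "x < 0")
    case True
    then show ?thesis by (intro const[of "{..<0}" x 0]) (auto simp: smooth_step_eq_0)
  next
    case False
    then show ?thesis using that by (intro const[of "{1<..}" x 1]) (auto simp: smooth_step_eq_1)
  qed
  moreover have "continuous_on UNIV s'" using C by (simp add: s'_def)
  ultimately show ?thesis using that d by blast
qed

text \<open>The derivative of \<open>smooth_step ((t - a) / \<epsilon>)\<close> concentrates at \<open>a\<close> with mass one.\<close>

lemma smooth_step_mollifier:
  fixes G :: "real \<Rightarrow> real"
  assumes s': "\<And>x. (smooth_step has_real_derivative s' x) (at x)" "continuous_on UNIV s'"
    "\<And>x. x \<notin> {0..1} \<Longrightarrow> s' x = 0"
    and G: "continuous_on UNIV G" "\<And>x. \<bar>G x\<bar> \<le> B"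
    and eps: "\<And>n. 0 < \<epsilon> n" "\<epsilon> \<longlonglongrightarrow> 0"
  shows "(\<lambda>n. LINT t|lborel. s' ((t - a) / \<epsilon> n) / \<epsilon> n * G t) \<longlonglongrightarrow> G a"
    and "integrable lborel (\<lambda>t. s' ((t - a) / \<epsilon> n) / \<epsilon> n * G t)"
proof -
  have sb: "s' \<in> borel_measurable borel" using s'(2) by (rule borel_measurable_continuous_onI)
  have Gb: "G \<in> borel_measurable borel" using G(1) by (rule borel_measurable_continuous_onI)
  have s'i: "(\<lambda>x. s' x * indicator {0..1} x) = s'" using s'(3) by (auto simp: fun_eq_iff indicator_def)
  have cont: "isCont s' x" for x using s'(2) by (simp add: continuous_on_eq_continuous_at)
  \<comment> \<open>The mass of the kernel is the increase of \<open>smooth_step\<close> over the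
    unit interval.\<close>
  have FTC: "has_bochner_integral lborel s' 1"
    using has_bochner_integral_FTC_Icc_real[of 0 1 smooth_step s'] s'(1) cont
    by (simp add: s'i smooth_step_eq_0 smooth_step_eq_1)
  have si: "integrable lborel s'" "(LINT x|lborel. s' x) = 1"
    using FTC by (auto simp: has_bochner_integral_iff)
  have shift: "(\<lambda>y. s' y * G (a + c * y)) \<in> borel_measurable borel" for c
    using sb Gb by measurable
  have bound: "\<bar>s' y * G (a + c * y)\<bar> \<le> \<bar>s' y\<bar> * B" for y c
    unfolding abs_mult by (intro mult_left_mono G(2)) auto
  have eq: "(\<lambda>y. s' ((a + \<epsilon> n * y - a) / \<epsilon> n) / \<epsilon> n * G (a + \<epsilon> n * y)) = (\<lambda>y. (1 / \<epsilon> n) * (s' y * G (a + \<epsilon> n * y)))" for n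
    using eps(1)[of n] by (auto simp: fun_eq_iff)
  have "integrable lborel (\<lambda>y. s' y * G (a + \<epsilon> n * y))" for n
    by (rule Bochner_Integration.integrable_bound[where f = "\<lambda>y. \<bar>s' y\<bar> * B"])
      (use si shift bound in \<open>auto intro!: order_trans[OF bound abs_ge_self]\<close>)
  then have I: "integrable lborel (\<lambda>y. s' ((a + \<epsilon> n * y - a) / \<epsilon> n) / \<epsilon> n * G (a + \<epsilon> n * y))" for n
    unfolding eq by (intro Bochner_Integration.integrable_mult_right)
  have "\<epsilon> n \<noteq> 0" for n using eps(1)[of n] by simp
  then show "integrable lborel (\<lambda>t. s' ((t - a) / \<epsilon> n) / \<epsilon> n * G t)" for n
    using lborel_integrable_real_affine_iff[THEN iffD1, OF _ I] by blast
  have "(LINT t|lborel. s' ((t - a) / \<epsilon> n) / \<epsilon> n * G t) = (LINT y|lborel. s' y * G (a + \<epsilon> n * y))" for n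
  proof -
    have "(LINT t|lborel. s' ((t - a) / \<epsilon> n) / \<epsilon> n * G t)
        = \<epsilon> n * (LINT y|lborel. (1 / \<epsilon> n) * (s' y * G (a + \<epsilon> n * y)))"
      using eps(1)[of n] by (subst lborel_integral_real_affine[of "\<epsilon> n" _ a]) (auto simp: eq)
    then show ?thesis using eps(1)[of n] by simp
  qed
  moreover have "(\<lambda>n. LINT y|lborel. s' y * G (a + \<epsilon> n * y)) \<longlonglongrightarrow> (LINT y|lborel. s' y * G a)"
  proof (rule integral_dominated_convergence[where w = "\<lambda>y. \<bar>s' y\<bar> * B"])
    show "AE y in lborel. (\<lambda>n. s' y * G (a + \<epsilon> n * y)) \<longlonglongrightarrow> s' y * G a"
    proof (rule AE_I2)
      fix y
      have "(\<lambda>n. a + \<epsilon> n * y) \<longlonglongrightarrow> a + 0 * y" by (intro tendsto_intros eps)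
      then have "(\<lambda>n. G (a + \<epsilon> n * y)) \<longlonglongrightarrow> G (a + 0 * y)"
        using G(1) by (intro continuous_on_tendsto_compose[of UNIV G]) auto
      then show "(\<lambda>n. s' y * G (a + \<epsilon> n * y)) \<longlonglongrightarrow> s' y * G a" by (intro tendsto_intros) simp
    qed
    show "AE y in lborel. norm (s' y * G (a + \<epsilon> n * y)) \<le> \<bar>s' y\<bar> * B" for n
      using bound by (intro AE_I2) simp
  qed (use si shift sb in \<open>auto intro!: Bochner_Integration.integrable_mult_left\<close>)
  moreover have "(LINT y|lborel. s' y * G a) = G a" using si by simp
  ultimately show "(\<lambda>n. LINT t|lborel. s' ((t - a) / \<epsilon> n) / \<epsilon> n * G t) \<longlonglongrightarrow> G a"
    by (simp add: si(2))
qed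

text \<open>Test with a smooth step up just after a minus one just after b. As the width shrinks,
  the derivative tends to the difference of the point masses at a and b, and the function itself to
  the indicator of \<open>{a<..b}\<close>. Interior a and b keep the support inside the open
  interval.\<close>

lemma weak_derivative_increment_interior:
  fixes g h :: "real \<Rightarrow> real"
  assumes g: "continuous_on {0..T} g" and h: "integrable (lebesgue_on {0<..<T}) h"
    and weak: "\<And>\<theta>. \<theta> \<in> test_functions {0<..<T} \<Longrightarrow>
      (LINT t|lebesgue_on {0<..<T}. deriv \<theta> t * g t) = - (LINT t|lebesgue_on {0<..<T}. \<theta> t * h t)"
    and ab: "0 < a" "a \<le> b" "b < T"
  shows "g b - g a = (LINT t|lebesgue_on {0<..<T}. indicator {a<..b} t * h t)"
proof -
  let ?M = "lebesgue_on {0<..<T}"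
  obtain s' where s': "\<And>x. (smooth_step has_real_derivative s' x) (at x)" "continuous_on UNIV s'"
    "\<And>x. x \<notin> {0..1} \<Longrightarrow> s' x = 0" using smooth_step_derivative by blast
  \<comment> \<open>The offset 2 keeps b + \<open>\<epsilon> n\<close> strictly below T already for
    n = 0.\<close>
  define \<epsilon> where "\<epsilon> n = (T - b) / real (n + 2)" for n
  have eps: "0 < \<epsilon> n" "b + \<epsilon> n < T" for n
  proof -
    show "0 < \<epsilon> n" using ab by (simp add: \<epsilon>_def)
    have "(T - b) / real (n + 2) < (T - b) / 1" using ab by (intro divide_strict_left_mono) auto
    then show "b + \<epsilon> n < T" by (simp add: \<epsilon>_def)
  qed
  have eps0: "\<epsilon> \<longlonglongrightarrow> 0" unfolding \<epsilon>_def by real_asymp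
  \<comment> \<open>Clamping the argument extends g to a bounded continuous function on the whole
    line, as the mollifier requires, without changing it inside the interval.\<close>
  define G where "G t = g (max 0 (min T t))" for t
  have T: "0 < T" using ab by simp
  have Gc: "continuous_on UNIV G"
    unfolding G_def using T by (intro continuous_on_compose2[OF g] continuous_intros) auto
  have GG: "G t = g t" if "t \<in> {0<..<T}" for t using that by (simp add: G_def)
  obtain B where B: "\<And>t. \<bar>G t\<bar> \<le> B"
  proof -
    have "compact (g ` {0..T})" using g by (intro compact_continuous_image) auto
    then obtain B where B: "\<And>y. y \<in> g ` {0..T} \<Longrightarrow> norm y \<le> B" by (metis compact_imp_bounded bounded_iff)
    have "\<bar>G t\<bar> \<le> B" for t using B[of "G t"] T by (simp add: G_def)
    then show ?thesis by (rule that)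
  qed
  define \<theta> where "\<theta> n t = smooth_step ((t - a) / \<epsilon> n) - smooth_step ((t - b) / \<epsilon> n)" for n t
  have test: "\<theta> n \<in> test_functions {0<..<T}" for n
  proof (rule test_functionsI[of _ "{a..b + \<epsilon> n}"])
    have aff: "Ck k (\<lambda>t::real. (t - c) / \<epsilon> n)" for k c
      using Ck_cmult[OF Ck_diff[OF Ck_inner[of k "1::real"] Ck_const[of k c]], of "1 / \<epsilon> n"]
      by simp
    show "Ck k (\<theta> n)" for k
      unfolding \<theta>_def[abs_def] by (intro Ck_diff Ck_compose[OF Ck_smooth_step aff])
    show "{a..b + \<epsilon> n} \<subseteq> {0<..<T}" using ab eps[of n] by auto
    show "\<theta> n t = 0" if "t \<notin> {a..b + \<epsilon> n}" for t
    proof (cases "t < a")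
      case True
      then show ?thesis using ab eps(1)[of n]
        by (simp add: \<theta>_def smooth_step_eq_0 divide_nonpos_pos)
    next
      case False
      then have "t > b + \<epsilon> n" using that by auto
      then have "1 \<le> (t - a) / \<epsilon> n" "1 \<le> (t - b) / \<epsilon> n" using ab eps(1)[of n] by (auto simp: le_divide_eq)
      then show ?thesis by (simp add: \<theta>_def smooth_step_eq_1)
    qed
  qed auto
  have dth: "deriv (\<theta> n) t = s' ((t - a) / \<epsilon> n) / \<epsilon> n - s' ((t - b) / \<epsilon> n) / \<epsilon> n" for n t
  proof (rule DERIV_imp_deriv)
    have "((\<lambda>t. smooth_step ((t - c) / \<epsilon> n)) has_real_derivative s' ((t - c) / \<epsilon> n) * (1 / \<epsilon> n)) (at t)" for c
      by (rule DERIV_chain2[OF s'(1)]) (use eps(1)[of n] in \<open>auto intro!: derivative_eq_intros\<close>)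
    then show "(\<theta> n has_real_derivative s' ((t - a) / \<epsilon> n) / \<epsilon> n - s' ((t - b) / \<epsilon> n) / \<epsilon> n) (at t)"
      unfolding \<theta>_def[abs_def] using DERIV_diff by fastforce
  qed
  have s'0: "s' ((t - c) / \<epsilon> n) = 0" if "a \<le> c" "c \<le> b" "t \<notin> {0<..<T}" for t c n
  proof (rule s'(3))
    have "t - c < 0 \<or> \<epsilon> n < t - c" using that ab eps[of n] by auto
    then show "(t - c) / \<epsilon> n \<notin> {0..1}" using eps(1)[of n]
      by (auto simp: zero_le_divide_iff divide_le_eq)
  qed
  note mol = smooth_step_mollifier[OF s' Gc B eps(1) eps0]
  have L: "(LINT t|?M. deriv (\<theta> n) t * g t)
      = (LINT t|lborel. s' ((t - a) / \<epsilon> n) / \<epsilon> n * G t) - (LINT t|lborel. s' ((t - b) / \<epsilon> n) / \<epsilon> n * G t)" for n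
  proof -
    have "(LINT t|?M. deriv (\<theta> n) t * g t) = (LINT t|?M. deriv (\<theta> n) t * G t)"
      by (rule Bochner_Integration.integral_cong) (auto simp: GG space_restrict_space)
    also have "\<dots> = (LINT t|lborel. deriv (\<theta> n) t * G t)"
    proof (rule integral_lebesgue_on_eq_lborel)
      show "deriv (\<theta> n) t * G t = 0" if "t \<notin> {0<..<T}" for t
        using s'0[of a t n] s'0[of b t n] that ab by (simp add: dth)
      show "(\<lambda>t. deriv (\<theta> n) t * G t) \<in> borel_measurable borel"
        using borel_measurable_continuous_onI[OF s'(2)] borel_measurable_continuous_onI[OF Gc]
        unfolding dth by measurable
    qed simp
    also have "\<dots> = (LINT t|lborel. s' ((t - a) / \<epsilon> n) / \<epsilon> n * G t - s' ((t - b) / \<epsilon> n) / \<epsilon> n * G t)"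
      by (simp add: dth left_diff_distrib)
    also have "\<dots> = (LINT t|lborel. s' ((t - a) / \<epsilon> n) / \<epsilon> n * G t) - (LINT t|lborel. s' ((t - b) / \<epsilon> n) / \<epsilon> n * G t)"
      by (intro Bochner_Integration.integral_diff mol(2))
    finally show ?thesis .
  qed
  have "(\<lambda>n. LINT t|?M. deriv (\<theta> n) t * g t) \<longlonglongrightarrow> G a - G b"
    unfolding L by (intro tendsto_diff mol(1))
  then have lim1: "(\<lambda>n. - (LINT t|?M. \<theta> n t * h t)) \<longlonglongrightarrow> g a - g b"
    using weak[OF test] GG[of a] GG[of b] ab by simp
  have th1: "\<bar>\<theta> n t\<bar> \<le> 1" for n t
    unfolding \<theta>_def
    using smooth_step_nonneg[of "(t - a) / \<epsilon> n"] smooth_step_nonneg[of "(t - b) / \<epsilon> n"]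
      smooth_step_le_1[of "(t - a) / \<epsilon> n"] smooth_step_le_1[of "(t - b) / \<epsilon> n"] by linarith
  have step_lim: "(\<lambda>n. smooth_step ((t - c) / \<epsilon> n)) \<longlonglongrightarrow> indicator {c<..} t" for t c
  proof (cases "c < t")
    case True
    have "eventually (\<lambda>n. \<epsilon> n < t - c) sequentially" using eps0 True by (intro order_tendstoD) auto
    then have "eventually (\<lambda>n. smooth_step ((t - c) / \<epsilon> n) = 1) sequentially"
      by eventually_elim (rule smooth_step_eq_1, use eps(1) in \<open>simp add: le_divide_eq\<close>)
    then show ?thesis using True by (simp add: tendsto_eventually)
  next
    case False
    then have "smooth_step ((t - c) / \<epsilon> n) = 0" for n
      using eps(1)[of n] by (intro smooth_step_eq_0) (simp add: divide_nonpos_pos)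
    then show ?thesis using False by simp
  qed
  have th_lim: "(\<lambda>n. \<theta> n t) \<longlonglongrightarrow> indicator {a<..b} t" for t
  proof -
    have "(\<lambda>n. \<theta> n t) \<longlonglongrightarrow> indicator {a<..} t - indicator {b<..} t"
      unfolding \<theta>_def by (intro tendsto_diff step_lim)
    also have "indicator {a<..} t - indicator {b<..} t = (indicator {a<..b} t :: real)"
      using ab by (auto simp: indicator_def)
    finally show ?thesis .
  qed
  have hm: "h \<in> borel_measurable ?M" using h by simp
  have "(\<lambda>n. LINT t|?M. \<theta> n t * h t) \<longlonglongrightarrow> (LINT t|?M. indicator {a<..b} t * h t)"
  proof (rule integral_dominated_convergence[where w = "\<lambda>t. \<bar>h t\<bar>"])
    have "indicat_real {a<..b} \<in> borel_measurable ?M" by (rule indicator_measurable_lebesgue_on) simp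
    then show "(\<lambda>t. indicator {a<..b} t * h t) \<in> borel_measurable ?M" using hm by measurable
    have "\<theta> n \<in> borel_measurable ?M" for n
      using test_functions_Ck[OF test, of 0] by (intro borel_measurable_lebesgue_on_continuous) simp
    then show "(\<lambda>t. \<theta> n t * h t) \<in> borel_measurable ?M" for n using hm by measurable
    show "AE t in ?M. (\<lambda>n. \<theta> n t * h t) \<longlonglongrightarrow> indicator {a<..b} t * h t"
      by (intro AE_I2 tendsto_mult th_lim tendsto_const)
    show "AE t in ?M. norm (\<theta> n t * h t) \<le> \<bar>h t\<bar>" for n
      using th1 by (intro AE_I2) (simp add: abs_mult mult_left_le_one_le)
  qed (use h in simp)
  from tendsto_minus[OF this] lim1 have "g a - g b = - (LINT t|?M. indicator {a<..b} t * h t)"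
    using LIMSEQ_unique by blast
  then show ?thesis by simp
qed

text \<open>The difference between g and the antiderivative of h is constant on the open interval by
  the interior case, and by continuity also on the closed one.\<close>

lemma weak_derivative_increment:
  fixes g h :: "real \<Rightarrow> real"
  assumes g: "continuous_on {0..T} g" and h: "integrable (lebesgue_on {0<..<T}) h"
    and weak: "\<And>\<theta>. \<theta> \<in> test_functions {0<..<T} \<Longrightarrow>
      (LINT t|lebesgue_on {0<..<T}. deriv \<theta> t * g t) = - (LINT t|lebesgue_on {0<..<T}. \<theta> t * h t)"
    and ab: "0 \<le> a" "a \<le> b" "b \<le> T"
  shows "g b - g a = (LINT t|lebesgue_on {0<..<T}. indicator {a<..b} t * h t)"
proof (cases "0 < T")
  case False
  then have "a = b" using ab by linarith
  then show ?thesis by simp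
next
  case T: True
  let ?M = "lebesgue_on {0<..<T}"
  define I where "I t = (LINT x|?M. indicator {0<..t} x * h x)" for t
  have hm: "h \<in> borel_measurable ?M" using h by simp
  note ind = indicator_measurable_lebesgue_on
  note Ii = integrable_indicator_mult_lebesgue_on[OF _ h]
  have diff: "I t - I s = (LINT x|?M. indicator {s<..t} x * h x)" if "0 \<le> s" "s \<le> t" for s t
  proof -
    have "I t - I s = (LINT x|?M. indicator {0<..t} x * h x - indicator {0<..s} x * h x)"
      unfolding I_def by (intro Bochner_Integration.integral_diff[symmetric] Ii) auto
    also have "\<dots> = (LINT x|?M. indicator {s<..t} x * h x)"
      using that by (intro Bochner_Integration.integral_cong) (auto simp: indicator_def)
    finally show ?thesis .
  qed
  have cont: "continuous_on {0..T} I"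
    unfolding continuous_on_sequentially comp_def
  proof (intro allI ballI impI, elim conjE)
    fix x :: "nat \<Rightarrow> real" and t assume x: "x \<longlonglongrightarrow> t"
    show "(\<lambda>n. I (x n)) \<longlonglongrightarrow> I t"
      unfolding I_def
    proof (rule integral_dominated_convergence[where w = "\<lambda>t. \<bar>h t\<bar>"])
      show "AE y in ?M. norm (indicator {0<..x n} y * h y) \<le> \<bar>h y\<bar>" for n
        by (intro AE_I2) (auto simp: indicator_def)
      \<comment> \<open>The indicators of the moving intervals may fail to converge at the endpoint
        t.\<close>
      have "AE y in lebesgue. y \<noteq> t" by (intro AE_completion AE_lborel_singleton)
      then have "AE y in lebesgue. (\<lambda>n. indicator {0<..x n} y * h y) \<longlonglongrightarrow> indicator {0<..t} y * h y"
      proof eventually_elim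
        case (elim y)
        have "eventually (\<lambda>n. indicator {0<..x n} y = (indicator {0<..t} y :: real)) sequentially"
        proof (cases "y < t")
          case True
          from order_tendstoD(1)[OF x this] show ?thesis
            by eventually_elim (use True in \<open>auto simp: indicator_def\<close>)
        next
          case False
          then have "t < y" using elim by simp
          from order_tendstoD(2)[OF x this] show ?thesis
            by eventually_elim (use \<open>t < y\<close> in \<open>auto simp: indicator_def\<close>)
        qed
        then have "(\<lambda>n. indicator {0<..x n} y) \<longlonglongrightarrow> (indicator {0<..t} y :: real)"
          by (rule tendsto_eventually)
        then show ?case by (intro tendsto_mult tendsto_const)
      qed
      then have "AE y in lebesgue. y \<in> {0<..<T} \<longrightarrow>
          (\<lambda>n. indicator {0<..x n} y * h y) \<longlonglongrightarrow> indicator {0<..t} y * h y"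
        by eventually_elim simp
      then show "AE y in ?M. (\<lambda>n. indicator {0<..x n} y * h y) \<longlonglongrightarrow> indicator {0<..t} y * h y"
        by (simp add: AE_restrict_space_iff)
    qed (use h hm in \<open>auto intro!: borel_measurable_times ind\<close>)
  qed
  define k where "k t = g t - I t" for t
  have kc: "continuous_on (closure {0<..<T}) k"
    unfolding k_def using T by (simp add: continuous_on_diff[OF g cont])
  have kconst: "k t = k (T / 2)" if "t \<in> {0<..<T}" for t
  proof -
    have *: "k t = k s" if "0 < s" "s \<le> t" "t < T" for s t
      using weak_derivative_increment_interior[OF g h weak that] diff[of s t] that by (simp add: k_def)
    show ?thesis using *[of t "T / 2"] *[of "T / 2" t] that by (cases "t \<le> T / 2") auto
  qed
  have kc0: "k t = k (T / 2)" if "t \<in> {0..T}" for t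
    by (rule continuous_constant_on_closure[OF kc kconst]) (use that T in auto)
  have "k a = k b" using kc0[of a] kc0[of b] ab by simp
  then show ?thesis using diff[of a b] ab by (simp add: k_def)
qed

text \<open>A continuous weak derivative is a classical one, by the fundamental theorem of calculus.
  Most of the work identifies the Lebesgue integral over the open interval with the gauge integral
  used there.\<close>

lemma DERIV_of_increments:
  fixes g h :: "real \<Rightarrow> real"
  assumes h: "continuous_on {0..T} h"
    and inc: "\<And>a b. 0 \<le> a \<Longrightarrow> a \<le> b \<Longrightarrow> b \<le> T \<Longrightarrow>
      g b - g a = (LINT t|lebesgue_on {0<..<T}. indicator {a<..b} t * h t)"
    and t: "t \<in> {0..T}"
  shows "(g has_real_derivative h t) (at t within {0..T})"
proof -
  have eq: "g x = g 0 + integral {0..x} h" if x: "x \<in> {0..T}" for x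
  proof -
    have si: "set_integrable lborel {0..x} h"
      using x by (intro borel_integrable_atLeastAtMost' continuous_on_subset[OF h]) auto
    have "(LINT t|lebesgue_on {0<..<T}. indicator {0<..x} t * h t)
        = (LINT t|lebesgue. indicator {0<..<T} t * (indicator {0<..x} t * h t))"
      by (simp add: integral_restrict_space)
    also have "\<dots> = (LINT t|lebesgue. indicator {0..x} t * h t)"
    proof (rule integral_cong_AE)
      have m: "(\<lambda>t. indicator {0..x} t * h t) \<in> borel_measurable lebesgue"
        using si measurable_completion unfolding set_integrable_def by (metis (no_types, lifting) borel_measurable_integrable real_scaleR_def ext)
      have "AE y in lebesgue. y \<noteq> 0" "AE y in lebesgue. y \<noteq> T" by (intro AE_completion AE_lborel_singleton)+
      then show ae: "AE t in lebesgue. indicator {0<..<T} t * (indicator {0<..x} t * h t) = indicator {0..x} t * h t"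
        by eventually_elim (use x in \<open>auto simp: indicator_def\<close>)
      show "(\<lambda>t. indicator {0..x} t * h t) \<in> borel_measurable lebesgue" by (rule m)
      show "(\<lambda>t. indicator {0<..<T} t * (indicator {0<..x} t * h t)) \<in> borel_measurable lebesgue"
      proof (rule borel_measurable_AE[OF m])
        show "AE t in lebesgue. indicator {0..x} t * h t = indicator {0<..<T} t * (indicator {0<..x} t * h t)"
          using ae by eventually_elim (rule sym)
      qed
    qed
    also have "\<dots> = (LINT t|lborel. indicator {0..x} t * h t)"
      using si by (intro integral_completion) (auto simp: set_integrable_def)
    also have "\<dots> = integral {0..x} h"
      using set_borel_integral_eq_integral(2)[OF si] by (simp add: set_lebesgue_integral_def)
    finally show ?thesis using inc[of 0 x] x by simp
  qed
  have "((\<lambda>x. g 0 + integral {0..x} h) has_real_derivative h t) (at t within {0..T})"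
    using integral_has_real_derivative[OF h t] by (auto intro!: derivative_eq_intros)
  then show ?thesis
  proof (rule has_field_derivative_transform_within[of _ _ _ _ 1])
    show "g 0 + integral {0..x} h = g x" if "x \<in> {0..T}" for x by (rule eq[OF that, symmetric])
  qed (use t in auto)
qed

text \<open>Only the oscillation J of the second derivative enters, since the third derivative will
  exist merely in the weak sense; J will be bounded by its integral over the step.\<close>

lemma trapezoid_error:
  fixes g0 g1 g2 :: "real \<Rightarrow> real"
  assumes d0: "\<And>t. t \<in> {a..b} \<Longrightarrow> (g0 has_real_derivative g1 t) (at t within {a..b})"
    and d1: "\<And>t. t \<in> {a..b} \<Longrightarrow> (g1 has_real_derivative g2 t) (at t within {a..b})"
    and J: "\<And>s t. s \<in> {a..b} \<Longrightarrow> t \<in> {a..b} \<Longrightarrow> \<bar>g2 s - g2 t\<bar> \<le> J" and ab: "a \<le> b"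
  shows "\<bar>g0 b - g0 a - (b - a) / 2 * (g1 b + g1 a)\<bar> \<le> (b - a)\<^sup>2 / 2 * J"
proof -
  have J0: "0 \<le> J" using J[of a a] ab by simp
  have 1: "\<bar>(g1 t - g1 a) - (t - a) * g2 t\<bar> \<le> J * (b - a)" if t: "t \<in> {a..b}" for t
  proof -
    have "norm ((g1 t - t * g2 t) - (g1 a - a * g2 t)) \<le> J * norm (t - a)"
    proof (rule field_differentiable_bound[of "{a..b}" "\<lambda>s. g1 s - s * g2 t" "\<lambda>s. g2 s - g2 t"])
      show "((\<lambda>s. g1 s - s * g2 t) has_real_derivative g2 s - g2 t) (at s within {a..b})" if "s \<in> {a..b}" for s
        using d1[OF that] by (auto intro!: derivative_eq_intros)
    qed (use J t ab in auto)
    also have "\<dots> \<le> J * (b - a)" using t J0 by (intro mult_left_mono) auto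
    finally show ?thesis by (simp add: algebra_simps)
  qed
  \<comment> \<open>The defect of the trapezoidal rule as a function of the right endpoint, up to a
    constant; its derivative is half of the quantity bounded above.\<close>
  define q where "q t = g0 t - (t - a) / 2 * (g1 t + g1 a)" for t
  have "norm (q b - q a) \<le> J * (b - a) / 2 * norm (b - a)"
  proof (rule field_differentiable_bound[of "{a..b}" q "\<lambda>t. ((g1 t - g1 a) - (t - a) * g2 t) / 2"])
    show "(q has_real_derivative ((g1 t - g1 a) - (t - a) * g2 t) / 2) (at t within {a..b})" if "t \<in> {a..b}" for t
      unfolding q_def using d0[OF that] d1[OF that]
      by (auto intro!: derivative_eq_intros simp: field_simps)
    show "norm (((g1 t - g1 a) - (t - a) * g2 t) / 2) \<le> J * (b - a) / 2" if "t \<in> {a..b}" for t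
      using 1[OF that] by simp
  qed (use ab in auto)
  then show ?thesis using ab by (simp add: q_def power2_eq_square algebra_simps)
qed

section \<open>Scalar pairings of functions of time and their increments\<close>

lemma l2_norm_nonneg: "0 \<le> l2_norm \<Omega> v"
  by (simp add: l2_norm_def l2_inner_def)

lemma L2L2_norm_squared: "(L2L2_norm T \<Omega> z)\<^sup>2 = (LINT t|lebesgue_on {0<..<T}. (l2_norm \<Omega> (z t))\<^sup>2)"
  by (simp add: L2L2_norm_def)

lemma L2L2_norm_in_L2:
  assumes "z \<in> L2L2 T \<Omega>" shows "(\<lambda>t. l2_norm \<Omega> (z t)) \<in> L2 {0<..<T}"
proof -
  have i: "integrable (lebesgue_on {0<..<T}) (\<lambda>t. (l2_norm \<Omega> (z t))\<^sup>2)"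
    using assms by (simp add: L2L2_def)
  have "(\<lambda>t. sqrt ((l2_norm \<Omega> (z t))\<^sup>2)) \<in> borel_measurable (lebesgue_on {0<..<T})"
    using borel_measurable_integrable[OF i] by measurable
  then show ?thesis using i by (simp add: L2_def l2_norm_nonneg)
qed

lemma const_in_L2_interval: "(\<lambda>t. c :: real) \<in> L2 {0<..<T::real}"
  by (rule L2_of_bounded[of _ _ "\<bar>c\<bar>"]) (auto simp: open_in_lebesgue)

lemma L2L2_norm_integrable:
  assumes "z \<in> L2L2 T \<Omega>" shows "integrable (lebesgue_on {0<..<T}) (\<lambda>t. l2_norm \<Omega> (z t))"
  using L2_integrable_mult[OF L2L2_norm_in_L2[OF assms] const_in_L2_interval[of 1]] by simp

text \<open>Strong measurability is used here: the pairing is an almost everywhere limit of pairings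
  with simple functions, each of which is visibly measurable. The norm of z then dominates
  it.\<close>

lemma
  assumes z: "z \<in> L2L2 T \<Omega>" and w: "w \<in> L2 \<Omega>"
  shows L2L2_inner_bound:
      "AE t in lebesgue_on {0<..<T}. \<bar>l2_inner \<Omega> (z t) w\<bar> \<le> l2_norm \<Omega> (z t) * l2_norm \<Omega> w"
    and L2L2_inner_integrable: "integrable (lebesgue_on {0<..<T}) (\<lambda>t. l2_inner \<Omega> (z t) w)"
proof -
  let ?M = "lebesgue_on {0<..<T}"
  have zL: "AE t in ?M. z t \<in> L2 \<Omega>" using z by (simp add: L2L2_def)
  then show b: "AE t in ?M. \<bar>l2_inner \<Omega> (z t) w\<bar> \<le> l2_norm \<Omega> (z t) * l2_norm \<Omega> w"
    by eventually_elim (simp add: l2_norm_eq L2.abs_le_nrm w)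
  obtain s where s: "\<And>k::nat. l2_simple \<Omega> (s k)"
    "AE t in ?M. (\<lambda>k. l2_norm \<Omega> (\<lambda>x. s k t x - z t x)) \<longlonglongrightarrow> 0"
    using z by (auto simp: L2L2_def)
  have sm: "(\<lambda>t. l2_inner \<Omega> (s k t) w) \<in> borel_measurable lebesgue" and sL: "s k t \<in> L2 \<Omega>" for k t
  proof -
    obtain n :: nat and E e where E: "\<And>i. i < n \<Longrightarrow> E i \<in> sets lebesgue" "\<And>i. i < n \<Longrightarrow> e i \<in> L2 \<Omega>"
      and se: "s k = (\<lambda>t x. \<Sum>i<n. indicator (E i) t * e i x)"
      using s(1)[of k] unfolding l2_simple_def by blast
    interpret R: real_semi_inner "L2 \<Omega>" "l2_inner \<Omega> :: ('a \<Rightarrow> real) \<Rightarrow> _" by (rule L2_real_semi_inner)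
    show "s k t \<in> L2 \<Omega>" for t unfolding se using E by (intro R.rsum_mem) simp
    have "(\<lambda>t. l2_inner \<Omega> (s k t) w) = (\<lambda>t. \<Sum>i<n. indicator (E i) t * l2_inner \<Omega> (e i) w)"
      unfolding se using E w by (intro ext R.rsum_left) auto
    moreover have "\<dots> \<in> borel_measurable lebesgue"
      by (rule borel_measurable_sum, rule borel_measurable_times, rule borel_measurable_indicator)
        (use E(1) in simp_all)
    ultimately show "(\<lambda>t. l2_inner \<Omega> (s k t) w) \<in> borel_measurable lebesgue" by simp
  qed
  have "AE t in ?M. lim (\<lambda>k. l2_inner \<Omega> (s k t) w) = l2_inner \<Omega> (z t) w"
    using zL s(2)
  proof eventually_elim
    case (elim t)
    have "(\<lambda>k. l2_inner \<Omega> (s k t) w - l2_inner \<Omega> (z t) w) \<longlonglongrightarrow> 0"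
    proof (rule Lim_null_comparison)
      show "\<forall>\<^sub>F k in sequentially. norm (l2_inner \<Omega> (s k t) w - l2_inner \<Omega> (z t) w)
          \<le> l2_norm \<Omega> (\<lambda>x. s k t x - z t x) * l2_norm \<Omega> w"
        using L2.abs_le_nrm[OF L2.diff[OF sL elim(1)] w] L2.diff_left[OF sL elim(1) w]
        by (simp add: l2_norm_eq)
      show "(\<lambda>k. l2_norm \<Omega> (\<lambda>x. s k t x - z t x) * l2_norm \<Omega> w) \<longlonglongrightarrow> 0"
        using tendsto_mult_right[OF elim(2), of "l2_norm \<Omega> w"] by simp
    qed
    then show ?case by (intro limI) (simp add: LIM_zero_iff)
  qed
  \<comment> \<open>The equality is known on the interval only. Cutting off both sides moves it to
    \<open>lebesgue\<close>, whose completeness carries measurability across the null set.\<close>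
  then have ae: "AE t in lebesgue. (if t \<in> {0<..<T} then lim (\<lambda>k. l2_inner \<Omega> (s k t) w) else 0)
      = (if t \<in> {0<..<T} then l2_inner \<Omega> (z t) w else 0)"
    by (subst (asm) AE_restrict_space_iff) (auto simp: open_in_lebesgue elim!: eventually_mono)
  have "(\<lambda>t. lim (\<lambda>k. l2_inner \<Omega> (s k t) w)) \<in> borel_measurable lebesgue"
    by (rule borel_measurable_lim_metric[OF sm])
  then have "(\<lambda>t. if t \<in> {0<..<T} then lim (\<lambda>k. l2_inner \<Omega> (s k t) w) else 0) \<in> borel_measurable lebesgue"
    by (intro measurable_If_set) (auto simp: open_in_lebesgue)
  from borel_measurable_AE[OF this ae]
  have m: "(\<lambda>t. l2_inner \<Omega> (z t) w) \<in> borel_measurable ?M"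
    by (subst (asm) borel_measurable_if) (auto simp: open_in_lebesgue)
  show "integrable ?M (\<lambda>t. l2_inner \<Omega> (z t) w)"
  proof (rule Bochner_Integration.integrable_bound[OF _ m])
    show "integrable ?M (\<lambda>t. l2_norm \<Omega> (z t) * l2_norm \<Omega> w)"
      by (intro Bochner_Integration.integrable_mult_left L2L2_norm_integrable z)
    show "AE t in ?M. norm (l2_inner \<Omega> (z t) w) \<le> norm (l2_norm \<Omega> (z t) * l2_norm \<Omega> w)"
      using b by eventually_elim (simp add: l2_norm_nonneg)
  qed
qed

lemma continuous_in_time_inner:
  assumes "continuous_in_time T \<Omega> z" "w \<in> L2 \<Omega>"
  shows "continuous_on {0..T} (\<lambda>t. l2_inner \<Omega> (z t) w)"
  unfolding continuous_on_def
proof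
  fix t assume t: "t \<in> {0..T}"
  have z: "z s \<in> L2 \<Omega>" if "s \<in> {0..T}" for s using assms(1) that by (simp add: continuous_in_time_def)
  have lim: "((\<lambda>s. l2_norm \<Omega> (\<lambda>x. z s x - z t x)) \<longlongrightarrow> 0) (at t within {0..T})"
    using assms(1) t by (simp add: continuous_in_time_def)
  have "((\<lambda>s. l2_inner \<Omega> (z s) w - l2_inner \<Omega> (z t) w) \<longlongrightarrow> 0) (at t within {0..T})"
  proof (rule Lim_null_comparison)
    show "\<forall>\<^sub>F s in at t within {0..T}. norm (l2_inner \<Omega> (z s) w - l2_inner \<Omega> (z t) w)
        \<le> l2_norm \<Omega> (\<lambda>x. z s x - z t x) * l2_norm \<Omega> w"
      unfolding eventually_at_filter
    proof (rule always_eventually, intro allI impI)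
      fix s assume "s \<in> {0..T}"
      from L2.abs_le_nrm[OF L2.diff[OF z[OF this] z[OF t]] assms(2)] L2.diff_left[OF z[OF this] z[OF t] assms(2)]
      show "norm (l2_inner \<Omega> (z s) w - l2_inner \<Omega> (z t) w) \<le> l2_norm \<Omega> (\<lambda>x. z s x - z t x) * l2_norm \<Omega> w"
        by (simp add: l2_norm_eq)
    qed
    show "((\<lambda>s. l2_norm \<Omega> (\<lambda>x. z s x - z t x) * l2_norm \<Omega> w) \<longlongrightarrow> 0) (at t within {0..T})"
      using tendsto_mult_right[OF lim, of "l2_norm \<Omega> w"] by simp
  qed
  then show "((\<lambda>t. l2_inner \<Omega> (z t) w) \<longlongrightarrow> l2_inner \<Omega> (z t) w) (at t within {0..T})"
    by (simp add: LIM_zero_iff)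
qed

text \<open>For fixed w the pairing is a continuous real function with an integrable weak
  derivative, so the scalar result applies.\<close>

lemma Hk_time_inner_increment:
  assumes "Hk_time k T \<Omega> Z" "j < k" "w \<in> L2 \<Omega>" "0 \<le> a" "a \<le> b" "b \<le> T"
  shows "l2_inner \<Omega> (Z j b) w - l2_inner \<Omega> (Z j a) w
    = (LINT t|lebesgue_on {0<..<T}. indicator {a<..b} t * l2_inner \<Omega> (Z (Suc j) t) w)"
proof -
  have W: "weak_time_deriv T \<Omega> (Z j) (Z (Suc j))" "continuous_in_time T \<Omega> (Z j)"
    using assms(1,2) by (auto simp: Hk_time_def)
  then have "Z (Suc j) \<in> L2L2 T \<Omega>" by (simp add: weak_time_deriv_def)
  then show ?thesis
    using W(1) assms(3)
    by (intro weak_derivative_increment[OF continuous_in_time_inner[OF W(2) assms(3)]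
          L2L2_inner_integrable[OF _ assms(3)] _ assms(4-6)]) (auto simp: weak_time_deriv_def)
qed

lemma Hk_time_in_L2: "Hk_time k T \<Omega> Z \<Longrightarrow> j < k \<Longrightarrow> t \<in> {0..T} \<Longrightarrow> Z j t \<in> L2 \<Omega>"
  by (simp add: Hk_time_def continuous_in_time_def)

lemma Hk_time_L2L2: "Hk_time k T \<Omega> Z \<Longrightarrow> j < k \<Longrightarrow> Z (Suc j) \<in> L2L2 T \<Omega>"
  by (simp add: Hk_time_def weak_time_deriv_def)

text \<open>The pairings of order 0 and 1 have continuous weak derivatives and are thus classically
  differentiable. The derivative of order 3 is only square integrable; it appears through the
  increments of the pairing of order 2, which bound its oscillation.\<close>

lemma trapezoid_error_Hk_time:
  assumes U: "Hk_time 3 T \<Omega> U" and w: "w \<in> L2 \<Omega>" and ab: "0 \<le> a" "a \<le> b" "b \<le> T"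
  shows "\<bar>l2_inner \<Omega> (U 0 b) w - l2_inner \<Omega> (U 0 a) w
      - (b - a) / 2 * (l2_inner \<Omega> (U 1 b) w + l2_inner \<Omega> (U 1 a) w)\<bar>
    \<le> (b - a)\<^sup>2 / 2 * ((LINT t|lebesgue_on {0<..<T}. indicator {a<..b} t * l2_norm \<Omega> (U 3 t)) * l2_norm \<Omega> w)"
proof -
  let ?M = "lebesgue_on {0<..<T}"
  define g where "g j t = l2_inner \<Omega> (U j t) w" for j t
  have inc: "g j y - g j x = (LINT t|?M. indicator {x<..y} t * g (Suc j) t)"
    if "j < 3" "0 \<le> x" "x \<le> y" "y \<le> T" for j x y
    unfolding g_def by (rule Hk_time_inner_increment[OF U that(1) w that(2-4)])
  have cont: "continuous_on {0..T} (g j)" if "j < 3" for j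
    unfolding g_def using U that w by (intro continuous_in_time_inner) (auto simp: Hk_time_def)
  have der: "(g j has_real_derivative g (Suc j) t) (at t within {a..b})" if "Suc j < 3" "t \<in> {a..b}" for j t
  proof -
    have "(g j has_real_derivative g (Suc j) t) (at t within {0..T})"
      using that ab by (intro DERIV_of_increments cont inc) auto
    then show ?thesis by (rule DERIV_subset) (use ab in auto)
  qed
  have U3: "U 3 \<in> L2L2 T \<Omega>" using Hk_time_L2L2[OF U, of 2] by simp
  note cut = integrable_indicator_mult_lebesgue_on
  have J: "\<bar>g 2 x - g 2 y\<bar> \<le> (LINT t|?M. indicator {a<..b} t * l2_norm \<Omega> (U 3 t)) * l2_norm \<Omega> w"
    if "x \<in> {a..b}" "y \<in> {a..b}" "x \<le> y" for x y
  proof -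
    have "\<bar>g 2 y - g 2 x\<bar> = \<bar>LINT t|?M. indicator {x<..y} t * g 3 t\<bar>"
      using inc[of 2 x y] that ab by simp
    also have "\<dots> \<le> (LINT t|?M. \<bar>indicator {x<..y} t * g 3 t\<bar>)"
      by (rule integral_abs_bound)
    also have "\<dots> \<le> (LINT t|?M. indicator {a<..b} t * (l2_norm \<Omega> (U 3 t) * l2_norm \<Omega> w))"
    proof (rule integral_mono_AE)
      show "integrable ?M (\<lambda>t. \<bar>indicator {x<..y} t * g 3 t\<bar>)"
        unfolding g_def by (intro Bochner_Integration.integrable_abs cut L2L2_inner_integrable U3 w) simp
      show "integrable ?M (\<lambda>t. indicator {a<..b} t * (l2_norm \<Omega> (U 3 t) * l2_norm \<Omega> w))"
        by (intro cut Bochner_Integration.integrable_mult_left L2L2_norm_integrable U3) simp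
      show "AE t in ?M. \<bar>indicator {x<..y} t * g 3 t\<bar> \<le> indicator {a<..b} t * (l2_norm \<Omega> (U 3 t) * l2_norm \<Omega> w)"
        using L2L2_inner_bound[OF U3 w]
        by eventually_elim (use that in \<open>auto simp: indicator_def g_def l2_norm_nonneg\<close>)
    qed
    also have "\<dots> = (LINT t|?M. indicator {a<..b} t * l2_norm \<Omega> (U 3 t)) * l2_norm \<Omega> w"
      by (simp flip: mult.assoc)
    finally show ?thesis by (simp add: abs_minus_commute)
  qed
  have "\<bar>g 0 b - g 0 a - (b - a) / 2 * (g 1 b + g 1 a)\<bar>
      \<le> (b - a)\<^sup>2 / 2 * ((LINT t|?M. indicator {a<..b} t * l2_norm \<Omega> (U 3 t)) * l2_norm \<Omega> w)"
  proof (rule trapezoid_error[of a b "g 0" "g 1" "g 2"])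
    show "(g 0 has_real_derivative g 1 t) (at t within {a..b})" if "t \<in> {a..b}" for t
      using der[of 0 t] that by simp
    show "(g 1 has_real_derivative g 2 t) (at t within {a..b})" if "t \<in> {a..b}" for t
      using der[of 1 t] that by (simp add: numeral_2_eq_2)
    show "\<bar>g 2 x - g 2 y\<bar> \<le> (LINT t|?M. indicator {a<..b} t * l2_norm \<Omega> (U 3 t)) * l2_norm \<Omega> w"
      if "x \<in> {a..b}" "y \<in> {a..b}" for x y
      using J[of x y] J[of y x] that by (cases "x \<le> y") (auto simp: abs_minus_commute)
  qed (rule ab)
  then show ?thesis by (simp add: g_def)
qed

section \<open>Consistency of the trapezoidal rule on the grid\<close>

lemma grid_in_interval: "k \<le> N \<Longrightarrow> 1 \<le> N \<Longrightarrow> 0 \<le> T \<Longrightarrow> grid T N k \<in> {0..T}"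
  using mult_right_mono[of "real k" "real N" T] by (simp add: grid_def divide_le_eq mult.commute)

text \<open>Testing the trapezoid error with the consistency error \<open>\<tau>\<close> itself.\<close>

lemma trapezoid_consistency:
  assumes U: "Hk_time 3 T \<Omega> U" and T: "0 < T" "1 \<le> N" and dt: "dt = T / real N"
  defines "\<tau> \<equiv> \<lambda>n x. diff_quot dt (\<lambda>k. U 0 (grid T N k)) n x - half_avg (\<lambda>k. U 1 (grid T N k)) n x"
  shows "\<And>n. n < N \<Longrightarrow> \<tau> n \<in> L2 \<Omega>"
    and "dt * (\<Sum>n<N. l2_inner \<Omega> (\<tau> n) (\<tau> n)) \<le> dt ^ 4 * (L2L2_norm T \<Omega> (U 3))\<^sup>2"
proof -
  let ?M = "lebesgue_on {0<..<T}"
  interpret R: real_semi_inner "L2 \<Omega>" "l2_inner \<Omega> :: ('a \<Rightarrow> real) \<Rightarrow> _" by (rule L2_real_semi_inner)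
  have dtp: "0 < dt" "dt * real N = T" using T dt by auto
  have gr: "grid T N k = real k * dt" for k by (simp add: grid_def dt)
  have grI: "grid T N k \<in> {0..T}" if "k \<le> N" for k
    using that T by (intro grid_in_interval) auto
  have UL: "U j (grid T N k) \<in> L2 \<Omega>" if "j < 3" "k \<le> N" for j k
    by (rule Hk_time_in_L2[OF U that(1) grI[OF that(2)]])
  have DQ: "diff_quot dt (\<lambda>k. U 0 (grid T N k)) n \<in> L2 \<Omega>" and HA: "half_avg (\<lambda>k. U 1 (grid T N k)) n \<in> L2 \<Omega>"
    if "n < N" for n
    using R.diff_quot_mem[of N "\<lambda>k. U 0 (grid T N k)" n dt] R.half_avg_mem[of N "\<lambda>k. U 1 (grid T N k)" n] UL that
    by auto
  show tau: "\<tau> n \<in> L2 \<Omega>" if "n < N" for n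
    unfolding \<tau>_def by (intro L2.diff DQ HA that)
  have U3: "U 3 \<in> L2L2 T \<Omega>" using Hk_time_L2L2[OF U, of 2] by simp
  define I where "I n = (indicator {grid T N n<..grid T N (Suc n)} :: real \<Rightarrow> real)" for n
  have Im: "I n \<in> borel_measurable ?M" for n
    unfolding I_def by (rule indicator_measurable_lebesgue_on) simp
  have IL: "I n \<in> L2 {0<..<T}" for n
    by (rule L2_of_bounded[OF _ _ Im, where c = 1]) (auto simp: open_in_lebesgue I_def indicator_def)
  have IUL: "(\<lambda>t. I n t * l2_norm \<Omega> (U 3 t)) \<in> L2 {0<..<T}" for n
  proof (rule L2_bound[OF L2_integrable_norm[OF L2L2_norm_in_L2[OF U3]]])
    show "(\<lambda>t. I n t * l2_norm \<Omega> (U 3 t)) \<in> borel_measurable ?M"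
      by (intro borel_measurable_times Im L2_measurable L2L2_norm_in_L2 U3)
  qed (auto simp: I_def indicator_def)
  have I2: "I n t * I n t = I n t" for n t by (simp add: I_def indicator_def)
  define Q where "Q n = (LINT t|?M. I n t * (l2_norm \<Omega> (U 3 t))\<^sup>2)" for n
  have Qi: "integrable ?M (\<lambda>t. I n t * (l2_norm \<Omega> (U 3 t))\<^sup>2)" for n
    using L2_integrable_mult[OF IUL[of n] L2L2_norm_in_L2[OF U3]] by (simp add: power2_eq_square mult.assoc)
  \<comment> \<open>The self-pairing gives a norm of at most dt / 2 times A, the integral of the
    norm of \<open>U 3\<close> over the step, and A^2 is at most dt * Q n. The factor 1/4 is
    dropped; the weight dt of the final sum supplies the fourth power.\<close>
  have each: "l2_inner \<Omega> (\<tau> n) (\<tau> n) \<le> dt ^ 3 * Q n" if n: "n < N" for n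
  proof -
    define a b where "a = grid T N n" and "b = grid T N (Suc n)"
    have ab: "0 \<le> a" "a \<le> b" "b \<le> T" "b - a = dt"
      using grI[of n] grI[of "Suc n"] n dtp by (auto simp: a_def b_def gr algebra_simps)
    have Iab: "I n = indicator {a<..b}" by (simp add: I_def a_def b_def)
    define A where "A = (LINT t|?M. I n t * l2_norm \<Omega> (U 3 t))"
    have A0: "0 \<le> A" unfolding A_def
      by (intro Bochner_Integration.integral_nonneg) (auto simp: I_def l2_norm_nonneg)
    have t: "\<tau> n \<in> L2 \<Omega>" by (rule tau[OF n])
    have "dt * l2_inner \<Omega> (\<tau> n) (\<tau> n)
        = l2_inner \<Omega> (U 0 b) (\<tau> n) - l2_inner \<Omega> (U 0 a) (\<tau> n)
          - dt / 2 * (l2_inner \<Omega> (U 1 b) (\<tau> n) + l2_inner \<Omega> (U 1 a) (\<tau> n))"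
    proof -
      have "l2_inner \<Omega> (\<tau> n) (\<tau> n) = l2_inner \<Omega>
          (\<lambda>x. diff_quot dt (\<lambda>k. U 0 (grid T N k)) n x - half_avg (\<lambda>k. U 1 (grid T N k)) n x) (\<tau> n)"
        by (simp add: \<tau>_def)
      also have "\<dots> = l2_inner \<Omega> (diff_quot dt (\<lambda>k. U 0 (grid T N k)) n) (\<tau> n)
          - l2_inner \<Omega> (half_avg (\<lambda>k. U 1 (grid T N k)) n) (\<tau> n)"
        by (rule L2.diff_left[OF DQ[OF n] HA[OF n] t])
      also have "l2_inner \<Omega> (diff_quot dt (\<lambda>k. U 0 (grid T N k)) n) (\<tau> n)
          = (l2_inner \<Omega> (U 0 b) (\<tau> n) - l2_inner \<Omega> (U 0 a) (\<tau> n)) / dt"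
        unfolding a_def b_def by (rule R.diff_quot_left[OF UL n t]) simp_all
      also have "l2_inner \<Omega> (half_avg (\<lambda>k. U 1 (grid T N k)) n) (\<tau> n)
          = (l2_inner \<Omega> (U 1 b) (\<tau> n) + l2_inner \<Omega> (U 1 a) (\<tau> n)) / 2"
        unfolding a_def b_def by (rule R.half_avg_left[OF UL n t]) simp_all
      finally have *: "l2_inner \<Omega> (\<tau> n) (\<tau> n)
          = (l2_inner \<Omega> (U 0 b) (\<tau> n) - l2_inner \<Omega> (U 0 a) (\<tau> n)) / dt
            - (l2_inner \<Omega> (U 1 b) (\<tau> n) + l2_inner \<Omega> (U 1 a) (\<tau> n)) / 2" .
      show ?thesis unfolding * using dtp(1) by (simp add: field_simps)
    qed
    also have "\<dots> \<le> dt\<^sup>2 / 2 * (A * l2_norm \<Omega> (\<tau> n))"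
      using trapezoid_error_Hk_time[OF U t ab(1-3)] unfolding ab(4) A_def Iab by linarith
    finally have "dt * (l2_norm \<Omega> (\<tau> n) * l2_norm \<Omega> (\<tau> n)) \<le> dt * (dt / 2 * A * l2_norm \<Omega> (\<tau> n))"
      unfolding l2_norm_squared[symmetric] by (simp add: power2_eq_square mult_ac)
    then have "l2_norm \<Omega> (\<tau> n) * l2_norm \<Omega> (\<tau> n) \<le> dt / 2 * A * l2_norm \<Omega> (\<tau> n)"
      using dtp(1) by simp
    then have "l2_norm \<Omega> (\<tau> n) \<le> dt / 2 * A"
      using l2_norm_nonneg[of \<Omega> "\<tau> n"] A0 dtp(1)
      by (cases "l2_norm \<Omega> (\<tau> n) = 0") (auto simp: mult_le_cancel_right)
    then have "(l2_norm \<Omega> (\<tau> n))\<^sup>2 \<le> (dt / 2 * A)\<^sup>2"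
      using l2_norm_nonneg by (rule power_mono)
    also have "\<dots> = dt\<^sup>2 / 4 * A\<^sup>2" by (simp add: power_mult_distrib power_divide)
    also have "\<dots> \<le> dt\<^sup>2 / 4 * (dt * Q n)"
    proof (intro mult_left_mono)
      \<comment> \<open>Since \<open>I n\<close> is its own square, it can be placed in both
        factors. Cauchy-Schwarz then keeps the integral of \<open>U 3\<close> local to the step, and
        the other factor is at most its length.\<close>
      have "A = l2_inner {0<..<T} (I n) (\<lambda>t. I n t * l2_norm \<Omega> (U 3 t))"
        by (simp add: A_def l2_inner_def I2 flip: mult.assoc)
      then have "A\<^sup>2 \<le> l2_inner {0<..<T} (I n) (I n)
          * l2_inner {0<..<T} (\<lambda>t. I n t * l2_norm \<Omega> (U 3 t)) (\<lambda>t. I n t * l2_norm \<Omega> (U 3 t))"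
        using L2.Cauchy_Schwarz[OF IL IUL, of n n] by simp
      also have "l2_inner {0<..<T} (\<lambda>t. I n t * l2_norm \<Omega> (U 3 t)) (\<lambda>t. I n t * l2_norm \<Omega> (U 3 t)) = Q n"
      proof -
        have *: "(I n t * l2_norm \<Omega> (U 3 t)) * (I n t * l2_norm \<Omega> (U 3 t)) = I n t * (l2_norm \<Omega> (U 3 t))\<^sup>2" for t
          using I2[of n t] by (simp add: power2_eq_square I_def indicator_def)
        show ?thesis unfolding l2_inner_def Q_def inner_real_def * ..
      qed
      finally have A2: "A\<^sup>2 \<le> l2_inner {0<..<T} (I n) (I n) * Q n" .
      have "l2_inner {0<..<T} (I n) (I n) = (LINT t|lebesgue. indicator {0<..<T} t * I n t)"
        by (simp add: l2_inner_def I2 integral_restrict_space open_in_lebesgue)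
      also have "\<dots> = (LINT t|lebesgue. indicator ({0<..<T} \<inter> {a<..b}) t)"
        by (simp add: I_def a_def b_def indicator_inter_arith)
      also have "\<dots> = measure lebesgue ({0<..<T} \<inter> {a<..b})" by simp
      also have "\<dots> \<le> measure lebesgue {a<..b}"
        by (intro measure_mono_fmeasurable) (auto simp: sets_completionI_sets bounded_set_imp_lmeasurable)
      also have "\<dots> = dt" using ab by simp
      finally have "l2_inner {0<..<T} (I n) (I n) \<le> dt" .
      moreover have "0 \<le> Q n" unfolding Q_def
        by (intro Bochner_Integration.integral_nonneg) (auto simp: I_def)
      ultimately show "A\<^sup>2 \<le> dt * Q n" using A2 mult_right_mono order_trans by blast
    qed simp
    also have "\<dots> \<le> dt ^ 3 * Q n"
    proof -
      have "0 \<le> Q n" unfolding Q_def by (intro Bochner_Integration.integral_nonneg) (auto simp: I_def)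
      then have "0 \<le> dt ^ 3 * Q n" using dtp(1) by simp
      then show ?thesis by (simp add: power2_eq_square power3_eq_cube)
    qed
    finally show ?thesis by (simp add: l2_norm_squared)
  qed
  have "(\<Sum>n<N. Q n) = (LINT t|?M. (\<Sum>n<N. I n t * (l2_norm \<Omega> (U 3 t))\<^sup>2))"
    unfolding Q_def by (intro Bochner_Integration.integral_sum[symmetric] Qi)
  also have "\<dots> \<le> (LINT t|?M. (l2_norm \<Omega> (U 3 t))\<^sup>2)"
  proof (rule integral_mono)
    show "integrable ?M (\<lambda>t. \<Sum>n<N. I n t * (l2_norm \<Omega> (U 3 t))\<^sup>2)"
      by (intro Bochner_Integration.integrable_sum Qi)
    show "integrable ?M (\<lambda>t. (l2_norm \<Omega> (U 3 t))\<^sup>2)" using U3 by (simp add: L2L2_def)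
    fix t assume "t \<in> space ?M"
    \<comment> \<open>The half-open cells are disjoint; as differences of indicators of half-lines
      they telescope.\<close>
    have "(\<Sum>n<N. I n t) = (\<Sum>n<N. indicator {..grid T N (Suc n)} t - indicator {..grid T N n} t)"
      using dtp(1) by (intro sum.cong refl) (auto simp: I_def indicator_def gr algebra_simps)
    also have "\<dots> = indicator {..grid T N N} t - indicator {..grid T N 0} t"
      by (rule sum_lessThan_telescope)
    also have "\<dots> \<le> 1" by (simp add: indicator_def)
    finally have "(\<Sum>n<N. I n t) * (l2_norm \<Omega> (U 3 t))\<^sup>2 \<le> 1 * (l2_norm \<Omega> (U 3 t))\<^sup>2"
      by (rule mult_right_mono) simp
    then show "(\<Sum>n<N. I n t * (l2_norm \<Omega> (U 3 t))\<^sup>2) \<le> (l2_norm \<Omega> (U 3 t))\<^sup>2"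
      by (simp add: sum_distrib_right)
  qed
  finally have QS: "(\<Sum>n<N. Q n) \<le> (L2L2_norm T \<Omega> (U 3))\<^sup>2" by (simp add: L2L2_norm_squared)
  have "dt * (\<Sum>n<N. l2_inner \<Omega> (\<tau> n) (\<tau> n)) \<le> dt * (\<Sum>n<N. dt ^ 3 * Q n)"
    using each dtp(1) by (intro mult_left_mono sum_mono) auto
  also have "\<dots> = dt ^ 4 * (\<Sum>n<N. Q n)" by (simp add: sum_distrib_left eval_nat_numeral mult.assoc)
  also have "\<dots> \<le> dt ^ 4 * (L2L2_norm T \<Omega> (U 3))\<^sup>2" using QS by (intro mult_left_mono) auto
  finally show "dt * (\<Sum>n<N. l2_inner \<Omega> (\<tau> n) (\<tau> n)) \<le> dt ^ 4 * (L2L2_norm T \<Omega> (U 3))\<^sup>2" .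
qed

section \<open>The error estimate\<close>

context bounded_open_set
begin

lemma snapshots_in_H10:
  assumes "\<And>t. t \<in> {0..T} \<Longrightarrow> u t \<in> H10 \<Omega>" "0 < T" "1 \<le> N" "j < 2 * N + 1"
  shows "snapshots T N u j \<in> H10 \<Omega>"
proof -
  interpret a: real_semi_inner "H10 \<Omega>" "h10_inner \<Omega>" by (rule H10_real_semi_inner)
  have g: "u (grid T N k) \<in> H10 \<Omega>" if "k \<le> N" for k
    using that assms(2,3) by (intro assms(1) grid_in_interval) auto
  show ?thesis
  proof (cases "j \<le> N")
    case False
    then have "j - N - 1 < N" using assms(4) by simp
    then show ?thesis using a.diff_quot_mem[of N "\<lambda>n. u (grid T N n)" "j - N - 1" "T / real N"] g False
      by (simp add: snapshots_def)
  qed (simp add: snapshots_def g)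
qed

text \<open>The form h leaves the Hilbert space of the decomposition open, and Q stands for any
  bound of the consistency error, so both cases of the theorem are instances. The last conclusion
  converts the first two into the bounds for the gradient-based decomposition.\<close>

lemma cn_pod_rom_error:
  fixes U F :: "nat \<Rightarrow> real \<Rightarrow> 'a \<Rightarrow> real" and z :: "nat \<Rightarrow> real Matrix.vec"
  assumes U: "Hk_time 3 T \<Omega> U" and F: "Hk_time 2 T \<Omega> F" and pos: "0 < \<nu>" "0 < T" "1 \<le> N"
    and X: "\<forall>t\<in>{0..T}. U 0 t \<in> H10 \<Omega>"
    and heat: "\<forall>t\<in>{0..T}. \<forall>w\<in>H10 \<Omega>.
       l2_inner \<Omega> (U 1 t) w + \<nu> * h10_inner \<Omega> (U 0 t) w = l2_inner \<Omega> (F 0 t) w"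
    and W: "real_semi_inner W h" and sub: "H10 \<Omega> \<subseteq> W"
    and nl: "\<forall>w\<in>H10 \<Omega>. h w w = 0 \<longleftrightarrow> h10_inner \<Omega> w w = 0"
    and es: "ordered_eigensystem (pod_matrix h N (snapshots T N (U 0))) lam z"
    and r: "r \<le> pod_rank N lam"
    and cn: "cn_rom \<Omega> \<nu> T N (F 0) (pod_space (pod_mode N (snapshots T N (U 0)) lam z) r) ur"
    and Q: "(T / real N) ^ 4 * (L2L2_norm T \<Omega> (U 3))\<^sup>2 \<le> Q"
  defines "\<phi> \<equiv> pod_mode N (snapshots T N (U 0)) lam z"
    and "R \<equiv> ritz \<Omega> (pod_space (pod_mode N (snapshots T N (U 0)) lam z) r)"
    and "s \<equiv> pod_rank N lam" and "dt \<equiv> T / real N"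
    and "e \<equiv> \<lambda>k x. U 0 (grid T N k) x - ur k x"
    and "C \<equiv> 8 + 12 * T\<^sup>2 + 6 * T + (2 + 3 / \<nu>) * (2 + 12 * T\<^sup>2 + 4 * T)"
  defines "\<rho> \<equiv> \<lambda>i x. \<phi> i x - R (\<phi> i) x"
    and "p0 \<equiv> (l2_norm \<Omega> (\<lambda>x. ur 0 x - R (U 0 0) x))\<^sup>2"
  shows "\<And>k. k \<le> N \<Longrightarrow> (l2_norm \<Omega> (e k))\<^sup>2
      \<le> C * ((\<Sum>i=r+1..s. lam i * (l2_norm \<Omega> (\<rho> i))\<^sup>2) + (p0 + Q))"
    and "(l2_norm \<Omega> (e N))\<^sup>2 + dt * (\<Sum>n=0..<N. (l2_norm \<Omega> (wgrad \<Omega> (half_avg e n)))\<^sup>2)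
      \<le> C * ((\<Sum>i=r+1..s. lam i * ((l2_norm \<Omega> (\<rho> i))\<^sup>2 + (l2_norm \<Omega> (wgrad \<Omega> (\<rho> i)))\<^sup>2)) + (p0 + Q))"
    and "\<And>i. h = h10_inner \<Omega> \<Longrightarrow> i \<in> {r+1..s} \<Longrightarrow> \<rho> i = \<phi> i \<and> (l2_norm \<Omega> (wgrad \<Omega> (\<phi> i)))\<^sup>2 = 1"
proof -
  let ?v = "snapshots T N (U 0)"
  interpret m: real_semi_inner "L2 \<Omega>" "l2_inner \<Omega> :: ('a \<Rightarrow> real) \<Rightarrow> _" by (rule L2_real_semi_inner)
  interpret a: real_semi_inner "H10 \<Omega>" "h10_inner \<Omega>" by (rule H10_real_semi_inner)
  note PR = pod_rom_of_eigensystem[OF H10_two_forms W subsetD[OF sub] bspec[OF nl] snapshots_in_H10[OF bspec[OF X] pos(2,3)] es r]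
  interpret P: pod_rom "L2 \<Omega>" "H10 \<Omega>" "l2_inner \<Omega>" "h10_inner \<Omega>" "2 * N + 1" s r ?v lam "\<lambda>i. vec_index (z i)" \<phi>
    using PR(1) unfolding \<phi>_def s_def by simp
  have R: "P.R w = R w" for w
    unfolding P.R_def unfolding R_def ritz_def h10_inner_def \<phi>_def ..
  have eta: "P.eta (\<phi> i) = \<rho> i" for i
    by (simp add: P.eta_def \<rho>_def R)
  define us where "us n = U 0 (grid T N n)" for n
  have gr: "grid T N k \<in> {0..T}" if "k \<le> N" for k
    using that pos by (intro grid_in_interval) auto
  have us: "us n = ?v n" if "n \<le> N" for n using that by (simp add: us_def snapshots_def)
  have dq: "?v (N + 1 + n) = diff_quot dt us n" if "n < N" for n
    by (simp add: snapshots_def dt_def us_def[abs_def])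
  have ur: "ur n \<in> P.Xr" if "n \<le> N" for n using cn that by (simp add: cn_rom_def \<phi>_def)
  define \<tau> where "\<tau> n x = diff_quot dt (\<lambda>k. U 0 (grid T N k)) n x - half_avg (\<lambda>k. U 1 (grid T N k)) n x" for n x
  note tc = trapezoid_consistency[OF U pos(2,3) dt_def[THEN meta_eq_to_obj_eq], folded \<tau>_def]
  have Q': "dt * (\<Sum>n<N. l2_inner \<Omega> (\<tau> n) (\<tau> n)) \<le> Q" using tc(2) Q by (simp add: dt_def)
  have U1: "U 1 (grid T N k) \<in> L2 \<Omega>" "F 0 (grid T N k) \<in> L2 \<Omega>" "us k \<in> H10 \<Omega>" if "k \<le> N" for k
    using Hk_time_in_L2[OF U, of 1] Hk_time_in_L2[OF F, of 0] gr[OF that] X by (auto simp: us_def)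
  \<comment> \<open>By definition of \<open>\<tau>\<close>, the averaged time derivative is the
    difference quotient minus \<open>\<tau> n\<close>; substituting this into the averaged heat
    equation gives the form that \<open>rom_error\<close> expects.\<close>
  have eq: "l2_inner \<Omega> (diff_quot dt ur n) w + \<nu> * h10_inner \<Omega> (half_avg ur n) w
      = l2_inner \<Omega> (diff_quot dt us n) w - l2_inner \<Omega> (\<tau> n) w + \<nu> * h10_inner \<Omega> (half_avg us n) w"
    if n: "n < N" and w: "w \<in> P.Xr" for n w
  proof -
    have wX: "w \<in> H10 \<Omega>" "w \<in> L2 \<Omega>" using P.Xr_sub[OF w] H10_L2 by auto
    have nN: "n \<le> N" "Suc n \<le> N" using n by auto
    have 1: "l2_inner \<Omega> (diff_quot dt ur n) w + \<nu> * h10_inner \<Omega> (half_avg ur n) w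
        = l2_inner \<Omega> (half_avg (\<lambda>k. F 0 (grid T N k)) n) w"
      using cn n w by (simp add: cn_rom_def h10_inner_def dt_def \<phi>_def)
    have 2: "l2_inner \<Omega> (half_avg (\<lambda>k. F 0 (grid T N k)) n) w
        = (l2_inner \<Omega> (F 0 (grid T N (Suc n))) w + l2_inner \<Omega> (F 0 (grid T N n)) w) / 2"
      by (rule m.half_avg_left[OF U1(2) n wX(2)]) simp_all
    have 3: "l2_inner \<Omega> (half_avg (\<lambda>k. U 1 (grid T N k)) n) w
        = (l2_inner \<Omega> (U 1 (grid T N (Suc n))) w + l2_inner \<Omega> (U 1 (grid T N n)) w) / 2"
      by (rule m.half_avg_left[OF U1(1) n wX(2)]) simp_all
    have 4: "h10_inner \<Omega> (half_avg us n) w = (h10_inner \<Omega> (us (Suc n)) w + h10_inner \<Omega> (us n) w) / 2"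
      by (rule a.half_avg_left[OF U1(3) n wX(1)]) simp_all
    have us_L2: "us k \<in> L2 \<Omega>" if "k \<le> N" for k using U1(3)[OF that] by (rule H10_L2)
    have D: "diff_quot dt us n \<in> L2 \<Omega>" "half_avg (\<lambda>k. U 1 (grid T N k)) n \<in> L2 \<Omega>"
      using m.diff_quot_mem[of N us n dt] m.half_avg_mem[of N "\<lambda>k. U 1 (grid T N k)" n] us_L2 U1(1) n by auto
    have "\<tau> n = (\<lambda>x. diff_quot dt us n x - half_avg (\<lambda>k. U 1 (grid T N k)) n x)"
      by (simp add: fun_eq_iff \<tau>_def us_def[abs_def])
    then have 5: "l2_inner \<Omega> (\<tau> n) w = l2_inner \<Omega> (diff_quot dt us n) w - l2_inner \<Omega> (half_avg (\<lambda>k. U 1 (grid T N k)) n) w"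
      using L2.diff_left[OF D wX(2)] by simp
    show ?thesis
      unfolding 1 2 5 3 4 us_def
      using heat[rule_format, OF gr[OF nN(1)] wX(1)] heat[rule_format, OF gr[OF nN(2)] wX(1)] by (simp add: field_simps)
  qed
  have e: "e = (\<lambda>k x. us k x - ur k x)" by (simp add: e_def us_def)
  have us0: "us 0 = U 0 0" by (simp add: us_def grid_def)
  have p0: "p0 = l2_inner \<Omega> (\<lambda>x. ur 0 x - R (us 0) x) (\<lambda>x. ur 0 x - R (us 0) x)"
    by (simp add: p0_def l2_norm_squared us0)
  note re = P.rom_error[OF refl pos(3,2,1) dt_def[THEN meta_eq_to_obj_eq] us dq ur tc(1) eq Q', unfolded eta R,
      folded p0 e C_def]
  have hn: "(l2_norm \<Omega> (wgrad \<Omega> w))\<^sup>2 = h10_inner \<Omega> w w" for w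
    by (simp add: l2_norm_squared h10_inner_def)
  show "(l2_norm \<Omega> (e k))\<^sup>2 \<le> C * ((\<Sum>i=r+1..s. lam i * (l2_norm \<Omega> (\<rho> i))\<^sup>2) + (p0 + Q))" if "k \<le> N" for k
    using re(1) that unfolding l2_norm_squared e by (simp add: add.assoc)
  show "(l2_norm \<Omega> (e N))\<^sup>2 + dt * (\<Sum>n=0..<N. (l2_norm \<Omega> (wgrad \<Omega> (half_avg e n)))\<^sup>2)
      \<le> C * ((\<Sum>i=r+1..s. lam i * ((l2_norm \<Omega> (\<rho> i))\<^sup>2 + (l2_norm \<Omega> (wgrad \<Omega> (\<rho> i)))\<^sup>2)) + (p0 + Q))"
    using re(2) unfolding hn unfolding l2_norm_squared e
    by (simp add: add.assoc distrib_left sum.distrib atLeast0LessThan)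
  fix i assume h: "h = h10_inner \<Omega>" and i: "i \<in> {r+1..s}"
  have i1: "i \<in> {1..s}" using i by auto
  have on: "h10_inner \<Omega> (\<phi> j) (\<phi> l) = (if j = l then 1 else 0)" if "j \<in> {1..s}" "l \<in> {1..s}" for j l
    using PR(2)[of j l] that h unfolding \<phi>_def s_def by simp
  \<comment> \<open>When the decomposition uses the gradient form, the tail modes are orthogonal, in
    the very form defining the Ritz projection, to the span of the first r modes.\<close>
  have "P.R (\<phi> i) = (\<lambda>x. 0)"
  proof (rule P.R_orthogonal)
    show "\<phi> i \<in> H10 \<Omega>" by (rule P.phi_in[OF i1])
    fix u assume "u \<in> P.Xr"
    then obtain c where c: "u = (\<lambda>x. \<Sum>l=1..r. c l * \<phi> l x)" by (auto simp: pod_space_def)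
    have "h10_inner \<Omega> (\<phi> i) u = (\<Sum>l=1..r. c l * h10_inner \<Omega> (\<phi> i) (\<phi> l))"
      unfolding c using P.rs by (intro a.rsum_right P.phi_in i1) auto
    also have "\<dots> = 0" using i i1 P.rs by (intro sum.neutral) (auto simp: on)
    finally show "h10_inner \<Omega> (\<phi> i) u = 0" .
  qed
  then show "\<rho> i = \<phi> i \<and> (l2_norm \<Omega> (wgrad \<Omega> (\<phi> i)))\<^sup>2 = 1"
    using on[OF i1 i1] by (simp add: \<rho>_def R[symmetric] hn)
qed

end

theorem lemma4p3:
  fixes \<Omega> :: "'a::euclidean_space set"
    and \<nu> T :: real
    and U L F :: "nat \<Rightarrow> real \<Rightarrow> 'a \<Rightarrow> real"
    and u \<Delta>u f :: "real \<Rightarrow> 'a \<Rightarrow> real"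
    and I :: real
  defines "u \<equiv> U 0" and "\<Delta>u \<equiv> L 0" and "f \<equiv> F 0"
    and "I \<equiv> (L2L2_norm T \<Omega> (U 3))\<^sup>2 + (L2L2_norm T \<Omega> (L 2))\<^sup>2 + (L2L2_norm T \<Omega> (F 2))\<^sup>2"
  assumes dim: "DIM('a) \<in> {1, 2, 3}"
    and domain: "open \<Omega>" "connected \<Omega>" "\<Omega> \<noteq> {}" "bounded \<Omega>" "lipschitz_boundary \<Omega>"
    and pos: "0 < \<nu>" "0 < T"
    and u_reg: "Hk_time 3 T \<Omega> U"
    and lap_reg: "Hk_time 2 T \<Omega> L"
    and f_reg: "Hk_time 2 T \<Omega> F"
    and u_in_X: "\<forall>t\<in>{0..T}. u t \<in> H10 \<Omega>"
    and lap: "\<forall>t\<in>{0..T}. weak_laplacian \<Omega> (u t) (\<Delta>u t)"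
    and heat: "\<forall>t\<in>{0..T}. \<forall>v\<in>H10 \<Omega>.
       l2_inner \<Omega> (U 1 t) v + \<nu> * l2_inner \<Omega> (wgrad \<Omega> (u t)) (wgrad \<Omega> v) = l2_inner \<Omega> (f t) v"
  shows "\<exists>C>0. \<forall>N\<ge>1. \<forall>lam z r ur.
    (let dt = T / real N;
         v = snapshots T N u;
         s = pod_rank N lam;
         \<phi> = pod_mode N v lam z;
         Xr = pod_space \<phi> r;
         R = ritz \<Omega> Xr;
         \<rho> = (\<lambda>i x. \<phi> i x - R (\<phi> i) x);
         e = (\<lambda>k x. u (grid T N k) x - ur k x);
         \<phi>r0 = (\<lambda>x. ur 0 x - R (u 0) x);
         rest = (l2_norm \<Omega> \<phi>r0)\<^sup>2 + dt^4 * I;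
         maxerr = (MAX k\<in>{1..N}. (l2_norm \<Omega> (e k))\<^sup>2);
         energyerr = (l2_norm \<Omega> (e N))\<^sup>2
           + dt * (\<Sum>n=0..<N. (l2_norm \<Omega> (wgrad \<Omega> (half_avg e n)))\<^sup>2)
     in 1 \<le> r \<and> r \<le> s \<and> cn_rom \<Omega> \<nu> T N f Xr ur \<longrightarrow>
       (ordered_eigensystem (pod_matrix (l2_inner \<Omega>) N v) lam z \<longrightarrow>
          maxerr \<le> C * ((\<Sum>i=r+1..s. lam i * (l2_norm \<Omega> (\<rho> i))\<^sup>2) + rest) \<and>
          energyerr \<le> C * ((\<Sum>i=r+1..s. lam i *
              ((l2_norm \<Omega> (\<rho> i))\<^sup>2 + (l2_norm \<Omega> (wgrad \<Omega> (\<rho> i)))\<^sup>2)) + rest)) \<and>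
       (ordered_eigensystem (pod_matrix (h10_inner \<Omega>) N v) lam z \<longrightarrow>
          maxerr \<le> C * ((\<Sum>i=r+1..s. lam i * (l2_norm \<Omega> (\<phi> i))\<^sup>2) + rest) \<and>
          energyerr \<le> C * ((\<Sum>i=r+1..s. (1 + (l2_norm \<Omega> (\<phi> i))\<^sup>2) * lam i) + rest)))"
proof -
  interpret bounded_open_set \<Omega> using domain(1,4) by unfold_locales
  \<comment> \<open>The constant is fixed before N, the eigensystem, r and the discrete solution are
    introduced, and it involves T and \<nu> only.\<close>
  define C where "C = 8 + 12 * T\<^sup>2 + 6 * T + (2 + 3 / \<nu>) * (2 + 12 * T\<^sup>2 + 4 * T)"
  have "0 < C" unfolding C_def using pos by (intro add_pos_pos mult_pos_pos) auto
  have heat': "\<forall>t\<in>{0..T}. \<forall>w\<in>H10 \<Omega>. l2_inner \<Omega> (U 1 t) w + \<nu> * h10_inner \<Omega> (U 0 t) w = l2_inner \<Omega> (F 0 t) w"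
    using heat by (simp add: h10_inner_def u_def f_def)
  have sub: "H10 \<Omega> \<subseteq> L2 \<Omega>" and null: "\<forall>w\<in>H10 \<Omega>. l2_inner \<Omega> w w = 0 \<longleftrightarrow> h10_inner \<Omega> w w = 0"
    using H10_L2 H10_null_iff by auto
  have I: "(T / real N) ^ 4 * (L2L2_norm T \<Omega> (U 3))\<^sup>2 \<le> (T / real N) ^ 4 * I" for N
    by (intro mult_left_mono) (simp_all add: I_def)
  show ?thesis
  proof (intro exI[of _ C] conjI allI impI, goal_cases)
    case 1
    show ?case by fact
  next
    case (2 N lam z r ur)
    have max: "(MAX k\<in>{1..N}. g k) \<le> B" if "\<And>k. k \<le> N \<Longrightarrow> g k \<le> B" for g :: "nat \<Rightarrow> real" and B
      using 2 that by (subst Max_le_iff) auto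
    note main = cn_pod_rom_error[OF u_reg f_reg pos 2 u_in_X[unfolded u_def] heat' _ _ _ _ _ _ I, folded C_def]
    note L2 = main[OF L2_real_semi_inner sub null]
    note H10 = main[OF H10_real_semi_inner order_refl] 
    show ?case unfolding Let_def u_def f_def
    proof (rule impI, elim conjE, goal_cases)
      case A: 1
      show ?case
      proof (intro conjI impI, goal_cases)
        case es: 1
        show ?case by (rule max) (rule L2(1)[OF es A(2,3)])
      next
        case es: 2
        show ?case by (rule L2(2)[OF es A(2,3)])
      next
        case es: 3
        \<comment> \<open>The tail modes are their own projection errors, so the first general bound
          becomes the stated one.\<close>
        note H = H10[OF _ es A(2,3)]
        show ?case using H(1) H(3)[OF _ refl] by (intro max) simp
      next
        case es: 4
        \<comment> \<open>The gradient of each tail mode has norm 1, which contributes the summand 1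
          in the weights 1 + |\<phi>|^2.\<close>
        note H = H10[OF _ es A(2,3)]
        show ?case using H(2) H(3)[OF _ refl] by (simp add: mult.commute add.commute)
      qed
    qed
  qed
qed

end
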